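(* (1) Let $\Phi:H_n\to H_k$ be a unital trace-preserving linear map and $\Omega: H_m\to H_l$ a completely positive linear map. Then \[ \|\Phi\otimes\Omega\|_{1\to2}\leq\sqrt{\gamma(\Phi)}\,\|\Omega\|_{1\to2}, \] and, if moreover $\Phi$ and $\Omega$ are quantum channels, then for every $0\le\alpha\le2$, \[ S_{\min,\alpha}(\Phi\otimes\Omega)\geq-\log\gamma(\Phi)+S_{\min,2}(\Omega). \] (2) For any $N\in\mathbb N$ and unital quantum channels $\Phi_i:H_{n_i}\to H_{k_i}$, $i=1,\dots,N$, and every $0\le\alpha\le2$, \[ \left\|\bigotimes_{i=1}^N\Phi_i\right\|_{1\to2}\leq\prod_{i=1}^N\sqrt{\gamma(\Phi_i)}\qquad\text{and}\qquad S_{\min,\alpha}\left(\bigotimes_{i=1}^N\Phi_i\right)\geq-\sum_{i=1}^N\log\gamma(\Phi_i). \]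
   Context: $H_n$ is the real vector space of $n\times n$ Hermitian matrices with inner product ${\rm Tr}(XY)$, $H_{n,0}$ its traceless subspace, and $H_{n,+,1}$ the set of density matrices. A quantum channel is a completely positive trace-preserving map; a map $\Phi:H_n\to H_k$ is unital if $\Phi(I_n/n)=I_k/k$. For a linear map $\Phi$, $\|\Phi\|_{1\to2}=\max_{0\neq\rho}\|\Phi(\rho)\|_2/\|\rho\|_1$ over nonzero Hermitian $\rho$ (Schatten norms). The Rényi entropy is $S_\alpha(\sigma)=\frac1{1-\alpha}\log{\rm Tr}\,\sigma^\alpha$ (limits at $\alpha=0,1$; $S_1$ is the von Neumann entropy), and $S_{\min,\alpha}(\Phi)=\min_{\rho\in H_{n,+,1}}S_\alpha(\Phi(\rho))$ for a channel $\Phi$. For a unital trace-preserving $\Phi:H_n\to H_k$, fix an orthonormal basis $M_1,\dots,M_{n^2-1}$ of $H_{n,0}$, let $(A_\Phi)_{i,j}={\rm Tr}[\Phi(M_i)\Phi(M_j)]$ with largest eigenvalue $\|A_\Phi\|_\infty$ (basis independent), and set $\gamma(\Phi)=\frac1k+\left(1-\frac1n\right)\|A_\Phi\|_\infty$ if $n\ge k\|A_\Phi\|_\infty$ and $\gamma(\Phi)=\|A_\Phi\|_\infty$ otherwise. *)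

theory Defs
  imports Complex_Main "Jordan_Normal_Form.Matrix" "Jordan_Normal_Form.Char_Poly"
    "Jordan_Normal_Form.Schur_Decomposition"
begin

text \<open>Matrices are complex matrices of the Jordan_Normal_Form library; a (real-)linear map
  H_n -> H_k is modelled as a function on complex matrices, constrained only on H_n.\<close>

definition mtrace :: "complex mat \<Rightarrow> complex" where
  "mtrace A = (\<Sum>i<dim_row A. A $$ (i,i))"

definition herm :: "nat \<Rightarrow> complex mat set" where
  "herm n = {A \<in> carrier_mat n n. mat_adjoint A = A}"

definition herm0 :: "nat \<Rightarrow> complex mat set" where
  "herm0 n = {A \<in> herm n. mtrace A = 0}"

definition psd :: "nat \<Rightarrow> complex mat set" where
  "psd n = {A \<in> herm n. \<forall>v \<in> carrier_vec n. 0 \<le> Re ((A *\<^sub>v v) \<bullet>c v)}"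

definition density :: "nat \<Rightarrow> complex mat set" where
  "density n = {A \<in> psd n. mtrace A = 1}"

definition eigvals :: "complex mat \<Rightarrow> complex list" where
  "eigvals A = (SOME as. char_poly A = (\<Prod>a\<leftarrow>as. [:- a, 1:]) \<and> length as = dim_row A)"

definition schatten1 :: "complex mat \<Rightarrow> real" where
  "schatten1 A = (\<Sum>a\<leftarrow>eigvals (mat_adjoint A * A). sqrt (Re a))"

definition schatten2 :: "complex mat \<Rightarrow> real" where
  "schatten2 A = sqrt (Re (mtrace (mat_adjoint A * A)))"

definition herm_map :: "nat \<Rightarrow> nat \<Rightarrow> (complex mat \<Rightarrow> complex mat) \<Rightarrow> bool" where
  "herm_map n k \<Phi> \<longleftrightarrow>
     (\<forall>A \<in> herm n. \<Phi> A \<in> herm k) \<and>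
     (\<forall>A \<in> herm n. \<forall>B \<in> herm n. \<Phi> (A + B) = \<Phi> A + \<Phi> B) \<and>
     (\<forall>A \<in> herm n. \<forall>r::real. \<Phi> (complex_of_real r \<cdot>\<^sub>m A) = complex_of_real r \<cdot>\<^sub>m \<Phi> A)"

definition trace_preserving :: "nat \<Rightarrow> (complex mat \<Rightarrow> complex mat) \<Rightarrow> bool" where
  "trace_preserving n \<Phi> \<longleftrightarrow> (\<forall>A \<in> herm n. mtrace (\<Phi> A) = mtrace A)"

definition unital :: "nat \<Rightarrow> nat \<Rightarrow> (complex mat \<Rightarrow> complex mat) \<Rightarrow> bool" where
  "unital n k \<Phi> \<longleftrightarrow>
     \<Phi> (complex_of_real (1 / real n) \<cdot>\<^sub>m 1\<^sub>m n) = complex_of_real (1 / real k) \<cdot>\<^sub>m 1\<^sub>m k"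

text \<open>Complexification of a map on Hermitian matrices: X = H + i K with H, K Hermitian.\<close>
definition cplx :: "(complex mat \<Rightarrow> complex mat) \<Rightarrow> complex mat \<Rightarrow> complex mat" where
  "cplx \<Phi> X = \<Phi> ((1/2) \<cdot>\<^sub>m (X + mat_adjoint X)) + \<i> \<cdot>\<^sub>m \<Phi> ((- \<i>/2) \<cdot>\<^sub>m (X - mat_adjoint X))"

definition matunit :: "nat \<Rightarrow> nat \<Rightarrow> nat \<Rightarrow> complex mat" where
  "matunit n i j = mat n n (\<lambda>(p,q). if p = i \<and> q = j then 1 else 0)"

text \<open>Tensor product of maps Phi: M_n -> M_k and Omega: M_m -> M_l, on M_(n m) = M_n (x) M_m
  (Kronecker convention: index (i,a) is i*m+a), defined by linear extension of
  (Phi (x) Omega)(E_ij (x) E_ab) = Phi(E_ij) (x) Omega(E_ab).\<close>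
definition tensor_map :: "nat \<Rightarrow> nat \<Rightarrow> nat \<Rightarrow> nat \<Rightarrow> (complex mat \<Rightarrow> complex mat)
    \<Rightarrow> (complex mat \<Rightarrow> complex mat) \<Rightarrow> complex mat \<Rightarrow> complex mat" where
  "tensor_map n m k l \<Phi> \<Omega> X = mat (k*l) (k*l) (\<lambda>(r,s).
     \<Sum>i<n. \<Sum>j<n. \<Sum>a<m. \<Sum>b<m. X $$ (i*m+a, j*m+b)
        * cplx \<Phi> (matunit n i j) $$ (r div l, s div l)
        * cplx \<Omega> (matunit m a b) $$ (r mod l, s mod l))"

definition completely_positive :: "nat \<Rightarrow> nat \<Rightarrow> (complex mat \<Rightarrow> complex mat) \<Rightarrow> bool" where
  "completely_positive n k \<Phi> \<longleftrightarrow>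
     (\<forall>p>0. \<forall>P \<in> psd (p*n). tensor_map p n p k (\<lambda>X. X) \<Phi> P \<in> psd (p*k))"

definition quantum_channel :: "nat \<Rightarrow> nat \<Rightarrow> (complex mat \<Rightarrow> complex mat) \<Rightarrow> bool" where
  "quantum_channel n k \<Phi> \<longleftrightarrow> herm_map n k \<Phi> \<and> completely_positive n k \<Phi> \<and> trace_preserving n \<Phi>"

definition norm_1to2 :: "nat \<Rightarrow> (complex mat \<Rightarrow> complex mat) \<Rightarrow> real" where
  "norm_1to2 n \<Phi> = Sup {schatten2 (\<Phi> \<rho>) / schatten1 \<rho> | \<rho>. \<rho> \<in> herm n \<and> \<rho> \<noteq> 0\<^sub>m n n}"

text \<open>Renyi entropy (natural logarithm). For alpha = 0 the convention 0 powr 0 = 0 gives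
  log rank, the limit; alpha = 1 is the von Neumann entropy (0 ln 0 = 0).\<close>
definition renyi :: "real \<Rightarrow> complex mat \<Rightarrow> real" where
  "renyi \<alpha> \<sigma> = (if \<alpha> = 1 then - (\<Sum>a\<leftarrow>eigvals \<sigma>. Re a * ln (Re a))
                 else ln (\<Sum>a\<leftarrow>eigvals \<sigma>. Re a powr \<alpha>) / (1 - \<alpha>))"

definition S_min :: "nat \<Rightarrow> real \<Rightarrow> (complex mat \<Rightarrow> complex mat) \<Rightarrow> real" where
  "S_min n \<alpha> \<Phi> = Inf {renyi \<alpha> (\<Phi> \<rho>) | \<rho>. \<rho> \<in> density n}"

definition onb_traceless :: "nat \<Rightarrow> complex mat list \<Rightarrow> bool" where
  "onb_traceless n Ms \<longleftrightarrow> length Ms = n^2 - 1 \<and> set Ms \<subseteq> herm0 n \<and>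
     (\<forall>i<length Ms. \<forall>j<length Ms. mtrace (Ms!i * Ms!j) = (if i = j then 1 else 0))"

definition A_mat :: "nat \<Rightarrow> (complex mat \<Rightarrow> complex mat) \<Rightarrow> complex mat" where
  "A_mat n \<Phi> = (let Ms = (SOME Ms. onb_traceless n Ms) in
     mat (length Ms) (length Ms) (\<lambda>(i,j). mtrace (\<Phi> (Ms!i) * \<Phi> (Ms!j))))"

text \<open>Largest eigenvalue (A_Phi is real symmetric); 0 for the empty matrix.\<close>
definition lambda_max :: "complex mat \<Rightarrow> real" where
  "lambda_max A = (if eigvals A = [] then 0 else Max (Re ` set (eigvals A)))"

definition gamma :: "nat \<Rightarrow> nat \<Rightarrow> (complex mat \<Rightarrow> complex mat) \<Rightarrow> real" where
  "gamma n k \<Phi> = (let a = lambda_max (A_mat n \<Phi>) in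
     if real k * a \<le> real n then 1 / real k + (1 - 1 / real n) * a else a)"

fun tensor_family :: "nat \<Rightarrow> (nat \<Rightarrow> nat) \<Rightarrow> (nat \<Rightarrow> nat) \<Rightarrow> (nat \<Rightarrow> complex mat \<Rightarrow> complex mat)
    \<Rightarrow> complex mat \<Rightarrow> complex mat" where
  "tensor_family 0 nn kk Phi = (\<lambda>X. X)"
| "tensor_family (Suc N) nn kk Phi =
     tensor_map (\<Prod>i<N. nn i) (nn N) (\<Prod>i<N. kk i) (kk N) (tensor_family N nn kk Phi) (Phi N)"

end

theory Submission
  imports Defs "HOL-Analysis.L2_Norm"
begin

text \<open>By convexity it is enough to bound the output on pure states \<open>v v\<^sup>*\<close>. Write \<open>v = \<Sum>\<^sub>i e\<^sub>i \<otimes> w\<^sub>i\<close> and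
  \<open>T\<^sub>i\<^sub>j = \<Omega>(w\<^sub>i w\<^sub>j\<^sup>*)\<close>, the blocks of \<open>(id \<otimes> \<Omega>)(v v\<^sup>*)\<close>. Expanding a matrix \<open>X\<close> in an orthonormal basis of
  traceless Hermitian matrices completed by \<open>I/sqrt n\<close> gives, with \<open>a = \<parallel>A\<^sub>\<Phi>\<parallel>\<^sub>\<infinity>\<close>,
  \<open>\<parallel>\<Phi>(X)\<parallel>\<^sub>2\<^sup>2 \<le> (1/k - a/n) |Tr X|\<^sup>2 + a \<parallel>X\<parallel>\<^sub>2\<^sup>2\<close>. Applying this to the \<open>n \<times> n\<close> matrices
  \<open>(\<langle>r|T\<^sub>i\<^sub>j|s\<rangle>)\<^sub>i\<^sub>j\<close> and summing over \<open>r, s\<close> leaves \<open>\<parallel>\<Sum>\<^sub>i T\<^sub>i\<^sub>i\<parallel>\<^sub>2\<^sup>2\<close>, the output of \<open>\<Omega>\<close> on the reduced state, and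
  \<open>\<Sum>\<^sub>i\<^sub>j \<parallel>T\<^sub>i\<^sub>j\<parallel>\<^sub>2\<^sup>2\<close>. Both are at most \<open>\<parallel>\<Omega>\<parallel>\<^sup>2\<close>: complete positivity gives \<open>\<parallel>T\<^sub>i\<^sub>j\<parallel>\<^sub>2\<^sup>2 \<le> \<parallel>T\<^sub>i\<^sub>i\<parallel>\<^sub>2 \<parallel>T\<^sub>j\<^sub>j\<parallel>\<^sub>2\<close>. The entropy
  bounds follow since \<open>S\<^sub>\<alpha> \<ge> S\<^sub>2 = - log \<parallel>\<sigma>\<parallel>\<^sub>2\<^sup>2\<close> for \<open>\<alpha> \<le> 2\<close>.\<close>

section \<open>Spectral theorem\<close>

text \<open>The norm estimate and the entropy estimate measure \<open>\<Omega>\<close> by different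
  quantities, a supremum and an infimum. Both run through the single predicate
  \<open>pure_bound\<close>, a homogeneous inequality over unnormalised vectors with an explicit
  constant C: C is \<open>norm_1to2\<close> in the first case and exp(-S/2), with S the minimal
  2-entropy of \<open>\<Omega>\<close>, in the second. This avoids any question of attainment. The
  obstacle is that maps are given on Hermitian matrices only, while the off-diagonal blocks
  \<open>w\<^sub>i w\<^sub>j\<^sup>*\<close> are not Hermitian. Maps are therefore replaced by the
  coefficients of their complex-linear extensions and complete positivity by a Kraus form of these
  coefficients; the estimate for \<open>\<Phi>\<close> has to hold for arbitrary complex X, although
  the basis used for it is Hermitian. For N factors the induction carries, besides the bound, that
  the product so far is a channel: that product plays the role of \<open>\<Omega>\<close> and stands
  on the left, so the estimate is wanted for both orders of the factors.\<close>

definition delta :: "nat \<Rightarrow> nat \<Rightarrow> complex" where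
  "delta s t = (if s = t then 1 else 0)"

text \<open>Index functions in place of matrices: prepending an eigenvector or reading an index as a
  pair is then a plain function definition.\<close>

definition orthonormal_cols :: "nat \<Rightarrow> nat \<Rightarrow> (nat \<Rightarrow> nat \<Rightarrow> complex) \<Rightarrow> bool" where
  "orthonormal_cols n m U \<longleftrightarrow> (\<forall>s<m. \<forall>t<m. (\<Sum>i<n. cnj (U i s) * U i t) = delta s t)"

lemma sum_delta_left:
  "s < n \<Longrightarrow> (\<Sum>t<n. delta s t * f t) = f s" for f :: "nat \<Rightarrow> complex"
  by (simp add: delta_def if_distrib[of "\<lambda>x. x * _"] cong: if_cong)

lemma sum_delta_right:
  "s < n \<Longrightarrow> (\<Sum>t<n. f t * delta t s) = f s" for f :: "nat \<Rightarrow> complex"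
  by (simp add: delta_def if_distrib[of "\<lambda>x. _ * x"] cong: if_cong)

lemma cmod_sq: "cnj z * z = complex_of_real ((cmod z)\<^sup>2)" "z * cnj z = complex_of_real ((cmod z)\<^sup>2)"
  using complex_norm_square[of z] by (auto simp: mult.commute)

text \<open>For a square matrix a left inverse is a right inverse; this is the completeness relation
  behind the basis expansions below.\<close>

lemma orthonormal_rows:
  assumes "orthonormal_cols n n U" "i < n" "j < n"
  shows "(\<Sum>s<n. U i s * cnj (U j s)) = delta i j"
proof -
  define A where "A = mat n n (\<lambda>(s,i). cnj (U i s))"
  define B where "B = mat n n (\<lambda>(i,s). U i s)"
  have AB: "A \<in> carrier_mat n n" "B \<in> carrier_mat n n" by (auto simp: A_def B_def)
  have "A * B = 1\<^sub>m n"
    using assms(1) by (intro eq_matI) (auto simp: A_def B_def scalar_prod_def orthonormal_cols_def delta_def atLeast0LessThan)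
  then have "B * A = 1\<^sub>m n" using mat_mult_left_right_inverse[OF AB] by simp
  then have "(B * A) $$ (i,j) = 1\<^sub>m n $$ (i,j)" by simp
  then show ?thesis using assms(2,3)
    by (auto simp: A_def B_def scalar_prod_def delta_def atLeast0LessThan)
qed

lemma cscalar_self:
  "v \<in> carrier_vec n \<Longrightarrow> v \<bullet>c v = complex_of_real (\<Sum>i<n. (cmod (v $ i))\<^sup>2)"
  by (auto simp: scalar_prod_def atLeast0LessThan cmod_sq intro!: sum.cong)

text \<open>Basis completion and Gram-Schmidt keep the given vector in first place but return
  vectors that are merely orthogonal, so each column is divided by its norm. The first has norm 1
  and stays x.\<close>

lemma unitary_extension:
  assumes "(\<Sum>i<n. (cmod (x i))\<^sup>2) = 1"
  shows "\<exists>W. orthonormal_cols n n W \<and> (\<forall>i<n. W i 0 = x i)"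
proof -
  have n: "n \<noteq> 0" using assms by (intro notI) auto
  define v where "v = vec n x"
  have v[simp]: "v \<in> carrier_vec n" by (simp add: v_def)
  have vv: "v \<bullet>c v = 1" using assms cscalar_self[OF v] by (simp add: v_def)
  have v0: "v \<noteq> 0\<^sub>v n" using vv by auto
  define b where "b = basis_completion v"
  define ws where "ws = gram_schmidt n b"
  interpret cof_vec_space n "TYPE(complex)" .
  from basis_completion[OF v v0, folded b_def]
  have dist_b: "distinct b" and indep: "\<not> lin_dep (set b)" and b: "set b \<subseteq> carrier_vec n"
    and hdb: "hd b = v" and len_b: "length b = n" by auto
  from hdb len_b n obtain vs where bv: "b = v # vs" by (cases b, auto)
  from gram_schmidt_result[OF b dist_b indep refl, folded ws_def]
  have ws: "set ws \<subseteq> carrier_vec n" "corthogonal ws" "length ws = n"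
    by (auto simp: len_b)
  from gram_schmidt_hd[OF v, of vs, folded bv] have hdws: "hd ws = v" unfolding ws_def .
  have ws0: "ws ! 0 = v" using hdws ws(3) n by (cases ws) auto
  define N where "N s = sqrt (\<Sum>i<n. (cmod (ws ! s $ i))\<^sup>2)" for s
  define W where "W i s = (ws ! s) $ i / complex_of_real (N s)" for i s
  have c: "ws ! s \<in> carrier_vec n" if "s < n" for s using ws that by auto
  have ip: "(ws ! t) \<bullet>c (ws ! s) = (\<Sum>i<n. cnj (ws ! s $ i) * ws ! t $ i)" if "s < n" "t < n" for s t
    using c[OF that(1)] c[OF that(2)] by (auto simp: scalar_prod_def atLeast0LessThan mult.commute intro!: sum.cong)
  have N2: "(ws ! s) \<bullet>c (ws ! s) = complex_of_real (N s * N s)" if "s < n" for s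
    using cscalar_self[OF c[OF that]] by (simp add: N_def sum_nonneg del: of_real_mult)
  have N0: "N s \<noteq> 0" if "s < n" for s
    using corthogonalD[OF ws(2), of s s] ws(3) that N2[OF that] by auto
  have "(\<Sum>i<n. cnj (W i s) * W i t) = delta s t" if "s < n" "t < n" for s t
  proof -
    have "(\<Sum>i<n. cnj (W i s) * W i t) = (ws ! t) \<bullet>c (ws ! s) / (N s * N t)"
      unfolding ip[OF that] W_def by (simp add: sum_divide_distrib)
    also have "\<dots> = delta s t"
      using corthogonalD[OF ws(2), of t s] ws(3) that N2[of s] N0[of s] by (auto simp: delta_def)
    finally show ?thesis .
  qed
  moreover have "N 0 = 1"
    using vv ws0 cscalar_self[OF v] unfolding N_def by (metis of_real_eq_1_iff real_sqrt_one)
  then have "\<forall>i<n. W i 0 = x i" by (auto simp: W_def ws0 v_def)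
  ultimately show ?thesis unfolding orthonormal_cols_def by blast
qed

text \<open>The characteristic polynomial splits over the complex numbers and, as n > 0, has a
  root.\<close>

lemma unit_eigenvector_exists:
  fixes M :: "nat \<Rightarrow> nat \<Rightarrow> complex"
  assumes "0 < n"
  shows "\<exists>e x. (\<Sum>i<n. (cmod (x i))\<^sup>2) = 1 \<and> (\<forall>i<n. (\<Sum>j<n. M i j * x j) = e * x i)"
proof -
  define A where "A = mat n n (\<lambda>(i,j). M i j)"
  have A: "A \<in> carrier_mat n n" by (simp add: A_def)
  obtain as where as: "char_poly A = (\<Prod>a\<leftarrow>as. [:- a, 1:])" "length as = n"
    using char_poly_factorized[OF A] by blast
  obtain e where "e \<in> set as" using as(2) assms by (cases as) auto
  then have "poly (char_poly A) e = 0" unfolding as(1) by (rule linear_poly_root)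
  then have "eigenvalue A e" using eigenvalue_root_char_poly[OF A] by simp
  then obtain v where v: "v \<in> carrier_vec n" "v \<noteq> 0\<^sub>v n" "A *\<^sub>v v = e \<cdot>\<^sub>v v"
    unfolding eigenvalue_def eigenvector_def using A by auto
  define N where "N = sqrt (\<Sum>i<n. (cmod (v $ i))\<^sup>2)"
  define x where "x i = v $ i / complex_of_real N" for i
  have "\<exists>i<n. v $ i \<noteq> 0" using v(1,2) by (auto simp: vec_eq_iff)
  then have "(\<Sum>i<n. (cmod (v $ i))\<^sup>2) > 0" by (auto intro!: sum_pos2)
  then have N: "N > 0" by (simp add: N_def)
  have "(\<Sum>i<n. (cmod (x i))\<^sup>2) = (\<Sum>i<n. (cmod (v $ i))\<^sup>2) / N\<^sup>2"
    using N by (simp add: x_def norm_divide power_divide sum_divide_distrib)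
  also have "\<dots> = 1" using N by (simp add: N_def sum_nonneg)
  finally have 1: "(\<Sum>i<n. (cmod (x i))\<^sup>2) = 1" .
  have "(\<Sum>j<n. M i j * x j) = e * x i" if "i < n" for i
  proof -
    have "(A *\<^sub>v v) $ i = (e \<cdot>\<^sub>v v) $ i" using v(3) by simp
    then have "(\<Sum>j<n. M i j * v $ j) = e * v $ i"
      using that v(1) by (simp add: A_def scalar_prod_def atLeast0LessThan)
    then show ?thesis by (simp add: x_def sum_divide_distrib[symmetric])
  qed
  with 1 show ?thesis by blast
qed

text \<open>Induction on the dimension: split off a unit eigenvector \<open>x\<close>, complete it to a unitary matrix
  \<open>W\<close>; Hermiticity makes \<open>W\<^sup>* M W\<close> block diagonal.\<close>

lemma hermitian_eigenbasis:
  fixes M :: "nat \<Rightarrow> nat \<Rightarrow> complex"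
  assumes "\<And>i j. i < n \<Longrightarrow> j < n \<Longrightarrow> M i j = cnj (M j i)"
  shows "\<exists>U (d :: nat \<Rightarrow> real). orthonormal_cols n n U \<and>
           (\<forall>t<n. \<forall>i<n. (\<Sum>j<n. M i j * U j t) = complex_of_real (d t) * U i t)"
  using assms
proof (induction n arbitrary: M)
  case 0
  then show ?case by (simp add: orthonormal_cols_def)
next
  case (Suc n)
  let ?n = "Suc n"
  obtain e x where x: "(\<Sum>i<?n. (cmod (x i))\<^sup>2) = 1" "\<forall>i<?n. (\<Sum>j<?n. M i j * x j) = e * x i"
    using unit_eigenvector_exists[of ?n M] by auto
  obtain W where W: "orthonormal_cols ?n ?n W" "\<forall>i<?n. W i 0 = x i"
    using unitary_extension[OF x(1)] by blast
  note ON = W(1)[unfolded orthonormal_cols_def, rule_format]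
  have W0: "(\<Sum>j<?n. M i j * W j 0) = e * W i 0" if "i < ?n" for i
    using x(2) W(2) that by simp
  have M': "cnj (M i j) = M j i" if "i < ?n" "j < ?n" for i j
    using Suc.prems[OF that(2,1)] by simp
  define C where "C s t = (\<Sum>i<?n. \<Sum>j<?n. cnj (W i s) * M i j * W j t)" for s t
  have Ch: "C s t = cnj (C t s)" if "s < ?n" "t < ?n" for s t
  proof -
    have "cnj (C t s) = (\<Sum>i<?n. \<Sum>j<?n. cnj (W j s) * M j i * W i t)"
      unfolding C_def cnj_sum complex_cnj_mult
      by (intro sum.cong refl) (simp add: M' mult_ac)
    also have "\<dots> = C s t" unfolding C_def by (rule sum.swap)
    finally show ?thesis by simp
  qed
  have C0: "C s 0 = e * delta s 0" if "s < ?n" for s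
  proof -
    have "C s 0 = (\<Sum>i<?n. cnj (W i s) * (\<Sum>j<?n. M i j * W j 0))"
      unfolding C_def by (simp only: sum_distrib_left mult.assoc)
    also have "\<dots> = (\<Sum>i<?n. cnj (W i s) * (e * W i 0))"
      by (rule sum.cong) (auto simp only: W0 lessThan_iff)
    also have "\<dots> = e * (\<Sum>i<?n. cnj (W i s) * W i 0)"
      by (simp only: sum_distrib_left) (simp only: mult_ac)
    finally show ?thesis using ON[of s 0] that by simp
  qed
  \<comment> \<open>This is M W = W C, obtained by inserting the completeness relation for the
    columns of W.\<close>
  have MW: "(\<Sum>j<?n. M i j * W j t) = (\<Sum>s<?n. W i s * C s t)" if "i < ?n" for i t
  proof -
    have "(\<Sum>s<?n. W i s * C s t) = (\<Sum>s<?n. \<Sum>k<?n. (W i s * cnj (W k s)) * (\<Sum>j<?n. M k j * W j t))"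
      unfolding C_def by (simp only: sum_distrib_left mult.assoc)
    also have "\<dots> = (\<Sum>k<?n. (\<Sum>s<?n. W i s * cnj (W k s)) * (\<Sum>j<?n. M k j * W j t))"
      by (subst sum.swap) (simp only: sum_distrib_right)
    also have "\<dots> = (\<Sum>k<?n. delta i k * (\<Sum>j<?n. M k j * W j t))"
      by (rule sum.cong) (use orthonormal_rows[OF W(1) that] in auto)
    also have "\<dots> = (\<Sum>j<?n. M i j * W j t)" by (rule sum_delta_left[OF that])
    finally show ?thesis by simp
  qed
  obtain U d where U: "orthonormal_cols n n U"
    "\<forall>t<n. \<forall>i<n. (\<Sum>j<n. C (Suc i) (Suc j) * U j t) = complex_of_real (d t) * U i t"
    using Suc.IH[of "\<lambda>i j. C (Suc i) (Suc j)", OF Ch] by (metis Suc_less_eq)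
  \<comment> \<open>The eigenvalue is a diagonal entry of the Hermitian matrix C.\<close>
  have ereal: "e = complex_of_real (Re e)"
  proof -
    have "C 0 0 = e" using C0[of 0] by (simp add: delta_def)
    then have "e = cnj e" using Ch[of 0 0] by simp
    then show ?thesis by (simp add: complex_eq_iff)
  qed
  \<comment> \<open>Block diagonal: 1 in the corner, the eigenvectors of the remaining block below
    it. The product W V diagonalises M.\<close>
  define V where "V s t = (case t of 0 \<Rightarrow> delta s 0 | Suc t' \<Rightarrow> (case s of 0 \<Rightarrow> 0 | Suc s' \<Rightarrow> U s' t'))" for s t
  define D where "D t = (case t of 0 \<Rightarrow> Re e | Suc t' \<Rightarrow> d t')" for t
  have VON: "(\<Sum>s<?n. cnj (V s t) * V s t') = delta t t'" if "t < ?n" "t' < ?n" for t t'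
    using that U(1) unfolding orthonormal_cols_def
    by (cases t; cases t') (auto simp: V_def sum.lessThan_Suc_shift delta_def simp del: sum.lessThan_Suc)
  have VE: "(\<Sum>t<?n. C s t * V t r) = complex_of_real (D r) * V s r" if "s < ?n" "r < ?n" for s r
  proof (cases r)
    case 0
    then show ?thesis using C0[OF that(1)] ereal
      by (auto simp: V_def D_def sum_delta_right simp del: sum.lessThan_Suc)
  next
    case (Suc r')
    \<comment> \<open>The rest of the first row is the conjugate of the rest of the first
      column.\<close>
    have "C 0 (Suc t) = 0" if "t < n" for t
      by (subst Ch) (use C0[of "Suc t"] that in \<open>simp_all add: delta_def\<close>)
    then show ?thesis using Suc that U(2)
      by (cases s) (auto simp: V_def D_def sum.lessThan_Suc_shift simp del: sum.lessThan_Suc)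
  qed
  define X where "X i t = (\<Sum>s<?n. W i s * V s t)" for i t
  have "orthonormal_cols ?n ?n X"
    unfolding orthonormal_cols_def
  proof (intro allI impI)
    fix t t' assume t: "t < ?n" "t' < ?n"
    have "(\<Sum>i<?n. cnj (X i t) * X i t') = (\<Sum>i<?n. \<Sum>s<?n. \<Sum>s'<?n. (cnj (W i s) * W i s') * (cnj (V s t) * V s' t'))"
      unfolding X_def cnj_sum sum_product complex_cnj_mult by (simp only: mult_ac)
    also have "\<dots> = (\<Sum>s<?n. \<Sum>i<?n. \<Sum>s'<?n. (cnj (W i s) * W i s') * (cnj (V s t) * V s' t'))"
      by (rule sum.swap)
    also have "\<dots> = (\<Sum>s<?n. \<Sum>s'<?n. \<Sum>i<?n. (cnj (W i s) * W i s') * (cnj (V s t) * V s' t'))"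
      by (intro sum.cong refl sum.swap)
    also have "\<dots> = (\<Sum>s<?n. \<Sum>s'<?n. delta s s' * (cnj (V s t) * V s' t'))"
      by (intro sum.cong refl) (simp only: sum_distrib_right[symmetric] ON lessThan_iff)
    also have "\<dots> = (\<Sum>s<?n. cnj (V s t) * V s t')"
      by (intro sum.cong refl) (simp only: sum_delta_left lessThan_iff)
    finally show "(\<Sum>i<?n. cnj (X i t) * X i t') = delta t t'" using VON[OF t] by simp
  qed
  moreover have "(\<Sum>j<?n. M i j * X j t) = complex_of_real (D t) * X i t" if "t < ?n" "i < ?n" for t i
  proof -
    have "(\<Sum>j<?n. M i j * X j t) = (\<Sum>j<?n. \<Sum>s<?n. (M i j * W j s) * V s t)"
      unfolding X_def by (simp only: sum_distrib_left mult.assoc)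
    also have "\<dots> = (\<Sum>s<?n. (\<Sum>j<?n. M i j * W j s) * V s t)"
      by (subst sum.swap) (simp only: sum_distrib_right)
    also have "\<dots> = (\<Sum>s<?n. \<Sum>r<?n. W i r * (C r s * V s t))"
      unfolding MW[OF that(2)] by (simp only: sum_distrib_right mult.assoc)
    also have "\<dots> = (\<Sum>r<?n. W i r * (\<Sum>s<?n. C r s * V s t))"
      by (subst sum.swap) (simp only: sum_distrib_left)
    also have "\<dots> = (\<Sum>r<?n. W i r * (complex_of_real (D t) * V r t))"
      by (intro sum.cong refl) (simp only: VE that(1) lessThan_iff)
    also have "\<dots> = complex_of_real (D t) * X i t"
      unfolding X_def by (simp only: sum_distrib_left mult_ac)
    finally show ?thesis .
  qed
  ultimately show ?case by blast
qed

section \<open>Hermitian matrices and Schatten norms\<close>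

lemma sum_rotate:
  "(\<Sum>i\<in>A. \<Sum>j\<in>B. \<Sum>s\<in>C. f i j s) = (\<Sum>s\<in>C. \<Sum>i\<in>A. \<Sum>j\<in>B. f i j s)"
proof -
  have "(\<Sum>i\<in>A. \<Sum>j\<in>B. \<Sum>s\<in>C. f i j s) = (\<Sum>i\<in>A. \<Sum>s\<in>C. \<Sum>j\<in>B. f i j s)"
    by (intro sum.cong refl sum.swap)
  also have "\<dots> = (\<Sum>s\<in>C. \<Sum>i\<in>A. \<Sum>j\<in>B. f i j s)" by (rule sum.swap)
  finally show ?thesis .
qed

lemma dim_mat_adjoint [simp]: "dim_row (mat_adjoint A) = dim_col A" "dim_col (mat_adjoint A) = dim_row A"
  by (auto simp: mat_adjoint_def)

lemma index_mat_adjoint [simp]: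
  "i < dim_col A \<Longrightarrow> j < dim_row A \<Longrightarrow> mat_adjoint A $$ (i,j) = cnj (A $$ (j,i))" for A :: "complex mat"
  by (simp add: mat_adjoint_def mat_of_rows_index)

lemma herm_iff:
  "A \<in> herm n \<longleftrightarrow> A \<in> carrier_mat n n \<and> (\<forall>i<n. \<forall>j<n. A $$ (i,j) = cnj (A $$ (j,i)))"
proof (cases "A \<in> carrier_mat n n")
  case True
  then have "mat_adjoint A = A \<longleftrightarrow> (\<forall>i<n. \<forall>j<n. cnj (A $$ (j,i)) = A $$ (i,j))"
    by (auto simp: mat_eq_iff)
  also have "\<dots> \<longleftrightarrow> (\<forall>i<n. \<forall>j<n. A $$ (i,j) = cnj (A $$ (j,i)))"
    by metis
  finally show ?thesis using True unfolding herm_def by blast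
qed (auto simp: herm_def)

lemma herm_carrier: "A \<in> herm n \<Longrightarrow> A \<in> carrier_mat n n"
  by (simp add: herm_iff)

definition quad_form :: "nat \<Rightarrow> complex mat \<Rightarrow> (nat \<Rightarrow> complex) \<Rightarrow> complex" where
  "quad_form n A x = (\<Sum>i<n. \<Sum>j<n. cnj (x i) * A $$ (i,j) * x j)"

lemma psd_iff:
  "A \<in> psd n \<longleftrightarrow> A \<in> herm n \<and> (\<forall>x. 0 \<le> Re (quad_form n A x))"
proof -
  have eq: "(A *\<^sub>v v) \<bullet>c v = quad_form n A (\<lambda>i. v $ i)"
    if "A \<in> carrier_mat n n" "v \<in> carrier_vec n" for v
    using that by (auto simp: quad_form_def scalar_prod_def atLeast0LessThan sum_distrib_left sum_distrib_right mult_ac intro!: sum.cong)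
  have eq': "quad_form n A x = quad_form n A (\<lambda>i. vec n x $ i)" for x
    by (simp add: quad_form_def)
  show ?thesis
  proof (cases "A \<in> carrier_mat n n")
    case True
    then show ?thesis unfolding psd_def using eq eq' by (auto, metis vec_carrier)
  next
    case False
    then show ?thesis by (auto simp: psd_def herm_def)
  qed
qed

definition spectral_rep :: "nat \<Rightarrow> complex mat \<Rightarrow> (nat \<Rightarrow> nat \<Rightarrow> complex) \<Rightarrow> (nat \<Rightarrow> real) \<Rightarrow> bool" where
  "spectral_rep n A U d \<longleftrightarrow> A \<in> carrier_mat n n \<and> orthonormal_cols n n U \<and>
     (\<forall>i<n. \<forall>j<n. A $$ (i,j) = (\<Sum>t<n. complex_of_real (d t) * U i t * cnj (U j t)))"

lemma spectral_theorem:
  assumes "A \<in> herm n"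
  shows "\<exists>U d. spectral_rep n A U d"
proof -
  have h: "A $$ (i,j) = cnj (A $$ (j,i))" if "i < n" "j < n" for i j
    using assms that unfolding herm_iff by blast
  obtain U d where U: "orthonormal_cols n n U"
    "\<forall>t<n. \<forall>i<n. (\<Sum>j<n. A $$ (i,j) * U j t) = complex_of_real (d t) * U i t"
    using hermitian_eigenbasis[of n "\<lambda>i j. A $$ (i,j)", OF h] by blast
  have "A $$ (i,j) = (\<Sum>t<n. complex_of_real (d t) * U i t * cnj (U j t))" if "i < n" "j < n" for i j
  proof -
    have "A $$ (i,j) = (\<Sum>l<n. A $$ (i,l) * delta l j)"
      using sum_delta_right[OF that(2), of "\<lambda>l. A $$ (i,l)"] by simp
    also have "\<dots> = (\<Sum>l<n. A $$ (i,l) * (\<Sum>t<n. U l t * cnj (U j t)))"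
      by (intro sum.cong refl) (simp add: orthonormal_rows[OF U(1)] that)
    also have "\<dots> = (\<Sum>t<n. (\<Sum>l<n. A $$ (i,l) * U l t) * cnj (U j t))"
      unfolding sum_distrib_left sum_distrib_right by (subst sum.swap) (simp only: mult.assoc)
    finally show ?thesis using U(2) that by simp
  qed
  then show ?thesis using U(1) herm_carrier[OF assms] unfolding spectral_rep_def by blast
qed

text \<open>\<open>eigvals\<close> is a choice among lists with the same linear factors. Only the
  multiset of roots is determined, and that suffices for sums over the list.\<close>

lemma mset_eq_of_linear_factors:
  fixes as bs :: "complex list"
  assumes "(\<Prod>a\<leftarrow>as. [:- a, 1:]) = (\<Prod>a\<leftarrow>bs. [:- a, 1:])"
  shows "mset as = mset bs"
proof -
  have "proots (\<Prod>a\<leftarrow>as. [:- a, 1:]) = mset as" for as :: "complex list"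
  proof (induction as)
    case (Cons a as)
    have "(\<Prod>a\<leftarrow>as. [:- a, 1:]) \<noteq> 0" by (auto simp: prod_list_zero_iff)
    then have "proots ([:- a, 1:] * (\<Prod>a\<leftarrow>as. [:- a, 1:])) = {#a#} + mset as"
      by (subst proots_mult) (auto simp: Cons)
    then show ?case by (simp del: mult_pCons_left)
  qed simp
  then show ?thesis using assms by metis
qed

text \<open>A is similar to the diagonal matrix of the values c t, so the two share their
  characteristic polynomial.\<close>

lemma mset_eigvals:
  assumes A: "A \<in> carrier_mat n n" and U: "orthonormal_cols n n U"
    and rep: "\<And>i j. i < n \<Longrightarrow> j < n \<Longrightarrow> A $$ (i,j) = (\<Sum>t<n. c t * U i t * cnj (U j t))"
  shows "mset (eigvals A) = mset (map c [0..<n])"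
proof -
  have ev: "char_poly A = (\<Prod>a\<leftarrow>eigvals A. [:- a, 1:])"
    using someI_ex[OF char_poly_factorized[OF A]] A unfolding eigvals_def by auto
  define P where "P = mat n n (\<lambda>(i,t). U i t)"
  define Q where "Q = mat n n (\<lambda>(t,j). cnj (U j t))"
  define D where "D = mat n n (\<lambda>(s,t). if s = t then c t else 0)"
  have carr: "P \<in> carrier_mat n n" "Q \<in> carrier_mat n n" "D \<in> carrier_mat n n"
    by (auto simp: P_def Q_def D_def)
  have QP: "Q * P = 1\<^sub>m n"
    using U by (intro eq_matI) (auto simp: P_def Q_def scalar_prod_def orthonormal_cols_def delta_def atLeast0LessThan)
  have PQ: "P * Q = 1\<^sub>m n" using mat_mult_left_right_inverse[OF carr(2,1) QP] .
  have PD: "P * D = mat n n (\<lambda>(i,t). c t * U i t)"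
    by (intro eq_matI) (auto simp: P_def D_def scalar_prod_def atLeast0LessThan if_distrib[of "\<lambda>x. _ * x"] cong: if_cong)
  have "A = P * D * Q"
    unfolding PD using A by (intro eq_matI) (auto simp: Q_def scalar_prod_def atLeast0LessThan rep)
  then have "similar_mat A D"
    using carr A QP PQ by (auto simp: similar_mat_def intro!: exI similar_mat_witI[of P Q n])
  then have "char_poly A = char_poly D" by (rule char_poly_similar)
  also have "\<dots> = (\<Prod>a\<leftarrow>diag_mat D. [:- a, 1:])"
    by (rule char_poly_upper_triangular[OF carr(3)]) (auto simp: D_def)
  also have "diag_mat D = map c [0..<n]"
    by (auto simp: diag_mat_def D_def)
  finally show ?thesis using ev by (intro mset_eq_of_linear_factors) simp
qed

lemma sum_list_eigvals:
  fixes f :: "complex \<Rightarrow> real"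
  assumes "A \<in> carrier_mat n n" "orthonormal_cols n n U"
    and "\<And>i j. i < n \<Longrightarrow> j < n \<Longrightarrow> A $$ (i,j) = (\<Sum>t<n. c t * U i t * cnj (U j t))"
  shows "(\<Sum>a\<leftarrow>eigvals A. f a) = (\<Sum>t<n. f (c t))"
proof -
  have e: "mset (eigvals A) = mset (map c [0..<n])"
    by (rule mset_eigvals) (use assms in auto)
  have "(\<Sum>a\<leftarrow>eigvals A. f a) = sum_mset (image_mset f (mset (eigvals A)))"
    by (simp only: mset_map[symmetric] sum_mset_sum_list)
  also have "\<dots> = sum_list (map f (map c [0..<n]))"
    unfolding e by (simp only: mset_map[symmetric] sum_mset_sum_list)
  also have "\<dots> = (\<Sum>t<n. f (c t))"
    by (simp add: interv_sum_list_conv_sum_set_nat atLeast0LessThan comp_def)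
  finally show ?thesis .
qed

lemma spectral_rep_eigvals:
  fixes f :: "real \<Rightarrow> real"
  assumes "spectral_rep n A U d"
  shows "(\<Sum>a\<leftarrow>eigvals A. f (Re a)) = (\<Sum>t<n. f (d t))"
  using assms sum_list_eigvals[of A n U "\<lambda>t. complex_of_real (d t)" "\<lambda>a. f (Re a)"]
  unfolding spectral_rep_def by auto

text \<open>Orthonormality collapses the inner product of U with itself, so the same U diagonalises
  the product; both Schatten norms can then be read off d.\<close>

lemma spectral_rep_adjoint_mult:
  assumes "spectral_rep n A U d" "i < n" "j < n"
  shows "(mat_adjoint A * A) $$ (i,j) = (\<Sum>t<n. complex_of_real ((d t)\<^sup>2) * U i t * cnj (U j t))"
proof -
  have A: "A \<in> carrier_mat n n" and U: "orthonormal_cols n n U"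
    and rep: "\<And>i j. i < n \<Longrightarrow> j < n \<Longrightarrow> A $$ (i,j) = (\<Sum>t<n. complex_of_real (d t) * U i t * cnj (U j t))"
    using assms by (auto simp: spectral_rep_def)
  have "(mat_adjoint A * A) $$ (i,j) = (\<Sum>k<n. cnj (A $$ (k,i)) * A $$ (k,j))"
    using A assms(2,3) by (auto simp: scalar_prod_def atLeast0LessThan)
  also have "\<dots> = (\<Sum>k<n. \<Sum>s<n. \<Sum>t<n. (cnj (U k s) * U k t) * (complex_of_real (d s * d t) * U i s * cnj (U j t)))"
    using assms(2,3) by (intro sum.cong refl)
      (simp only: rep cnj_sum sum_product lessThan_iff complex_cnj_mult complex_cnj_complex_of_real
        complex_cnj_cnj of_real_mult, simp only: mult_ac)
  also have "\<dots> = (\<Sum>s<n. \<Sum>k<n. \<Sum>t<n. (cnj (U k s) * U k t) * (complex_of_real (d s * d t) * U i s * cnj (U j t)))"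
    by (rule sum.swap)
  also have "\<dots> = (\<Sum>s<n. \<Sum>t<n. \<Sum>k<n. (cnj (U k s) * U k t) * (complex_of_real (d s * d t) * U i s * cnj (U j t)))"
    by (intro sum.cong refl sum.swap)
  also have "\<dots> = (\<Sum>s<n. \<Sum>t<n. delta s t * (complex_of_real (d s * d t) * U i s * cnj (U j t)))"
    using U by (intro sum.cong refl) (simp add: sum_distrib_right[symmetric] orthonormal_cols_def)
  also have "\<dots> = (\<Sum>s<n. complex_of_real (d s * d s) * U i s * cnj (U j s))"
    by (intro sum.cong refl) (simp only: sum_delta_left lessThan_iff)
  finally show ?thesis by (simp add: power2_eq_square)
qed

lemma spectral_rep_trace:
  assumes "spectral_rep n A U d"
  shows "mtrace A = complex_of_real (\<Sum>t<n. d t)"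
proof -
  have "mtrace A = (\<Sum>i<n. \<Sum>t<n. complex_of_real (d t) * (cnj (U i t) * U i t))"
    using assms by (auto simp: mtrace_def spectral_rep_def mult_ac intro!: sum.cong)
  also have "\<dots> = (\<Sum>t<n. complex_of_real (d t) * (\<Sum>i<n. cnj (U i t) * U i t))"
    by (subst sum.swap) (simp only: sum_distrib_left)
  also have "\<dots> = (\<Sum>t<n. complex_of_real (d t) * delta t t)"
    using assms by (intro sum.cong refl) (simp add: spectral_rep_def orthonormal_cols_def)
  finally show ?thesis by (simp add: delta_def)
qed

lemma schatten1_spectral:
  assumes "spectral_rep n A U d"
  shows "schatten1 A = (\<Sum>t<n. \<bar>d t\<bar>)"
proof -
  have "A \<in> carrier_mat n n" using assms by (simp add: spectral_rep_def)
  then have "mat_adjoint A * A \<in> carrier_mat n n" by auto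
  moreover have "orthonormal_cols n n U" using assms by (simp add: spectral_rep_def)
  ultimately have "schatten1 A = (\<Sum>t<n. sqrt (Re (complex_of_real ((d t)\<^sup>2))))"
    unfolding schatten1_def by (rule sum_list_eigvals) (rule spectral_rep_adjoint_mult[OF assms])
  then show ?thesis by simp
qed

section \<open>The Hilbert-Schmidt norm\<close>

lemma schatten2_eq:
  assumes "A \<in> carrier_mat n k"
  shows "schatten2 A = sqrt (\<Sum>i<n. \<Sum>j<k. (cmod (A $$ (i,j)))\<^sup>2)"
proof -
  have "mtrace (mat_adjoint A * A) = (\<Sum>j<k. \<Sum>i<n. cnj (A $$ (i,j)) * A $$ (i,j))"
    using assms by (auto simp: mtrace_def scalar_prod_def atLeast0LessThan intro!: sum.cong)
  also have "\<dots> = (\<Sum>i<n. \<Sum>j<k. cnj (A $$ (i,j)) * A $$ (i,j))" by (rule sum.swap)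
  also have "\<dots> = complex_of_real (\<Sum>i<n. \<Sum>j<k. (cmod (A $$ (i,j)))\<^sup>2)"
    by (simp only: cmod_sq of_real_sum)
  finally show ?thesis by (simp add: schatten2_def)
qed

lemma schatten2_nonneg: "A \<in> carrier_mat n k \<Longrightarrow> 0 \<le> schatten2 A"
  by (simp add: schatten2_eq sum_nonneg)

lemma schatten2_L2:
  assumes "A \<in> carrier_mat n k"
  shows "schatten2 A = L2_set (\<lambda>p. cmod (A $$ p)) ({..<n} \<times> {..<k})"
  unfolding schatten2_eq[OF assms] L2_set_def by (simp add: sum.cartesian_product)

lemma schatten2_triangle:
  assumes "A \<in> carrier_mat n k" "B \<in> carrier_mat n k"
  shows "schatten2 (A + B) \<le> schatten2 A + schatten2 B"
proof -
  have AB: "A + B \<in> carrier_mat n k" using assms by auto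
  have "schatten2 (A + B) \<le> L2_set (\<lambda>p. cmod (A $$ p) + cmod (B $$ p)) ({..<n} \<times> {..<k})"
    unfolding schatten2_L2[OF AB] using assms by (intro L2_set_mono) (auto simp: norm_triangle_ineq)
  also have "\<dots> \<le> schatten2 A + schatten2 B"
    unfolding schatten2_L2[OF assms(1)] schatten2_L2[OF assms(2)] by (rule L2_set_triangle_ineq)
  finally show ?thesis .
qed

lemma schatten2_smult:
  assumes "A \<in> carrier_mat n k"
  shows "schatten2 (c \<cdot>\<^sub>m A) = cmod c * schatten2 A"
proof -
  have c: "c \<cdot>\<^sub>m A \<in> carrier_mat n k" using assms by auto
  show ?thesis unfolding schatten2_L2[OF assms] schatten2_L2[OF c] using assms
    by (auto simp: L2_set_right_distrib norm_mult intro!: L2_set_cong)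
qed

lemma schatten2_spectral:
  assumes "spectral_rep n A U d"
  shows "(schatten2 A)\<^sup>2 = (\<Sum>t<n. (d t)\<^sup>2)"
proof -
  have A: "A \<in> carrier_mat n n" using assms by (simp add: spectral_rep_def)
  then have "spectral_rep n (mat_adjoint A * A) U (\<lambda>t. (d t)\<^sup>2)"
    using assms spectral_rep_adjoint_mult[OF assms] by (auto simp: spectral_rep_def)
  then have "mtrace (mat_adjoint A * A) = complex_of_real (\<Sum>t<n. (d t)\<^sup>2)" by (rule spectral_rep_trace)
  then show ?thesis by (simp add: schatten2_def sum_nonneg)
qed

text \<open>The quadratic form takes the value d t at the t-th eigenvector.\<close>

lemma spectral_rep_psd_nonneg:
  assumes "spectral_rep n A U d" "A \<in> psd n" "t < n"
  shows "0 \<le> d t"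
proof -
  have U: "\<And>s t. s < n \<Longrightarrow> t < n \<Longrightarrow> (\<Sum>i<n. cnj (U i s) * U i t) = delta s t"
    using assms by (auto simp: spectral_rep_def orthonormal_cols_def)
  have "quad_form n A (\<lambda>i. U i t)
      = (\<Sum>i<n. \<Sum>j<n. \<Sum>s<n. complex_of_real (d s) * ((cnj (U i t) * U i s) * (cnj (U j s) * U j t)))"
    using assms(1) by (auto simp: quad_form_def spectral_rep_def sum_distrib_left sum_distrib_right mult_ac intro!: sum.cong)
  also have "\<dots> = (\<Sum>s<n. \<Sum>i<n. \<Sum>j<n. complex_of_real (d s) * ((cnj (U i t) * U i s) * (cnj (U j s) * U j t)))"
    by (rule sum_rotate)
  also have "\<dots> = (\<Sum>s<n. complex_of_real (d s) * ((\<Sum>i<n. cnj (U i t) * U i s) * (\<Sum>j<n. cnj (U j s) * U j t)))"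
    unfolding sum_product by (simp only: sum_distrib_left)
  also have "\<dots> = (\<Sum>s<n. delta t s * (complex_of_real (d s) * delta s t))"
    by (intro sum.cong refl) (simp add: U assms(3))
  also have "\<dots> = complex_of_real (d t)" by (subst sum_delta_left[OF assms(3)]) (simp add: delta_def)
  finally show ?thesis using assms(2) unfolding psd_iff by (metis Re_complex_of_real)
qed

section \<open>Gram representations of positive matrices\<close>

definition outer :: "nat \<Rightarrow> (nat \<Rightarrow> complex) \<Rightarrow> complex mat" where
  "outer n v = mat n n (\<lambda>(i,j). v i * cnj (v j))"

text \<open>The quadratic form becomes a sum of squared moduli. Together with
  \<open>psd_imp_gram\<close> this turns positivity into a matter of explicit vectors.\<close>

lemma psd_gram:
  assumes "A \<in> carrier_mat n n"
    and A: "\<And>i j. i < n \<Longrightarrow> j < n \<Longrightarrow> A $$ (i,j) = (\<Sum>t\<in>T. x t i * cnj (x t j))"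
  shows "A \<in> psd n"
  unfolding psd_iff herm_iff
proof (intro conjI allI impI)
  fix y
  have "quad_form n A y = (\<Sum>i<n. \<Sum>j<n. \<Sum>t\<in>T. (x t i * cnj (y i)) * cnj (x t j * cnj (y j)))"
    using A by (auto simp: quad_form_def sum_distrib_left sum_distrib_right mult_ac intro!: sum.cong)
  also have "\<dots> = (\<Sum>t\<in>T. \<Sum>i<n. \<Sum>j<n. (x t i * cnj (y i)) * cnj (x t j * cnj (y j)))"
    by (rule sum_rotate)
  also have "\<dots> = (\<Sum>t\<in>T. (\<Sum>i<n. x t i * cnj (y i)) * cnj (\<Sum>i<n. x t i * cnj (y i)))"
    by (simp only: sum_product cnj_sum)
  also have "\<dots> = complex_of_real (\<Sum>t\<in>T. (cmod (\<Sum>i<n. x t i * cnj (y i)))\<^sup>2)"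
    by (simp only: cmod_sq of_real_sum)
  finally show "0 \<le> Re (quad_form n A y)" by (simp add: sum_nonneg)
qed (use assms in \<open>auto simp: mult.commute\<close>)

text \<open>The vectors are the eigenvectors scaled by the square roots of the eigenvalues.\<close>

lemma psd_imp_gram:
  assumes "A \<in> psd n"
  shows "\<exists>x. \<forall>i<n. \<forall>j<n. A $$ (i,j) = (\<Sum>t<n. x t i * cnj (x t j))"
proof -
  obtain U d where Ud: "spectral_rep n A U d"
    using spectral_theorem assms unfolding psd_def by blast
  have d: "0 \<le> d t" if "t < n" for t using spectral_rep_psd_nonneg[OF Ud assms that] .
  have "complex_of_real (d t) * U i t * cnj (U j t)
      = (complex_of_real (sqrt (d t)) * U i t) * cnj (complex_of_real (sqrt (d t)) * U j t)" if "t < n" for i j t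
  proof -
    have "complex_of_real (d t) = complex_of_real (sqrt (d t)) * complex_of_real (sqrt (d t))"
      using d[OF that] by (simp flip: of_real_mult)
    then show ?thesis by (simp add: mult_ac)
  qed
  then show ?thesis using Ud unfolding spectral_rep_def
    by (intro exI[of _ "\<lambda>t i. complex_of_real (sqrt (d t)) * U i t"]) (auto intro!: sum.cong)
qed

lemma outer_carrier [simp]: "outer n v \<in> carrier_mat n n"
  by (simp add: outer_def)

lemma outer_psd: "outer n v \<in> psd n"
  by (rule psd_gram[where T = "{()}" and x = "\<lambda>_. v"]) (auto simp: outer_def)

lemma outer_herm: "outer n v \<in> herm n"
  using outer_psd by (simp add: psd_iff)

lemma mtrace_outer: "mtrace (outer n v) = complex_of_real (\<Sum>i<n. (cmod (v i))\<^sup>2)"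
  by (simp add: mtrace_def outer_def cmod_sq)

lemma schatten1_psd:
  assumes "A \<in> psd n"
  shows "schatten1 A = Re (mtrace A)"
proof -
  obtain U d where Ud: "spectral_rep n A U d"
    using spectral_theorem assms unfolding psd_def by blast
  have "\<bar>d t\<bar> = d t" if "t < n" for t using spectral_rep_psd_nonneg[OF Ud assms that] by simp
  then show ?thesis by (simp add: schatten1_spectral[OF Ud] spectral_rep_trace[OF Ud])
qed

section \<open>Reduction to pure states and complex-linear extension\<close>

definition pure_bound :: "nat \<Rightarrow> (complex mat \<Rightarrow> complex mat) \<Rightarrow> real \<Rightarrow> bool" where
  "pure_bound n \<Psi> C \<longleftrightarrow> (\<forall>v. schatten2 (\<Psi> (outer n v)) \<le> C * (\<Sum>i<n. (cmod (v i))\<^sup>2))"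

lemma herm_cnj: "A \<in> herm n \<Longrightarrow> i < n \<Longrightarrow> j < n \<Longrightarrow> cnj (A $$ (i,j)) = A $$ (j,i)"
  unfolding herm_iff by metis

lemma hermI:
  assumes "A \<in> carrier_mat n n" "\<And>i j. i < n \<Longrightarrow> j < n \<Longrightarrow> cnj (A $$ (i,j)) = A $$ (j,i)"
  shows "A \<in> herm n"
  using assms unfolding herm_iff by simp

lemma herm_smult:
  assumes "A \<in> herm n"
  shows "complex_of_real r \<cdot>\<^sub>m A \<in> herm n"
  using herm_carrier[OF assms] by (intro hermI) (auto simp: herm_cnj[OF assms])

lemma zero_herm: "0\<^sub>m n n \<in> herm n"
  by (intro hermI) auto

lemma herm_map_herm: "herm_map n k \<Phi> \<Longrightarrow> A \<in> herm n \<Longrightarrow> \<Phi> A \<in> herm k"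
  and herm_map_add: "herm_map n k \<Phi> \<Longrightarrow> A \<in> herm n \<Longrightarrow> B \<in> herm n \<Longrightarrow> \<Phi> (A + B) = \<Phi> A + \<Phi> B"
  and herm_map_smult: "herm_map n k \<Phi> \<Longrightarrow> A \<in> herm n \<Longrightarrow> \<Phi> (complex_of_real r \<cdot>\<^sub>m A) = complex_of_real r \<cdot>\<^sub>m \<Phi> A"
  by (simp_all add: herm_map_def)

lemma herm_map_zero:
  assumes "herm_map n k \<Phi>"
  shows "\<Phi> (0\<^sub>m n n) = 0\<^sub>m k k"
proof -
  have "complex_of_real 0 \<cdot>\<^sub>m 0\<^sub>m n n = 0\<^sub>m n n" by (intro eq_matI) auto
  then have "\<Phi> (0\<^sub>m n n) = complex_of_real 0 \<cdot>\<^sub>m \<Phi> (0\<^sub>m n n)"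
    using herm_map_smult[OF assms zero_herm, of 0] by simp
  also have "\<dots> = 0\<^sub>m k k" 
    using herm_carrier[OF herm_map_herm[OF assms zero_herm]] by (intro eq_matI) auto
  finally show ?thesis .
qed

text \<open>A Hermitian matrix is a real combination of pure states with absolute weight its trace norm,
  so only pure states matter.\<close>

lemma pure_bound_schatten1:
  assumes \<Psi>: "herm_map n k \<Psi>" and b: "pure_bound n \<Psi> C" and A: "A \<in> herm n"
  shows "schatten2 (\<Psi> A) \<le> C * schatten1 A"
proof -
  obtain U d where Ud: "spectral_rep n A U d" using spectral_theorem[OF A] by blast
  then have U: "orthonormal_cols n n U"
    and rep: "\<And>i j. i < n \<Longrightarrow> j < n \<Longrightarrow> A $$ (i,j) = (\<Sum>t<n. complex_of_real (d t) * U i t * cnj (U j t))"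
    by (auto simp: spectral_rep_def)
  \<comment> \<open>Partial sums of the spectral decomposition. Additivity of \<open>\<Psi>\<close>
    is available on Hermitian matrices, and the induction stays among them.\<close>
  define R where "R p = mat n n (\<lambda>(i,j). \<Sum>t<p. complex_of_real (d t) * U i t * cnj (U j t))" for p
  have R: "R p \<in> herm n" for p
    unfolding R_def by (intro hermI) (auto simp: mult_ac)
  have nrm: "(\<Sum>i<n. (cmod (U i t))\<^sup>2) = 1" if "t < n" for t
  proof -
    have "complex_of_real (\<Sum>i<n. (cmod (U i t))\<^sup>2) = (\<Sum>i<n. cnj (U i t) * U i t)"
      by (simp only: cmod_sq of_real_sum)
    also have "\<dots> = 1" using U that by (simp add: orthonormal_cols_def delta_def)
    finally show ?thesis by (metis of_real_eq_1_iff)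
  qed
  have "p \<le> n \<Longrightarrow> schatten2 (\<Psi> (R p)) \<le> C * (\<Sum>t<p. \<bar>d t\<bar>)" for p
  proof (induction p)
    case 0
    have "R 0 = 0\<^sub>m n n" by (intro eq_matI) (auto simp: R_def)
    then show ?case by (simp add: herm_map_zero[OF \<Psi>] schatten2_eq[of _ k k])
  next
    case (Suc p)
    let ?O = "outer n (\<lambda>i. U i p)"
    have O: "complex_of_real (d p) \<cdot>\<^sub>m ?O \<in> herm n" by (intro herm_smult outer_herm)
    have "R (Suc p) = R p + complex_of_real (d p) \<cdot>\<^sub>m ?O"
      by (intro eq_matI) (auto simp: R_def outer_def mult_ac)
    then have e: "\<Psi> (R (Suc p)) = \<Psi> (R p) + complex_of_real (d p) \<cdot>\<^sub>m \<Psi> ?O"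
      by (simp add: herm_map_add[OF \<Psi> R O] herm_map_smult[OF \<Psi> outer_herm])
    have c1: "\<Psi> (R p) \<in> carrier_mat k k" by (rule herm_carrier[OF herm_map_herm[OF \<Psi> R]])
    have c2: "\<Psi> ?O \<in> carrier_mat k k" by (rule herm_carrier[OF herm_map_herm[OF \<Psi> outer_herm]])
    have "schatten2 (\<Psi> (R (Suc p))) \<le> schatten2 (\<Psi> (R p)) + schatten2 (complex_of_real (d p) \<cdot>\<^sub>m \<Psi> ?O)"
      unfolding e by (rule schatten2_triangle[of _ k k]) (use c1 c2 in auto)
    moreover have "schatten2 (complex_of_real (d p) \<cdot>\<^sub>m \<Psi> ?O) = \<bar>d p\<bar> * schatten2 (\<Psi> ?O)"
      using schatten2_smult[OF c2] by simp
    moreover have "schatten2 (\<Psi> ?O) \<le> C"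
      using b nrm[of p] Suc.prems unfolding pure_bound_def by (metis Suc_le_eq mult.right_neutral)
    then have "\<bar>d p\<bar> * schatten2 (\<Psi> ?O) \<le> \<bar>d p\<bar> * C" by (intro mult_left_mono) auto
    ultimately show ?case using Suc by (simp add: algebra_simps)
  qed
  moreover have "R n = A"
    using herm_carrier[OF A] by (intro eq_matI) (auto simp: R_def rep)
  ultimately show ?thesis by (metis le_refl schatten1_spectral[OF Ud])
qed

lemma schatten1_nonneg: "A \<in> herm n \<Longrightarrow> 0 \<le> schatten1 A"
  using spectral_theorem[of A n] by (auto simp: schatten1_spectral sum_nonneg)

lemma pure_bound_nonneg:
  assumes "herm_map n k \<Psi>" "pure_bound n \<Psi> C" "0 < n"
  shows "0 \<le> C"
proof -
  have "0 \<le> schatten2 (\<Psi> (outer n (\<lambda>i. if i = 0 then 1 else 0)))"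
    by (rule schatten2_nonneg[OF herm_carrier[OF herm_map_herm[OF assms(1) outer_herm]]])
  also have "\<dots> \<le> C * (\<Sum>i<n. (cmod (if i = 0 then 1 else 0))\<^sup>2)"
    using assms(2) unfolding pure_bound_def by blast
  also have "(\<Sum>i<n. (cmod (if i = 0 then 1 else 0))\<^sup>2) = 1"
    using assms(3) by (simp add: if_distrib[of cmod] if_distrib[of "\<lambda>x. x\<^sup>2"] cong: if_cong)
  finally show ?thesis by simp
qed

lemma pure_bound_ratio:
  assumes "herm_map n k \<Psi>" "pure_bound n \<Psi> C" "0 < n" "A \<in> herm n"
  shows "schatten2 (\<Psi> A) / schatten1 A \<le> C"
\<comment> \<open>A quotient with denominator 0 is 0, so this case asks for 0 \<le> C.\<close>
proof (cases "schatten1 A = 0")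
  case False
  then have "0 < schatten1 A" using schatten1_nonneg[OF assms(4)] by simp
  then show ?thesis using pure_bound_schatten1[OF assms(1,2,4)] by (simp add: divide_le_eq)
qed (use pure_bound_nonneg[OF assms(1-3)] in simp)

lemma norm_1to2_le:
  assumes "herm_map n k \<Psi>" "pure_bound n \<Psi> C" "0 < n"
  shows "norm_1to2 n \<Psi> \<le> C"
  unfolding norm_1to2_def
proof (rule cSup_least)
  have "(1\<^sub>m n :: complex mat) \<noteq> 0\<^sub>m n n"
    using assms(3) by (metis index_one_mat(1) index_zero_mat(1) zero_neq_one)
  moreover have "1\<^sub>m n \<in> herm n" by (intro hermI) auto
  ultimately show "{schatten2 (\<Psi> \<rho>) / schatten1 \<rho> |\<rho>. \<rho> \<in> herm n \<and> \<rho> \<noteq> 0\<^sub>m n n} \<noteq> {}" by blast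
qed (use pure_bound_ratio[OF assms] in blast)

text \<open>The complex-linear map with matrix coefficients \<open>c i j r s\<close>, i.e. \<open>E\<^sub>i\<^sub>j \<mapsto> (c i j r s)\<^sub>r\<^sub>s\<close>.\<close>

definition lin_map :: "nat \<Rightarrow> nat \<Rightarrow> (nat \<Rightarrow> nat \<Rightarrow> nat \<Rightarrow> nat \<Rightarrow> complex) \<Rightarrow> complex mat \<Rightarrow> complex mat" where
  "lin_map n k c X = mat k k (\<lambda>(r,s). \<Sum>i<n. \<Sum>j<n. X $$ (i,j) * c i j r s)"

text \<open>Read with row index (i, r) and column index (j, s), this is the Choi matrix of
  \<open>\<Phi>\<close>.\<close>

definition coef :: "nat \<Rightarrow> (complex mat \<Rightarrow> complex mat) \<Rightarrow> nat \<Rightarrow> nat \<Rightarrow> nat \<Rightarrow> nat \<Rightarrow> complex" where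
  "coef n \<Phi> i j r s = cplx \<Phi> (matunit n i j) $$ (r,s)"

text \<open>Induction over the set of entries of X that are kept, adding one matrix unit at a
  time.\<close>

lemma linear_functional_expand:
  fixes L :: "complex mat \<Rightarrow> complex"
  assumes add: "\<And>X Y. X \<in> carrier_mat n n \<Longrightarrow> Y \<in> carrier_mat n n \<Longrightarrow> L (X + Y) = L X + L Y"
    and smult: "\<And>X a. X \<in> carrier_mat n n \<Longrightarrow> L (a \<cdot>\<^sub>m X) = a * L X"
    and X: "X \<in> carrier_mat n n"
  shows "L X = (\<Sum>i<n. \<Sum>j<n. X $$ (i,j) * L (matunit n i j))"
proof -
  define R where "R S = mat n n (\<lambda>p. if p \<in> S then X $$ p else 0)" for S
  have z: "L (0\<^sub>m n n) = 0" using add[of "0\<^sub>m n n" "0\<^sub>m n n"] by simp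
  have "L (R S) = (\<Sum>p\<in>S. X $$ p * L (matunit n (fst p) (snd p)))"
    if "finite S" "S \<subseteq> {..<n} \<times> {..<n}" for S
    using that
  proof (induction S)
    case empty
    have "R {} = 0\<^sub>m n n" by (intro eq_matI) (auto simp: R_def)
    then show ?case using z by simp
  next
    case (insert p S)
    have "R (insert p S) = R S + X $$ p \<cdot>\<^sub>m matunit n (fst p) (snd p)"
      using insert by (intro eq_matI) (auto simp: R_def matunit_def)
    then have "L (R (insert p S)) = L (R S) + X $$ p * L (matunit n (fst p) (snd p))"
      by (simp add: add smult R_def matunit_def)
    then show ?case using insert by simp
  qed
  from this[of "{..<n} \<times> {..<n}"]
  have "L (R ({..<n} \<times> {..<n})) = (\<Sum>p\<in>{..<n} \<times> {..<n}. X $$ p * L (matunit n (fst p) (snd p)))"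
    by simp
  also have "R ({..<n} \<times> {..<n}) = X" using X by (intro eq_matI) (auto simp: R_def)
  finally show ?thesis by (simp add: sum.cartesian_product case_prod_unfold)
qed

section \<open>Complexification of Hermiticity-preserving maps\<close>

definition re_part :: "complex mat \<Rightarrow> complex mat" where
  "re_part X = (1/2) \<cdot>\<^sub>m (X + mat_adjoint X)"

definition im_part :: "complex mat \<Rightarrow> complex mat" where
  "im_part X = (- \<i>/2) \<cdot>\<^sub>m (X - mat_adjoint X)"

lemma cplx_parts: "cplx \<Phi> X = \<Phi> (re_part X) + \<i> \<cdot>\<^sub>m \<Phi> (im_part X)"
  by (simp add: cplx_def re_part_def im_part_def)

lemma re_part_index: "X \<in> carrier_mat n n \<Longrightarrow> i < n \<Longrightarrow> j < n \<Longrightarrow>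
    re_part X $$ (i,j) = (X $$ (i,j) + cnj (X $$ (j,i))) / 2"
  and im_part_index: "X \<in> carrier_mat n n \<Longrightarrow> i < n \<Longrightarrow> j < n \<Longrightarrow>
    im_part X $$ (i,j) = - \<i> * (X $$ (i,j) - cnj (X $$ (j,i))) / 2"
  by (auto simp: re_part_def im_part_def)

lemma parts_carrier: "X \<in> carrier_mat n n \<Longrightarrow> re_part X \<in> carrier_mat n n"
  "X \<in> carrier_mat n n \<Longrightarrow> im_part X \<in> carrier_mat n n"
  by (auto simp: re_part_def im_part_def)

lemma parts_herm:
  assumes "X \<in> carrier_mat n n"
  shows "re_part X \<in> herm n" "im_part X \<in> herm n"
  using parts_carrier[OF assms]
  by (auto intro!: hermI simp: re_part_index[OF assms] im_part_index[OF assms] algebra_simps)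

lemma mat_cong:
  assumes "A \<in> carrier_mat n n" "B \<in> carrier_mat n n"
    and "\<And>i j. i < n \<Longrightarrow> j < n \<Longrightarrow> A $$ (i,j) = B $$ (i,j)"
  shows "A = B"
  using assms by (intro eq_matI) auto

context
  fixes n k \<Phi>
  assumes \<Phi>: "herm_map n k \<Phi>"
begin

lemma cplx_carrier:
  assumes "X \<in> carrier_mat n n"
  shows "cplx \<Phi> X \<in> carrier_mat k k"
  using herm_carrier[OF herm_map_herm[OF \<Phi> parts_herm(1)[OF assms]]]
    herm_carrier[OF herm_map_herm[OF \<Phi> parts_herm(2)[OF assms]]]
  by (auto simp: cplx_parts)

lemma cplx_add:
  assumes X: "X \<in> carrier_mat n n" and Y: "Y \<in> carrier_mat n n"
  shows "cplx \<Phi> (X + Y) = cplx \<Phi> X + cplx \<Phi> Y"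
proof -
  have XY: "X + Y \<in> carrier_mat n n" using assms by auto
  have 1: "re_part (X + Y) = re_part X + re_part Y"
    using parts_carrier X Y XY
    by (intro mat_cong[of _ n]) (auto simp: re_part_index[of _ n] parts_carrier carrier_matD[OF parts_carrier(1)] field_simps)
  have 2: "im_part (X + Y) = im_part X + im_part Y"
    using parts_carrier X Y XY
    by (intro mat_cong[of _ n]) (auto simp: im_part_index[of _ n] carrier_matD[OF parts_carrier(2)] field_simps)
  have c: "\<Phi> (re_part X) \<in> carrier_mat k k" "\<Phi> (im_part X) \<in> carrier_mat k k"
    "\<Phi> (re_part Y) \<in> carrier_mat k k" "\<Phi> (im_part Y) \<in> carrier_mat k k"
    by (auto intro!: herm_carrier herm_map_herm[OF \<Phi>] parts_herm X Y)
  show ?thesis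
    unfolding cplx_parts 1 2 herm_map_add[OF \<Phi> parts_herm(1)[OF X] parts_herm(1)[OF Y]]
      herm_map_add[OF \<Phi> parts_herm(2)[OF X] parts_herm(2)[OF Y]]
    using c by (intro mat_cong[of _ k]) (auto simp: algebra_simps)
qed

lemma cplx_real_smult:
  assumes X: "X \<in> carrier_mat n n"
  shows "cplx \<Phi> (complex_of_real a \<cdot>\<^sub>m X) = complex_of_real a \<cdot>\<^sub>m cplx \<Phi> X"
proof -
  have aX: "complex_of_real a \<cdot>\<^sub>m X \<in> carrier_mat n n" using assms by auto
  have 1: "re_part (complex_of_real a \<cdot>\<^sub>m X) = complex_of_real a \<cdot>\<^sub>m re_part X"
    using parts_carrier X aX
    by (intro mat_cong[of _ n]) (auto simp: re_part_index[of _ n] carrier_matD[OF parts_carrier(1)] field_simps)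
  have 2: "im_part (complex_of_real a \<cdot>\<^sub>m X) = complex_of_real a \<cdot>\<^sub>m im_part X"
    using parts_carrier X aX
    by (intro mat_cong[of _ n]) (auto simp: im_part_index[of _ n] carrier_matD[OF parts_carrier(2)] field_simps)
  have c: "\<Phi> (re_part X) \<in> carrier_mat k k" "\<Phi> (im_part X) \<in> carrier_mat k k"
    by (auto intro!: herm_carrier herm_map_herm[OF \<Phi>] parts_herm X)
  show ?thesis
    unfolding cplx_parts 1 2 herm_map_smult[OF \<Phi> parts_herm(1)[OF X]]
      herm_map_smult[OF \<Phi> parts_herm(2)[OF X]]
    using c by (intro mat_cong[of _ k]) (auto simp: algebra_simps)
qed

text \<open>Multiplication by the imaginary unit turns the pair of parts (H, K) into (-K,
  H).\<close>

lemma cplx_i_smult: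
  assumes X: "X \<in> carrier_mat n n"
  shows "cplx \<Phi> (\<i> \<cdot>\<^sub>m X) = \<i> \<cdot>\<^sub>m cplx \<Phi> X"
proof -
  have aX: "\<i> \<cdot>\<^sub>m X \<in> carrier_mat n n" using assms by auto
  have 1: "re_part (\<i> \<cdot>\<^sub>m X) = complex_of_real (- 1) \<cdot>\<^sub>m im_part X"
    using parts_carrier X aX
    by (intro mat_cong[of _ n]) (auto simp: re_part_index[of _ n] im_part_index[of _ n] carrier_matD[OF parts_carrier(2)] field_simps)
  have 2: "im_part (\<i> \<cdot>\<^sub>m X) = re_part X"
    using parts_carrier X aX
    by (intro mat_cong[of _ n]) (auto simp: re_part_index[of _ n] im_part_index[of _ n] field_simps)
  have c: "\<Phi> (re_part X) \<in> carrier_mat k k" "\<Phi> (im_part X) \<in> carrier_mat k k"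
    by (auto intro!: herm_carrier herm_map_herm[OF \<Phi>] parts_herm X)
  show ?thesis
    unfolding cplx_parts 1 2 herm_map_smult[OF \<Phi> parts_herm(2)[OF X]]
    using c by (intro mat_cong[of _ k]) (auto simp: algebra_simps)
qed

lemma cplx_smult:
  assumes X: "X \<in> carrier_mat n n"
  shows "cplx \<Phi> (a \<cdot>\<^sub>m X) = a \<cdot>\<^sub>m cplx \<Phi> X"
proof -
  have "a \<cdot>\<^sub>m X = complex_of_real (Re a) \<cdot>\<^sub>m X + \<i> \<cdot>\<^sub>m (complex_of_real (Im a) \<cdot>\<^sub>m X)"
    using X by (intro mat_cong[of _ n]) (auto, metis complex_eq distrib_right mult.assoc)
  then have "cplx \<Phi> (a \<cdot>\<^sub>m X)
      = complex_of_real (Re a) \<cdot>\<^sub>m cplx \<Phi> X + \<i> \<cdot>\<^sub>m (complex_of_real (Im a) \<cdot>\<^sub>m cplx \<Phi> X)"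
    using X by (simp add: cplx_add cplx_i_smult cplx_real_smult)
  also have "\<dots> = a \<cdot>\<^sub>m cplx \<Phi> X"
    using cplx_carrier[OF X] by (intro mat_cong[of _ k]) (auto, metis complex_eq distrib_right mult.assoc)
  finally show ?thesis .
qed

lemma cplx_expand:
  assumes "X \<in> carrier_mat n n" "r < k" "s < k"
  shows "cplx \<Phi> X $$ (r,s) = (\<Sum>i<n. \<Sum>j<n. X $$ (i,j) * coef n \<Phi> i j r s)"
  unfolding coef_def
  by (rule linear_functional_expand[where L = "\<lambda>X. cplx \<Phi> X $$ (r,s)"])
    (use assms in \<open>auto simp: cplx_add cplx_smult carrier_matD[OF cplx_carrier]\<close>)

lemma cplx_herm:
  assumes "A \<in> herm n"
  shows "cplx \<Phi> A = \<Phi> A"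
proof -
  have A: "A \<in> carrier_mat n n" "mat_adjoint A = A" using assms by (auto simp: herm_def)
  have "re_part A = A" unfolding re_part_def A(2) using A(1) by (intro mat_cong[of _ n]) auto
  moreover have "im_part A = 0\<^sub>m n n" unfolding im_part_def A(2) using A(1) by (intro mat_cong[of _ n]) auto
  ultimately show ?thesis
    using herm_carrier[OF herm_map_herm[OF \<Phi> assms]]
    by (intro mat_cong[of _ k]) (auto simp: cplx_parts herm_map_zero[OF \<Phi>])
qed

text \<open>The bridge from a map specified on Hermitian matrices to sums over its
  coefficients.\<close>

lemma herm_map_lin_map:
  assumes "A \<in> herm n"
  shows "\<Phi> A = lin_map n k (coef n \<Phi>) A"
  using herm_carrier[OF herm_map_herm[OF \<Phi> assms]] cplx_expand[OF herm_carrier[OF assms]]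
  by (intro mat_cong[of _ k]) (auto simp: lin_map_def cplx_herm[OF assms])

text \<open>Passing from a matrix unit to its adjoint keeps \<open>re_part\<close> and negates
  \<open>im_part\<close>, and the images of both parts are Hermitian.\<close>

lemma coef_cnj:
  assumes "i < n" "j < n" "r < k" "s < k"
  shows "coef n \<Phi> j i s r = cnj (coef n \<Phi> i j r s)"
proof -
  have X: "matunit n i j \<in> carrier_mat n n" for i j
    by (auto simp: matunit_def)
  have u: "matunit n i j $$ (p,q) = delta p i * delta q j" if "p < n" "q < n" for i j p q
    using that by (simp add: matunit_def delta_def)
  have [simp]: "cnj (delta p q) = delta p q" for p q by (simp add: delta_def)
  have 1: "re_part (matunit n j i) = re_part (matunit n i j)"
  proof (rule mat_cong[of _ n])
    fix p q assume "p < n" "q < n"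
    then show "re_part (matunit n j i) $$ (p,q) = re_part (matunit n i j) $$ (p,q)"
      by (simp add: re_part_index[OF X] u algebra_simps)
  qed (rule parts_carrier[OF X])+
  have 2: "im_part (matunit n j i) = complex_of_real (- 1) \<cdot>\<^sub>m im_part (matunit n i j)"
  proof (rule mat_cong[of _ n])
    fix p q assume "p < n" "q < n"
    then show "im_part (matunit n j i) $$ (p,q) = (complex_of_real (- 1) \<cdot>\<^sub>m im_part (matunit n i j)) $$ (p,q)"
      by (simp add: im_part_index[OF X] u carrier_matD[OF parts_carrier(2)[OF X]] algebra_simps)
  qed (use parts_carrier[OF X] in auto)
  have h: "\<Phi> (re_part (matunit n i j)) \<in> herm k" "\<Phi> (im_part (matunit n i j)) \<in> herm k"
    by (auto intro!: herm_map_herm[OF \<Phi>] parts_herm X)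
  show ?thesis
    unfolding coef_def cplx_parts 1 2 herm_map_smult[OF \<Phi> parts_herm(2)[OF X]]
    using assms h[THEN herm_carrier] by (auto simp: herm_cnj[OF h(1)] herm_cnj[OF h(2)] algebra_simps)
qed

text \<open>Trace preservation is assumed on Hermitian matrices; it reaches matrix units through
  their two Hermitian parts.\<close>

lemma coef_trace:
  assumes tp: "trace_preserving n \<Phi>" and ij: "i < n" "j < n"
  shows "(\<Sum>r<k. coef n \<Phi> i j r r) = delta i j"
proof -
  have X: "matunit n i j \<in> carrier_mat n n" by (auto simp: matunit_def)
  have c: "\<Phi> (re_part (matunit n i j)) \<in> carrier_mat k k" "\<Phi> (im_part (matunit n i j)) \<in> carrier_mat k k"
    by (auto intro!: herm_carrier herm_map_herm[OF \<Phi>] parts_herm X)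
  have "(\<Sum>r<k. coef n \<Phi> i j r r) = mtrace (\<Phi> (re_part (matunit n i j))) + \<i> * mtrace (\<Phi> (im_part (matunit n i j)))"
    unfolding coef_def cplx_parts mtrace_def using c by (auto simp: sum.distrib sum_distrib_left)
  also have "\<dots> = mtrace (re_part (matunit n i j)) + \<i> * mtrace (im_part (matunit n i j))"
    using tp parts_herm[OF X] by (simp add: trace_preserving_def)
  also have "\<dots> = (\<Sum>r<n. matunit n i j $$ (r,r))"
    unfolding mtrace_def using parts_carrier[OF X]
    by (auto simp: re_part_index[OF X] im_part_index[OF X] sum_distrib_left field_simps simp flip: sum.distrib intro!: sum.cong)
  also have "\<dots> = (\<Sum>r<n. delta i r * delta r j)"
    by (intro sum.cong) (auto simp: matunit_def delta_def)
  finally show ?thesis by (simp add: sum_delta_left ij)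
qed

end

section \<open>Tensor products and Kraus representations\<close>

lemma mult_add_less:
  fixes i n a m :: nat
  assumes "i < n" "a < m"
  shows "i*m+a < n*m"
proof -
  have "i*m+a < Suc i * m" using assms by simp
  also have "\<dots> \<le> n*m" using assms by (intro mult_le_mono1) simp
  finally show ?thesis .
qed

text \<open>The Kronecker index \<open>i*m+a\<close> encodes the pair (i, a), recovered by quotient
  and remainder.\<close>

lemma sum_div_mod:
  fixes f :: "nat \<Rightarrow> nat \<Rightarrow> 'b::comm_monoid_add"
  shows "(\<Sum>p<n*m. f (p div m) (p mod m)) = (\<Sum>i<n. \<Sum>a<m. f i a)"
proof (cases "m = 0")
  case False
  have "(\<Sum>p<n*m. f (p div m) (p mod m)) = (\<Sum>q\<in>{..<n}\<times>{..<m}. f (fst q) (snd q))"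
  proof (rule sum.reindex_bij_witness[where j = "\<lambda>p. (p div m, p mod m)" and i = "\<lambda>q. fst q * m + snd q"])
    show "fst q * m + snd q \<in> {..<n*m}" if "q \<in> {..<n}\<times>{..<m}" for q
      using that mult_add_less[of "fst q" n "snd q" m] by auto
  qed (use False in \<open>auto simp: less_mult_imp_div_less\<close>)
  then show ?thesis by (simp add: sum.cartesian_product case_prod_unfold)
qed simp

lemma sum_mult_add:
  fixes g :: "nat \<Rightarrow> 'b::comm_monoid_add"
  shows "(\<Sum>p<n*m. g p) = (\<Sum>i<n. \<Sum>a<m. g (i*m+a))"
  using sum_div_mod[where f = "\<lambda>i a. g (i*m+a)" and n = n and m = m] by (simp add: mult.commute)

lemma div_mod_less: "p < n*m \<Longrightarrow> p div m < n \<and> p mod m < m" for p n m :: nat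
  by (cases "m = 0") (auto simp: less_mult_imp_div_less)

lemma outer_index: "i < n \<Longrightarrow> j < n \<Longrightarrow> outer n v $$ (i,j) = v i * cnj (v j)"
  by (simp add: outer_def)

lemma outer_eq_zero:
  assumes "(\<Sum>i<n. (cmod (v i))\<^sup>2) = 0"
  shows "outer n v = 0\<^sub>m n n"
proof -
  have "v i = 0" if "i < n" for i using assms that by (simp add: sum_nonneg_eq_0_iff)
  then show ?thesis by (intro mat_cong[of _ n]) (auto simp: outer_def)
qed

text \<open>Hermiticity of the Choi matrix, the coefficient form of mapping Hermitian matrices to
  Hermitian ones.\<close>

definition coef_herm :: "nat \<Rightarrow> nat \<Rightarrow> (nat \<Rightarrow> nat \<Rightarrow> nat \<Rightarrow> nat \<Rightarrow> complex) \<Rightarrow> bool" where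
  "coef_herm n k c \<longleftrightarrow> (\<forall>i<n. \<forall>j<n. \<forall>r<k. \<forall>s<k. cnj (c i j r s) = c j i s r)"

lemma lin_map_carrier [simp]: "lin_map n k c X \<in> carrier_mat k k"
  by (simp add: lin_map_def)

lemma lin_map_index: "r < k \<Longrightarrow> s < k \<Longrightarrow> lin_map n k c X $$ (r,s) = (\<Sum>i<n. \<Sum>j<n. X $$ (i,j) * c i j r s)"
  by (simp add: lin_map_def)

lemma herm_map_lin:
  assumes "coef_herm n k c"
  shows "herm_map n k (lin_map n k c)"
  unfolding herm_map_def
proof (intro conjI ballI allI)
  fix A assume A: "A \<in> herm n"
  show "lin_map n k c A \<in> herm k"
  proof (rule hermI)
    fix r s assume rs: "r < k" "s < k"
    have "cnj (lin_map n k c A $$ (r,s)) = (\<Sum>i<n. \<Sum>j<n. A $$ (j,i) * c j i s r)"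
      using assms rs unfolding lin_map_index[OF rs] cnj_sum complex_cnj_mult
      by (intro sum.cong refl) (auto simp: herm_cnj[OF A] coef_herm_def)
    also have "\<dots> = (\<Sum>j<n. \<Sum>i<n. A $$ (j,i) * c j i s r)" by (rule sum.swap)
    finally show "cnj (lin_map n k c A $$ (r,s)) = lin_map n k c A $$ (s,r)"
      by (simp add: lin_map_index rs)
  qed simp
next
  fix A B assume "A \<in> herm n" "B \<in> herm n"
  then show "lin_map n k c (A + B) = lin_map n k c A + lin_map n k c B"
    by (intro mat_cong[of _ k])
      (auto simp: lin_map_index carrier_matD[OF herm_carrier] carrier_matD[OF lin_map_carrier] distrib_right sum.distrib)
next
  fix A and r :: real assume "A \<in> herm n"
  then show "lin_map n k c (complex_of_real r \<cdot>\<^sub>m A) = complex_of_real r \<cdot>\<^sub>m lin_map n k c A"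
    by (intro mat_cong[of _ k])
      (auto simp: lin_map_index carrier_matD[OF herm_carrier] carrier_matD[OF lin_map_carrier] sum_distrib_left mult.assoc)
qed

text \<open>Complexifying a map that is already complex linear changes nothing. This identifies the
  coefficients of a tensor product, so that products can be iterated.\<close>

lemma coef_lin_map:
  assumes "i < n" "j < n" "r < k" "s < k"
  shows "coef n (lin_map n k c) i j r s = c i j r s"
proof -
  have X: "matunit n i j \<in> carrier_mat n n" by (auto simp: matunit_def)
  have "coef n (lin_map n k c) i j r s
      = (\<Sum>p<n. \<Sum>q<n. (re_part (matunit n i j) $$ (p,q) + \<i> * im_part (matunit n i j) $$ (p,q)) * c p q r s)"
    unfolding coef_def cplx_parts using assms
    by (simp add: lin_map_index carrier_matD[OF lin_map_carrier] distrib_right sum.distrib sum_distrib_left mult.assoc)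
  also have "\<dots> = (\<Sum>p<n. \<Sum>q<n. matunit n i j $$ (p,q) * c p q r s)"
    by (intro sum.cong refl) (auto simp: re_part_index[OF X] im_part_index[OF X] field_simps)
  also have "\<dots> = (\<Sum>p<n. delta i p * (\<Sum>q<n. delta j q * c p q r s))"
    unfolding sum_distrib_left by (intro sum.cong refl) (auto simp: matunit_def delta_def)
  finally show ?thesis using assms by (simp add: sum_delta_left)
qed

definition tensor_coef :: "nat \<Rightarrow> nat \<Rightarrow> (nat \<Rightarrow> nat \<Rightarrow> nat \<Rightarrow> nat \<Rightarrow> complex) \<Rightarrow>
    (nat \<Rightarrow> nat \<Rightarrow> nat \<Rightarrow> nat \<Rightarrow> complex) \<Rightarrow> nat \<Rightarrow> nat \<Rightarrow> nat \<Rightarrow> nat \<Rightarrow> complex" where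
  "tensor_coef m l c c' p q r s = c (p div m) (q div m) (r div l) (s div l) * c' (p mod m) (q mod m) (r mod l) (s mod l)"

lemma tensor_map_lin_map:
  "tensor_map n m k l \<Phi> \<Omega> = lin_map (n*m) (k*l) (tensor_coef m l (coef n \<Phi>) (coef m \<Omega>))"
proof (intro ext mat_cong[of _ "k*l"])
  fix X r s assume rs: "r < k*l" "s < k*l"
  let ?f = "\<lambda>i j a b. X $$ (i*m+a, j*m+b) * coef n \<Phi> i j (r div l) (s div l) * coef m \<Omega> a b (r mod l) (s mod l)"
  have "tensor_map n m k l \<Phi> \<Omega> X $$ (r,s) = (\<Sum>i<n. \<Sum>j<n. \<Sum>a<m. \<Sum>b<m. ?f i j a b)"
    using rs by (simp add: tensor_map_def coef_def)
  also have "\<dots> = (\<Sum>i<n. \<Sum>a<m. \<Sum>j<n. \<Sum>b<m. ?f i j a b)"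
    by (intro sum.cong refl sum.swap)
  also have "\<dots> = (\<Sum>i<n. \<Sum>a<m. \<Sum>q<n*m. ?f i (q div m) a (q mod m))"
    by (intro sum.cong refl sum_div_mod[symmetric])
  also have "\<dots> = (\<Sum>p<n*m. \<Sum>q<n*m. ?f (p div m) (q div m) (p mod m) (q mod m))"
    by (rule sum_div_mod[symmetric])
  finally show "tensor_map n m k l \<Phi> \<Omega> X $$ (r,s) = lin_map (n*m) (k*l) (tensor_coef m l (coef n \<Phi>) (coef m \<Omega>)) X $$ (r,s)"
    using rs by (simp add: lin_map_index tensor_coef_def mult.assoc)
qed (auto simp: tensor_map_def)

lemma tensor_coef_herm:
  assumes "coef_herm n k c" "coef_herm m l c'"
  shows "coef_herm (n*m) (k*l) (tensor_coef m l c c')"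
  unfolding coef_herm_def
proof (intro allI impI)
  fix i j r s assume "i < n*m" "j < n*m" "r < k*l" "s < k*l"
  from this[THEN div_mod_less] show "cnj (tensor_coef m l c c' i j r s) = tensor_coef m l c c' j i s r"
    using assms by (simp add: coef_herm_def tensor_coef_def)
qed

lemma coef_herm_coef: "herm_map n k \<Phi> \<Longrightarrow> coef_herm n k (coef n \<Phi>)"
  unfolding coef_herm_def using coef_cnj[symmetric] by blast

lemma herm_map_tensor:
  assumes "herm_map n k \<Phi>" "herm_map m l \<Omega>"
  shows "herm_map (n*m) (k*l) (tensor_map n m k l \<Phi> \<Omega>)"
  unfolding tensor_map_lin_map
  by (intro herm_map_lin tensor_coef_herm coef_herm_coef assms)

text \<open>The identity function agrees with the coefficient map on n x n matrices, and the two
  Hermitian parts of a matrix unit have that size.\<close>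

lemma coef_id:
  assumes "i < n" "j < n" "r < n" "s < n"
  shows "coef n (\<lambda>X. X) i j r s = delta i r * delta j s"
proof -
  have "lin_map n n (\<lambda>i j r s. delta i r * delta j s) X = X" if "X \<in> carrier_mat n n" for X
  proof (rule mat_cong[of _ n])
    fix r s assume rs: "r < n" "s < n"
    have "lin_map n n (\<lambda>i j r s. delta i r * delta j s) X $$ (r,s) = (\<Sum>i<n. (\<Sum>j<n. X $$ (i,j) * delta j s) * delta i r)"
      unfolding lin_map_index[OF rs] sum_distrib_right by (simp only: mult_ac)
    then show "lin_map n n (\<lambda>i j r s. delta i r * delta j s) X $$ (r,s) = X $$ (r,s)"
      using rs by (simp add: sum_delta_right)
  qed (use that in auto)
  then have "coef n (\<lambda>X. X) i j r s = coef n (lin_map n n (\<lambda>i j r s. delta i r * delta j s)) i j r s"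
    unfolding coef_def cplx_parts by (simp add: parts_carrier matunit_def)
  then show ?thesis by (simp add: coef_lin_map assms)
qed

section \<open>Kraus representations, with the operators given by their entries\<close>

definition kraus :: "nat \<Rightarrow> nat \<Rightarrow> (nat \<Rightarrow> nat \<Rightarrow> nat \<Rightarrow> nat \<Rightarrow> complex) \<Rightarrow> bool" where
  "kraus n k c \<longleftrightarrow> (\<exists>(T::nat) K. \<forall>i<n. \<forall>j<n. \<forall>r<k. \<forall>s<k. c i j r s = (\<Sum>t<T. K t r i * cnj (K t s j)))"

lemma krausI:
  fixes T :: nat
  assumes "\<And>i j r s. i < n \<Longrightarrow> j < n \<Longrightarrow> r < k \<Longrightarrow> s < k \<Longrightarrow> c i j r s = (\<Sum>t<T. K t r i * cnj (K t s j))"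
  shows "kraus n k c"
  unfolding kraus_def by (intro exI[of _ T] exI[of _ K]) (simp add: assms)

text \<open>If the x_u are Gram vectors of P, the vectors K_t x_u are Gram vectors of the
  image.\<close>

lemma kraus_positive:
  assumes "kraus n k c" "P \<in> psd n"
  shows "lin_map n k c P \<in> psd k"
proof -
  obtain T :: nat and K where K: "\<And>i j r s. i < n \<Longrightarrow> j < n \<Longrightarrow> r < k \<Longrightarrow> s < k \<Longrightarrow> c i j r s = (\<Sum>t<T. K t r i * cnj (K t s j))"
    using assms(1) unfolding kraus_def by blast
  obtain x where x: "\<And>i j. i < n \<Longrightarrow> j < n \<Longrightarrow> P $$ (i,j) = (\<Sum>u<n. x u i * cnj (x u j))"
    using psd_imp_gram[OF assms(2)] by blast
  let ?y = "\<lambda>p r. \<Sum>i<n. x (fst p) i * K (snd p) r i"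
  show ?thesis
  proof (rule psd_gram[where T = "{..<n}\<times>{..<T}" and x = ?y])
    fix r s assume rs: "r < k" "s < k"
    let ?f = "\<lambda>i j u t. (x u i * K t r i) * cnj (x u j * K t s j)"
    have "lin_map n k c P $$ (r,s) = (\<Sum>i<n. \<Sum>j<n. (\<Sum>u<n. x u i * cnj (x u j)) * (\<Sum>t<T. K t r i * cnj (K t s j)))"
      using rs by (simp add: lin_map_index K x)
    also have "\<dots> = (\<Sum>i<n. \<Sum>j<n. \<Sum>p\<in>{..<n}\<times>{..<T}. ?f i j (fst p) (snd p))"
      by (simp add: sum_product sum.cartesian_product case_prod_unfold mult_ac)
    also have "\<dots> = (\<Sum>p\<in>{..<n}\<times>{..<T}. \<Sum>i<n. \<Sum>j<n. ?f i j (fst p) (snd p))"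
      by (rule sum_rotate)
    also have "\<dots> = (\<Sum>p\<in>{..<n}\<times>{..<T}. ?y p r * cnj (?y p s))"
      unfolding cnj_sum sum_product ..
    finally show "lin_map n k c P $$ (r,s) = (\<Sum>p\<in>{..<n}\<times>{..<T}. ?y p r * cnj (?y p s))" .
  qed simp
qed

text \<open>The Kronecker products of the Kraus operators of the factors serve, with the pair of
  labels packed into one index.\<close>

lemma kraus_tensor:
  assumes "kraus n k c" "kraus m l c'"
  shows "kraus (n*m) (k*l) (tensor_coef m l c c')"
proof -
  obtain T :: nat and K where K: "\<And>i j r s. i < n \<Longrightarrow> j < n \<Longrightarrow> r < k \<Longrightarrow> s < k \<Longrightarrow> c i j r s = (\<Sum>t<T. K t r i * cnj (K t s j))"
    using assms(1) unfolding kraus_def by blast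
  obtain T' :: nat and K' where K': "\<And>i j r s. i < m \<Longrightarrow> j < m \<Longrightarrow> r < l \<Longrightarrow> s < l \<Longrightarrow> c' i j r s = (\<Sum>t<T'. K' t r i * cnj (K' t s j))"
    using assms(2) unfolding kraus_def by blast
  let ?K = "\<lambda>t r i. K (t div T') (r div l) (i div m) * K' (t mod T') (r mod l) (i mod m)"
  have "tensor_coef m l c c' i j r s = (\<Sum>t<T*T'. ?K t r i * cnj (?K t s j))"
    if "i < n*m" "j < n*m" "r < k*l" "s < k*l" for i j r s
  proof -
    have "(\<Sum>t<T*T'. ?K t r i * cnj (?K t s j))
       = (\<Sum>t<T. \<Sum>t'<T'. (K t (r div l) (i div m) * K' t' (r mod l) (i mod m)) * cnj (K t (s div l) (j div m) * K' t' (s mod l) (j mod m)))"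
      by (rule sum_div_mod)
    also have "\<dots> = (\<Sum>t<T. K t (r div l) (i div m) * cnj (K t (s div l) (j div m)))
        * (\<Sum>t'<T'. K' t' (r mod l) (i mod m) * cnj (K' t' (s mod l) (j mod m)))"
      unfolding sum_product by (simp only: complex_cnj_mult mult_ac)
    also have "\<dots> = tensor_coef m l c c' i j r s"
      using that[THEN div_mod_less] by (simp add: tensor_coef_def K K')
    finally show ?thesis by simp
  qed
  then show ?thesis by (rule krausI)
qed

lemma kraus_cong:
  assumes "\<And>i j r s. i < n \<Longrightarrow> j < n \<Longrightarrow> r < k \<Longrightarrow> s < k \<Longrightarrow> c i j r s = c' i j r s"
  shows "kraus n k c \<longleftrightarrow> kraus n k c'"
  unfolding kraus_def using assms by auto

lemma kraus_id: "kraus n n (coef n (\<lambda>X. X))"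
  by (rule krausI[where T = 1 and K = "\<lambda>t r i. delta i r"]) (auto simp: coef_id delta_def)

lemma kraus_imp_completely_positive:
  assumes "kraus n k (coef n \<Phi>)"
  shows "completely_positive n k \<Phi>"
  unfolding completely_positive_def tensor_map_lin_map
  by (auto intro!: kraus_positive kraus_tensor kraus_id assms)

text \<open>Choi: apply \<open>id \<otimes> \<Phi>\<close> to the maximally entangled state.\<close>

lemma completely_positive_imp_kraus:
  assumes "completely_positive n k \<Phi>" "0 < n"
  shows "kraus n k (coef n \<Phi>)"
proof -
  \<comment> \<open>The vector is left unnormalised: P then has entries 0 and 1, and the entries of
    its image are exactly the coefficients of \<open>\<Phi>\<close>.\<close>
  define P where "P = outer (n*n) (\<lambda>p. delta (p div n) (p mod n))"
  have P: "P $$ (i*n+a, j*n+b) = delta i a * delta j b" if "i < n" "j < n" "a < n" "b < n" for i j a b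
    using that by (simp add: P_def outer_def mult_add_less) (simp add: delta_def)
  let ?C = "tensor_map n n n k (\<lambda>X. X) \<Phi> P"
  have C: "?C \<in> psd (n*k)"
    using assms outer_psd unfolding completely_positive_def P_def by blast
  have e: "?C $$ (i*k+r, j*k+s) = coef n \<Phi> i j r s" if "i < n" "j < n" "r < k" "s < k" for i j r s
  proof -
    have "?C $$ (i*k+r, j*k+s) = (\<Sum>i'<n. \<Sum>j'<n. \<Sum>a<n. \<Sum>b<n. P $$ (i'*n+a, j'*n+b)
        * coef n (\<lambda>X. X) i' j' i j * coef n \<Phi> a b r s)"
      using that by (simp add: tensor_map_def coef_def mult_add_less)
    also have "\<dots> = (\<Sum>i'<n. \<Sum>j'<n. \<Sum>a<n. \<Sum>b<n. delta i i' * (delta j j' * (delta i' a * (delta j' b * coef n \<Phi> a b r s))))"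
      by (intro sum.cong refl) (use that in \<open>auto simp: P coef_id delta_def\<close>)
    also have "\<dots> = (\<Sum>i'<n. delta i i' * (\<Sum>j'<n. delta j j' * (\<Sum>a<n. delta i' a * (\<Sum>b<n. delta j' b * coef n \<Phi> a b r s))))"
      by (simp only: sum_distrib_left)
    also have "\<dots> = coef n \<Phi> i j r s"
      using that by (simp add: sum_delta_left)
    finally show ?thesis .
  qed
  \<comment> \<open>A Gram vector of the Choi matrix, its index split into (i, r), is a Kraus
    operator.\<close>
  obtain x where x: "\<forall>p<n*k. \<forall>q<n*k. ?C $$ (p,q) = (\<Sum>t<n*k. x t p * cnj (x t q))"
    using psd_imp_gram[OF C] by blast
  show ?thesis
  proof (rule krausI)
    fix i j r s assume "i < n" "j < n" "r < k" "s < k"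
    then show "coef n \<Phi> i j r s = (\<Sum>t<n*k. x t (i*k+r) * cnj (x t (j*k+s)))"
      using x e[of i j r s] by (simp add: mult_add_less)
  qed
qed

text \<open>The definition of complete positivity tests only amplifications by an identity map, so
  the property is carried to a product of two maps through Kraus forms.\<close>

lemma quantum_channel_tensor:
  assumes "quantum_channel n k \<Phi>" "quantum_channel m l \<Omega>" "0 < n" "0 < m"
  shows "quantum_channel (n*m) (k*l) (tensor_map n m k l \<Phi> \<Omega>)"
proof -
  have h: "herm_map n k \<Phi>" "herm_map m l \<Omega>" and tp: "trace_preserving n \<Phi>" "trace_preserving m \<Omega>"
    and kr: "kraus n k (coef n \<Phi>)" "kraus m l (coef m \<Omega>)"
    using assms completely_positive_imp_kraus by (auto simp: quantum_channel_def)
  let ?c = "tensor_coef m l (coef n \<Phi>) (coef m \<Omega>)"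
  have "kraus (n*m) (k*l) (coef (n*m) (tensor_map n m k l \<Phi> \<Omega>))"
    unfolding tensor_map_lin_map
    by (rule iffD2[OF kraus_cong kraus_tensor[OF kr]]) (simp add: coef_lin_map)
  moreover have "trace_preserving (n*m) (tensor_map n m k l \<Phi> \<Omega>)"
    unfolding trace_preserving_def
  proof
    fix A assume A: "A \<in> herm (n*m)"
    \<comment> \<open>Both factors contribute a Kronecker delta; two indices agree exactly when
      their quotients and remainders do.\<close>
    have tr: "(\<Sum>r<k*l. ?c p q r r) = delta p q" if "p < n*m" "q < n*m" for p q
    proof -
      have "(\<Sum>r<k*l. ?c p q r r) = (\<Sum>r<k. \<Sum>r'<l. coef n \<Phi> (p div m) (q div m) r r * coef m \<Omega> (p mod m) (q mod m) r' r')"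
        unfolding tensor_coef_def by (rule sum_div_mod)
      also have "\<dots> = delta (p div m) (q div m) * delta (p mod m) (q mod m)"
        using that[THEN div_mod_less] coef_trace[OF h(1) tp(1)] coef_trace[OF h(2) tp(2)]
        by (simp add: sum_product[symmetric])
      finally show ?thesis by (auto simp: delta_def) (metis div_mult_mod_eq)+
    qed
    have "mtrace (tensor_map n m k l \<Phi> \<Omega> A) = (\<Sum>r<k*l. \<Sum>p<n*m. \<Sum>q<n*m. A $$ (p,q) * ?c p q r r)"
      unfolding tensor_map_lin_map mtrace_def by (simp add: lin_map_index carrier_matD[OF lin_map_carrier])
    also have "\<dots> = (\<Sum>p<n*m. \<Sum>q<n*m. \<Sum>r<k*l. A $$ (p,q) * ?c p q r r)"
      by (rule sum_rotate[symmetric])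
    also have "\<dots> = (\<Sum>p<n*m. \<Sum>q<n*m. A $$ (p,q) * delta q p)"
      unfolding sum_distrib_left[symmetric] by (intro sum.cong refl) (simp add: tr delta_def)
    also have "\<dots> = mtrace A"
      using herm_carrier[OF A] by (simp add: sum_delta_right mtrace_def)
    finally show "mtrace (tensor_map n m k l \<Phi> \<Omega> A) = mtrace A" .
  qed
  ultimately show ?thesis
    using h by (auto simp: quantum_channel_def herm_map_tensor kraus_imp_completely_positive)
qed

lemma quantum_channel_density:
  assumes "quantum_channel n k \<Phi>" "0 < n" "A \<in> density n"
  shows "\<Phi> A \<in> density k"
proof -
  have "herm_map n k \<Phi>" "kraus n k (coef n \<Phi>)" "trace_preserving n \<Phi>" "A \<in> psd n" "A \<in> herm n" "mtrace A = 1"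
    using assms completely_positive_imp_kraus by (auto simp: quantum_channel_def density_def psd_def)
  then show ?thesis
    using kraus_positive[of n k "coef n \<Phi>" A] by (auto simp: density_def trace_preserving_def herm_map_lin_map)
qed

text \<open>Makes the set in the definition of the norm bounded above, without which its supremum is junk.\<close>

lemma ex_pure_bound:
  assumes \<Phi>: "herm_map n k \<Phi>"
  shows "\<exists>C. pure_bound n \<Phi> C"
proof -
  let ?c = "coef n \<Phi>"
  define C where "C = (\<Sum>p\<in>{..<k}\<times>{..<k}. \<Sum>i<n. \<Sum>j<n. cmod (?c i j (fst p) (snd p)))"
  have "schatten2 (\<Phi> (outer n v)) \<le> C * (\<Sum>i<n. (cmod (v i))\<^sup>2)" for v
  proof -
    let ?N = "\<Sum>i<n. (cmod (v i))\<^sup>2"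
    have b: "cmod (v i) * cmod (v j) \<le> ?N" if "i < n" "j < n" for i j
    proof -
      have "(cmod (v i))\<^sup>2 \<le> ?N" "(cmod (v j))\<^sup>2 \<le> ?N" using that by (auto intro!: member_le_sum)
      then show ?thesis using sum_squares_bound[of "cmod (v i)" "cmod (v j)"] by linarith
    qed
    have c: "\<Phi> (outer n v) \<in> carrier_mat k k" using herm_carrier[OF herm_map_herm[OF \<Phi> outer_herm]] .
    have "cmod (\<Phi> (outer n v) $$ p) \<le> (\<Sum>i<n. \<Sum>j<n. cmod (?c i j (fst p) (snd p))) * ?N"
      if "p \<in> {..<k}\<times>{..<k}" for p
    proof -
      have "\<Phi> (outer n v) $$ p = (\<Sum>i<n. \<Sum>j<n. v i * cnj (v j) * ?c i j (fst p) (snd p))"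
        using that by (auto simp: herm_map_lin_map[OF \<Phi> outer_herm] lin_map_index outer_index)
      also have "cmod \<dots> \<le> (\<Sum>i<n. \<Sum>j<n. cmod (v i * cnj (v j) * ?c i j (fst p) (snd p)))"
        by (intro order_trans[OF norm_sum] sum_mono norm_sum)
      also have "\<dots> \<le> (\<Sum>i<n. \<Sum>j<n. cmod (?c i j (fst p) (snd p)) * ?N)"
        using b by (intro sum_mono) (simp only: norm_mult complex_mod_cnj mult.commute[of _ "cmod (?c _ _ _ _)"],
          auto intro: mult_left_mono)
      finally show ?thesis by (simp only: sum_distrib_right)
    qed
    then have "(\<Sum>p\<in>{..<k}\<times>{..<k}. cmod (\<Phi> (outer n v) $$ p)) \<le> C * ?N"
      unfolding C_def sum_distrib_right[where A = "{..<k}\<times>{..<k}"] by (intro sum_mono)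
    moreover have "schatten2 (\<Phi> (outer n v)) \<le> (\<Sum>p\<in>{..<k}\<times>{..<k}. cmod (\<Phi> (outer n v) $$ p))"
      unfolding schatten2_L2[OF c] by (intro L2_set_le_sum) auto
    ultimately show ?thesis by linarith
  qed
  then show ?thesis unfolding pure_bound_def by blast
qed

lemma pure_bound_norm:
  assumes \<Phi>: "herm_map n k \<Phi>" and n: "0 < n"
  shows "pure_bound n \<Phi> (norm_1to2 n \<Phi>)"
  unfolding pure_bound_def
proof
  fix v
  let ?N = "\<Sum>i<n. (cmod (v i))\<^sup>2"
  obtain C where C: "pure_bound n \<Phi> C" using ex_pure_bound[OF \<Phi>] by blast
  have s1: "schatten1 (outer n v) = ?N" by (simp add: schatten1_psd[OF outer_psd] mtrace_outer)
  show "schatten2 (\<Phi> (outer n v)) \<le> norm_1to2 n \<Phi> * ?N"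
  \<comment> \<open>The zero matrix is excluded from the supremum and has to be treated
    apart.\<close>
  proof (cases "outer n v = 0\<^sub>m n n")
    case True
    have "complex_of_real ?N = mtrace (0\<^sub>m n n)" unfolding mtrace_outer[symmetric] True ..
    then have "complex_of_real ?N = 0" by (simp add: mtrace_def del: of_real_sum)
    then have "?N = 0" by (simp only: of_real_eq_0_iff)
    then show ?thesis using True by (simp add: herm_map_zero[OF \<Phi>] schatten2_eq[of _ k k])
  next
    case False
    then have "?N \<noteq> 0" using outer_eq_zero by blast
    then have N: "0 < ?N" by (simp add: sum_nonneg order_le_neq_trans)
    have "schatten2 (\<Phi> (outer n v)) / schatten1 (outer n v) \<le> norm_1to2 n \<Phi>"
      unfolding norm_1to2_def
    proof (rule cSup_upper)
      show "bdd_above {schatten2 (\<Phi> \<rho>) / schatten1 \<rho> |\<rho>. \<rho> \<in> herm n \<and> \<rho> \<noteq> 0\<^sub>m n n}"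
        using pure_bound_ratio[OF \<Phi> C n] by (intro bdd_aboveI[of _ C]) blast
    qed (use False outer_herm in blast)
    then show ?thesis using N by (simp add: s1 divide_le_eq)
  qed
qed

section \<open>Traceless orthonormal bases\<close>

lemma parseval:
  assumes "orthonormal_cols n n U"
  shows "(\<Sum>t<n. (cmod (\<Sum>i<n. cnj (U i t) * x i))\<^sup>2) = (\<Sum>i<n. (cmod (x i))\<^sup>2)"
proof -
  have "complex_of_real (\<Sum>t<n. (cmod (\<Sum>i<n. cnj (U i t) * x i))\<^sup>2)
      = (\<Sum>t<n. (\<Sum>i<n. cnj (U i t) * x i) * cnj (\<Sum>j<n. cnj (U j t) * x j))"
    by (simp only: cmod_sq of_real_sum)
  also have "\<dots> = (\<Sum>t<n. \<Sum>i<n. \<Sum>j<n. (U j t * cnj (U i t)) * (x i * cnj (x j)))"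
    unfolding cnj_sum sum_product by (simp only: complex_cnj_mult complex_cnj_cnj mult_ac)
  also have "\<dots> = (\<Sum>i<n. \<Sum>j<n. \<Sum>t<n. (U j t * cnj (U i t)) * (x i * cnj (x j)))"
    by (rule sum_rotate[symmetric])
  also have "\<dots> = (\<Sum>i<n. \<Sum>j<n. (x i * cnj (x j)) * delta j i)"
    unfolding sum_distrib_right[symmetric]
    by (intro sum.cong refl) (simp add: orthonormal_rows[OF assms])
  also have "\<dots> = (\<Sum>i<n. x i * cnj (x i))"
    by (intro sum.cong refl) (simp add: sum_delta_right)
  also have "\<dots> = complex_of_real (\<Sum>i<n. (cmod (x i))\<^sup>2)" by (simp only: cmod_sq of_real_sum)
  finally show ?thesis by (simp only: of_real_eq_iff)
qed

text \<open>Rayleigh quotient: in eigencoordinates the form is a sum of squared moduli weighted by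
  d, and \<open>parseval\<close> preserves their total. All that is later extracted from the largest
  eigenvalue passes through this inequality.\<close>

lemma quad_form_le_lambda_max:
  assumes "A \<in> herm n"
  shows "Re (quad_form n A x) \<le> lambda_max A * (\<Sum>i<n. (cmod (x i))\<^sup>2)"
proof -
  obtain U d where Ud: "spectral_rep n A U d" using spectral_theorem[OF assms] by blast
  then have A: "A \<in> carrier_mat n n" and U: "orthonormal_cols n n U"
    and rep: "\<And>i j. i < n \<Longrightarrow> j < n \<Longrightarrow> A $$ (i,j) = (\<Sum>t<n. complex_of_real (d t) * U i t * cnj (U j t))"
    by (auto simp: spectral_rep_def)
  have ms: "mset (eigvals A) = mset (map (\<lambda>t. complex_of_real (d t)) [0..<n])"
    by (rule mset_eigvals[OF A U]) (rule rep)
  have d: "d t \<le> lambda_max A" if "t < n" for t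
  proof -
    have "set (eigvals A) = (\<lambda>t. complex_of_real (d t)) ` {0..<n}"
      using arg_cong[OF ms, of set_mset] by (simp only: set_mset_mset set_map set_upt)
    then have "complex_of_real (d t) \<in> set (eigvals A)" using that by auto
    then show ?thesis unfolding lambda_max_def
      by (auto intro!: Max_ge image_eqI[of _ _ "complex_of_real (d t)"])
  qed
  let ?y = "\<lambda>t. \<Sum>i<n. cnj (U i t) * x i"
  have "quad_form n A x = (\<Sum>i<n. \<Sum>j<n. \<Sum>t<n. complex_of_real (d t) * (cnj (cnj (U i t) * x i) * (cnj (U j t) * x j)))"
    unfolding quad_form_def
    by (intro sum.cong refl) (simp add: rep sum_distrib_left sum_distrib_right mult_ac)
  also have "\<dots> = (\<Sum>t<n. \<Sum>i<n. \<Sum>j<n. complex_of_real (d t) * (cnj (cnj (U i t) * x i) * (cnj (U j t) * x j)))"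
    by (rule sum_rotate)
  also have "\<dots> = (\<Sum>t<n. complex_of_real (d t) * (cnj (?y t) * ?y t))"
    unfolding cnj_sum sum_product by (simp only: sum_distrib_left)
  also have "\<dots> = complex_of_real (\<Sum>t<n. d t * (cmod (?y t))\<^sup>2)"
    by (simp only: cmod_sq of_real_sum of_real_mult)
  finally have "Re (quad_form n A x) = (\<Sum>t<n. d t * (cmod (?y t))\<^sup>2)" by simp
  also have "\<dots> \<le> (\<Sum>t<n. lambda_max A * (cmod (?y t))\<^sup>2)"
    by (intro sum_mono mult_right_mono) (auto simp: d)
  also have "\<dots> = lambda_max A * (\<Sum>i<n. (cmod (x i))\<^sup>2)"
    using parseval[OF U, of x] by (simp add: sum_distrib_left[symmetric])
  finally show ?thesis .
qed

text \<open>Generalised Gell-Mann matrices; the diagonal ones are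
  \<open>(E\<^sub>0\<^sub>0 + \<dots> + E\<^sub>i\<^sub>-\<^sub>1\<^sub>,\<^sub>i\<^sub>-\<^sub>1 - i E\<^sub>i\<^sub>i) / sqrt (i (i + 1))\<close>, and the index \<open>(0,0)\<close> is not used.\<close>

definition gm_diag :: "nat \<Rightarrow> nat \<Rightarrow> real" where
  "gm_diag i p = (if p < i then 1 else if p = i then - real i else 0) / sqrt (real i * (real i + 1))"

definition gm :: "nat \<Rightarrow> nat \<Rightarrow> nat \<Rightarrow> nat \<Rightarrow> complex" where
  "gm i j p q = (if i < j then (delta p i * delta q j + delta p j * delta q i) / complex_of_real (sqrt 2)
     else if j < i then \<i> * (delta p i * delta q j - delta p j * delta q i) / complex_of_real (sqrt 2)
     else delta p q * complex_of_real (gm_diag i p))"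

lemma gm_diag_sum:
  assumes "i < n"
  shows "(\<Sum>p<n. gm_diag i p) = 0"
proof -
  have "(\<Sum>p<n. if p < i then 1 else if p = i then - real i else 0) = (\<Sum>p<Suc i. if p < i then 1 else - real i)"
    using assms by (intro sum.mono_neutral_cong_right) auto
  also have "\<dots> = 0" by simp
  finally show ?thesis unfolding gm_diag_def by (simp add: sum_divide_distrib[symmetric])
qed

text \<open>On the positions up to i, which contain the support of \<open>gm_diag i\<close>, the
  entries of \<open>gm_diag j\<close> are constant, and those of \<open>gm_diag i\<close> sum to 0.
  Division by zero makes \<open>gm_diag 0\<close> vanish, so i = 0 fits in.\<close>

lemma gm_diag_orth_less:
  assumes "i < j" "j < n"
  shows "(\<Sum>p<n. gm_diag i p * gm_diag j p) = 0"
proof -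
  have "(\<Sum>p<n. gm_diag i p * gm_diag j p) = (\<Sum>p<n. gm_diag i p * (1 / sqrt (real j * (real j + 1))))"
    using assms(1) by (intro sum.cong refl) (auto simp: gm_diag_def)
  also have "\<dots> = (\<Sum>p<n. gm_diag i p) * (1 / sqrt (real j * (real j + 1)))"
    by (simp only: sum_distrib_right)
  finally show ?thesis using gm_diag_sum[of i n] assms by simp
qed

lemma gm_diag_orth:
  assumes "i < n" "j < n" "0 < i"
  shows "(\<Sum>p<n. gm_diag i p * gm_diag j p) = (if i = j then 1 else 0)"
proof (cases i j rule: linorder_cases)
  case less
  then show ?thesis using gm_diag_orth_less assms by simp
next
  case greater
  then show ?thesis using gm_diag_orth_less[of j i n] assms by (simp add: mult.commute)
next
  case equal
  let ?N = "real i * (real i + 1)"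
  have "(\<Sum>p<n. gm_diag i p * gm_diag i p) = (\<Sum>p<n. (if p < i then 1 else if p = i then (real i)\<^sup>2 else 0) / ?N)"
    by (intro sum.cong refl) (auto simp: gm_diag_def power2_eq_square)
  also have "\<dots> = (\<Sum>p<n. if p < i then 1 else if p = i then (real i)\<^sup>2 else 0) / ?N"
    by (rule sum_divide_distrib[symmetric])
  also have "(\<Sum>p<n. if p < i then 1 else if p = i then (real i)\<^sup>2 else 0) = (\<Sum>p<Suc i. if p < i then 1 else (real i)\<^sup>2)"
    using assms by (intro sum.mono_neutral_cong_right) auto
  also have "\<dots> = ?N" by (simp add: power2_eq_square algebra_simps)
  finally show ?thesis using assms equal by simp
qed

lemma gm_cnj: "cnj (gm i j p q) = gm i j q p"
  by (auto simp: gm_def delta_def)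

text \<open>Pairing with an off-diagonal generator reads off two entries of M, with a diagonal one a
  combination of the diagonal. Orthogonality thereby reduces to evaluating entries.\<close>

lemma gm_trace_mult:
  assumes "i < n" "j < n"
  shows "(\<Sum>p<n. \<Sum>q<n. M p q * gm i j q p) =
    (if i < j then (M i j + M j i) / complex_of_real (sqrt 2)
     else if j < i then \<i> * (M j i - M i j) / complex_of_real (sqrt 2)
     else (\<Sum>p<n. M p p * complex_of_real (gm_diag i p)))"
proof -
  have e: "(\<Sum>p<n. \<Sum>q<n. M p q * (delta q a * delta p b)) = M b a" if "a < n" "b < n" for a b
  proof -
    have "(\<Sum>p<n. \<Sum>q<n. M p q * (delta q a * delta p b)) = (\<Sum>p<n. (\<Sum>q<n. M p q * delta q a) * delta p b)"
      by (simp only: sum_distrib_right mult.assoc)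
    then show ?thesis using that by (simp add: sum_delta_right)
  qed
  consider "i < j" | "j < i" | "i = j" by linarith
  then show ?thesis
  proof cases
    case 1
    have "(\<Sum>p<n. \<Sum>q<n. M p q * gm i j q p)
        = ((\<Sum>p<n. \<Sum>q<n. M p q * (delta q i * delta p j)) + (\<Sum>p<n. \<Sum>q<n. M p q * (delta q j * delta p i))) / complex_of_real (sqrt 2)"
      unfolding sum.distrib[symmetric] sum_divide_distrib using 1
      by (intro sum.cong refl) (simp add: gm_def field_simps)
    then show ?thesis using 1 assms by (simp add: e add.commute)
  next
    case 2
    have "(\<Sum>p<n. \<Sum>q<n. M p q * gm i j q p)
        = \<i> * ((\<Sum>p<n. \<Sum>q<n. M p q * (delta q i * delta p j)) - (\<Sum>p<n. \<Sum>q<n. M p q * (delta q j * delta p i))) / complex_of_real (sqrt 2)"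
      unfolding sum_subtractf[symmetric] sum_divide_distrib sum_distrib_left using 2
      by (intro sum.cong refl) (simp add: gm_def field_simps)
    then show ?thesis using 2 assms by (simp add: e)
  next
    case 3
    have "(\<Sum>p<n. \<Sum>q<n. M p q * gm i j q p) = (\<Sum>p<n. \<Sum>q<n. (M p q * complex_of_real (gm_diag i q)) * delta q p)"
      using 3 by (intro sum.cong refl) (simp add: gm_def)
    then show ?thesis using 3 by (simp add: sum_delta_right)
  qed
qed

lemma gm_orth:
  assumes "i < n" "j < n" "i' < n" "j' < n" "(i,j) \<noteq> (0,0)"
  shows "(\<Sum>p<n. \<Sum>q<n. gm i j p q * gm i' j' q p) = (if i = i' \<and> j = j' then 1 else 0)"
proof (cases "i' = j'")
  case True
  then show ?thesis
  proof (cases "i = j")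
    case True
    have "(\<Sum>p<n. \<Sum>q<n. gm i j p q * gm i' j' q p) = complex_of_real (\<Sum>p<n. gm_diag i p * gm_diag i' p)"
      using True \<open>i' = j'\<close> assms(3,4) by (subst gm_trace_mult) (auto simp: gm_def delta_def)
    also have "(\<Sum>p<n. gm_diag i p * gm_diag i' p) = (if i = i' then 1 else 0)"
      by (rule gm_diag_orth) (use assms True in auto)
    finally show ?thesis using True \<open>i' = j'\<close> by auto
  next
    case False
    then have "gm i j p p = 0" for p by (auto simp: gm_def delta_def)
    then show ?thesis using True False assms(3,4) by (subst gm_trace_mult) auto
  qed
next
  case False
  have [simp]: "complex_of_real (sqrt 2) * complex_of_real (sqrt 2) = 2"
    by (simp flip: of_real_mult)
  show ?thesis using False assms(3,4)
    by (subst gm_trace_mult) (auto simp: gm_def delta_def field_simps)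
qed

lemma onb_traceless_exists:
  assumes n: "0 < n"
  shows "\<exists>Ms. onb_traceless n Ms"
proof -
  \<comment> \<open>The shift by one skips the pair (0,0): p below n^2 - 1 runs over the other index
    pairs, each once.\<close>
  define I where "I p = (Suc p div n)" for p
  define J where "J p = (Suc p mod n)" for p
  define M where "M p = mat n n (\<lambda>(a,b). gm (I p) (J p) a b)" for p
  define Ms where "Ms = map M [0..<n^2-1]"
  have IJ: "I p < n \<and> J p < n \<and> (I p, J p) \<noteq> (0,0)" if "p < n^2-1" for p
  proof -
    have "Suc p < n * n" using that by (simp add: power2_eq_square)
    then have "I p < n \<and> J p < n" using div_mod_less unfolding I_def J_def by blast
    moreover have "Suc p = I p * n + J p" by (simp add: I_def J_def)
    ultimately show ?thesis by (cases "I p") auto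
  qed
  have inj: "I p = I q \<and> J p = J q \<longleftrightarrow> p = q" for p q
    unfolding I_def J_def by (metis div_mult_mod_eq nat.inject)
  have tr: "mtrace (M p * M q) = (\<Sum>a<n. \<Sum>b<n. gm (I p) (J p) a b * gm (I q) (J q) b a)" for p q
    by (simp add: mtrace_def M_def scalar_prod_def atLeast0LessThan)
  have "M p \<in> herm0 n" if "p < n^2-1" for p
  proof -
    have "M p \<in> herm n" by (rule hermI) (auto simp: M_def gm_cnj)
    moreover have "mtrace (M p) = 0"
    proof (cases "I p = J p")
      case True
      have "mtrace (M p) = complex_of_real (\<Sum>a<n. gm_diag (I p) a)"
        using True by (simp add: mtrace_def M_def gm_def delta_def)
      then show ?thesis using gm_diag_sum[of "I p" n] IJ[OF that] by simp
    next
      case False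
      then have "gm (I p) (J p) a a = 0" for a by (auto simp: gm_def delta_def)
      then show ?thesis by (simp add: mtrace_def M_def)
    qed
    ultimately show ?thesis by (simp add: herm0_def)
  qed
  moreover have "mtrace (M p * M q) = (if p = q then 1 else 0)" if "p < n^2-1" "q < n^2-1" for p q
    unfolding tr using gm_orth[of "I p" n "J p" "I q" "J q"] IJ[OF that(1)] IJ[OF that(2)] inj[of p q] by simp
  ultimately have "onb_traceless n Ms"
    unfolding onb_traceless_def Ms_def by auto
  then show ?thesis by blast
qed

section \<open>Unital trace-preserving maps in an adapted basis\<close>

lemma unital_scaled_identity:
  assumes \<Phi>: "herm_map n k \<Phi>" and u: "unital n k \<Phi>" and n: "0 < n"
    and rs: "r < k" "s < k"
  shows "(\<Sum>i<n. coef n \<Phi> i i r s) = complex_of_real (real n / real k) * delta r s"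
proof -
  have I: "complex_of_real (1 / real n) \<cdot>\<^sub>m 1\<^sub>m n \<in> herm n" by (intro hermI) auto
  have "(complex_of_real (1 / real k) \<cdot>\<^sub>m 1\<^sub>m k) $$ (r,s)
      = (\<Sum>i<n. \<Sum>j<n. (complex_of_real (1 / real n) \<cdot>\<^sub>m 1\<^sub>m n) $$ (i,j) * coef n \<Phi> i j r s)"
    using u unfolding unital_def herm_map_lin_map[OF \<Phi> I] by (simp only: lin_map_index[OF rs, symmetric])
  also have "\<dots> = (\<Sum>i<n. \<Sum>j<n. delta i j * (complex_of_real (1 / real n) * coef n \<Phi> i j r s))"
    by (intro sum.cong refl) (auto simp: delta_def)
  also have "\<dots> = complex_of_real (1 / real n) * (\<Sum>i<n. coef n \<Phi> i i r s)"
    unfolding sum_distrib_left by (intro sum.cong refl) (simp only: sum_delta_left lessThan_iff)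
  finally show ?thesis using n rs by (auto simp: delta_def field_simps)
qed

text \<open>Basis matrices flattened into columns: q is the Kronecker index of an entry, p numbers
  the basis element, and the column after the last of \<open>Ms\<close> is I/sqrt n. With n^2
  columns the array is square, so orthonormality yields completeness.\<close>

definition basis_entry :: "nat \<Rightarrow> complex mat list \<Rightarrow> nat \<Rightarrow> nat \<Rightarrow> complex" where
  "basis_entry n Ms q p = (if p < length Ms then Ms ! p $$ (q div n, q mod n)
     else delta (q div n) (q mod n) / complex_of_real (sqrt (real n)))"

lemma basis_entry_orthonormal:
  assumes Ms: "onb_traceless n Ms" and n: "0 < n"
  shows "orthonormal_cols (n*n) (n*n) (basis_entry n Ms)"
  unfolding orthonormal_cols_def
proof (intro allI impI)
  fix p p' assume p: "p < n*n" "p' < n*n"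
  let ?L = "length Ms" and ?e = "\<lambda>p i j. basis_entry n Ms (i*n+j) p"
  have L: "Suc ?L = n*n" using Ms n by (simp add: onb_traceless_def power2_eq_square)
  have M0: "Ms ! p \<in> herm0 n" if "p < ?L" for p using Ms that by (auto simp: onb_traceless_def)
  then have M: "Ms ! p \<in> herm n" "mtrace (Ms ! p) = 0" if "p < ?L" for p using that by (auto simp: herm0_def)
  have e1: "?e p i j = Ms ! p $$ (i,j)" if "p < ?L" "i < n" "j < n" for p i j
    using that by (simp add: basis_entry_def)
  have e2: "?e p i j = delta i j / complex_of_real (sqrt (real n))" if "\<not> p < ?L" "i < n" "j < n" for p i j
    using that by (simp add: basis_entry_def)
  have tr: "(\<Sum>i<n. Ms ! p $$ (i,i)) = 0" if "p < ?L" for p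
    using M[OF that] herm_carrier[OF M(1)[OF that]] by (simp add: mtrace_def)
  have sq: "complex_of_real (sqrt (real n)) * complex_of_real (sqrt (real n)) = of_nat n"
    by (simp flip: of_real_mult)
  have "(\<Sum>q<n*n. cnj (basis_entry n Ms q p) * basis_entry n Ms q p') = (\<Sum>i<n. \<Sum>j<n. cnj (?e p i j) * ?e p' i j)"
    by (rule sum_mult_add)
  also have "\<dots> = delta p p'"
  proof (cases "p < ?L"; cases "p' < ?L")
    assume a: "p < ?L" "p' < ?L"
    have "(\<Sum>i<n. \<Sum>j<n. cnj (?e p i j) * ?e p' i j) = (\<Sum>i<n. \<Sum>j<n. Ms ! p' $$ (i,j) * Ms ! p $$ (j,i))"
      by (intro sum.cong refl) (simp add: e1 a herm_cnj[OF M(1)])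
    also have "\<dots> = mtrace (Ms ! p' * Ms ! p)"
      using herm_carrier[OF M(1)[OF a(1)]] herm_carrier[OF M(1)[OF a(2)]]
      by (simp add: mtrace_def scalar_prod_def atLeast0LessThan)
    also have "\<dots> = delta p p'" using Ms a by (auto simp: onb_traceless_def delta_def)
    finally show ?thesis .
  next
    assume a: "p < ?L" "\<not> p' < ?L"
    have "(\<Sum>i<n. \<Sum>j<n. cnj (?e p i j) * ?e p' i j) = (\<Sum>i<n. (\<Sum>j<n. cnj (Ms ! p $$ (i,j)) * delta j i) / complex_of_real (sqrt (real n)))"
      unfolding sum_divide_distrib by (intro sum.cong refl) (simp add: e1 e2 a, simp add: delta_def)
    also have "\<dots> = cnj (\<Sum>i<n. Ms ! p $$ (i,i)) / complex_of_real (sqrt (real n))"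
      by (simp add: sum_delta_right sum_divide_distrib)
    finally show ?thesis using a by (auto simp: tr[OF a(1)] delta_def)
  next
    assume a: "\<not> p < ?L" "p' < ?L"
    have "(\<Sum>i<n. \<Sum>j<n. cnj (?e p i j) * ?e p' i j) = (\<Sum>i<n. (\<Sum>j<n. Ms ! p' $$ (i,j) * delta j i) / complex_of_real (sqrt (real n)))"
      unfolding sum_divide_distrib by (intro sum.cong refl) (simp add: e1 e2 a, simp add: delta_def)
    also have "\<dots> = (\<Sum>i<n. Ms ! p' $$ (i,i)) / complex_of_real (sqrt (real n))"
      by (simp add: sum_delta_right sum_divide_distrib)
    finally show ?thesis using a by (auto simp: tr[OF a(2)] delta_def)
  next
    assume a: "\<not> p < ?L" "\<not> p' < ?L"
    have "(\<Sum>i<n. \<Sum>j<n. cnj (?e p i j) * ?e p' i j) = (\<Sum>i<n. \<Sum>j<n. delta i j * (1 / of_nat n))"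
      by (intro sum.cong refl) (simp add: e2 a sq[symmetric], simp add: delta_def)
    also have "\<dots> = (\<Sum>i<n. 1 / of_nat n)"
      by (intro sum.cong refl) (simp only: sum_delta_left lessThan_iff)
    also have "\<dots> = 1" using n by simp
    finally show ?thesis using a L p by (simp add: delta_def)
  qed
  finally show "(\<Sum>q<n*n. cnj (basis_entry n Ms q p) * basis_entry n Ms q p') = delta p p'" .
qed

text \<open>Expand \<open>X\<close> in the orthonormal basis \<open>M\<^sub>0, M\<^sub>1, \<dots>, I/sqrt n\<close>. The image of the last element is a
  multiple of the identity, hence orthogonal to the traceless images of the others.\<close>

lemma unital_tp_bound:
  fixes X :: "nat \<Rightarrow> nat \<Rightarrow> complex"
  assumes \<Phi>: "herm_map n k \<Phi>" and u: "unital n k \<Phi>" and tp: "trace_preserving n \<Phi>"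
    and n: "0 < n" and k: "0 < k"
  defines "a \<equiv> lambda_max (A_mat n \<Phi>)"
  shows "(\<Sum>r<k. \<Sum>s<k. (cmod (\<Sum>i<n. \<Sum>j<n. X i j * coef n \<Phi> i j r s))\<^sup>2)
     \<le> (1 / real k - a / real n) * (cmod (\<Sum>i<n. X i i))\<^sup>2 + a * (\<Sum>i<n. \<Sum>j<n. (cmod (X i j))\<^sup>2)"
    and "0 \<le> a"
proof -
  define Ms where "Ms = (SOME Ms. onb_traceless n Ms)"
  have onb: "onb_traceless n Ms" unfolding Ms_def by (rule someI_ex[OF onb_traceless_exists[OF n]])
  define L where "L = length Ms"
  have L: "Suc L = n*n" using onb n by (simp add: onb_traceless_def L_def power2_eq_square)
  have M0: "Ms ! p \<in> herm0 n" if "p < L" for p using onb that by (auto simp: onb_traceless_def L_def)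
  then have M: "Ms ! p \<in> herm n" "mtrace (Ms ! p) = 0" if "p < L" for p using that by (auto simp: herm0_def)
  define V where "V = basis_entry n Ms"
  have V: "orthonormal_cols (n*n) (n*n) V" unfolding V_def by (rule basis_entry_orthonormal[OF onb n])
  have V1: "V (i*n+j) p = Ms ! p $$ (i,j)" if "p < L" "i < n" "j < n" for p i j
    using that by (simp add: V_def basis_entry_def L_def)
  have V2: "V (i*n+j) L = delta i j / complex_of_real (sqrt (real n))" if "i < n" "j < n" for i j
    using that by (simp add: V_def basis_entry_def L_def)
  define F where "F p r s = (\<Sum>i<n. \<Sum>j<n. V (i*n+j) p * coef n \<Phi> i j r s)" for p r s
  \<comment> \<open>The Gram matrix of the images of all basis elements; its corner with indices
    below L is \<open>A_mat n \<Phi>\<close>.\<close>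
  define B where "B p p' = (\<Sum>r<k. \<Sum>s<k. F p r s * cnj (F p' r s))" for p p'
  have F1: "F p r s = \<Phi> (Ms ! p) $$ (r,s)" if "p < L" "r < k" "s < k" for p r s
    unfolding herm_map_lin_map[OF \<Phi> M(1)[OF that(1)]] lin_map_index[OF that(2,3)] F_def
    using that by (intro sum.cong refl) (simp add: V1)
  \<comment> \<open>Unitality sends I/sqrt n to sqrt n / k times the identity.\<close>
  have F2: "F L r s = complex_of_real (sqrt (real n) / real k) * delta r s" if "r < k" "s < k" for r s
  proof -
    have "F L r s = (\<Sum>i<n. \<Sum>j<n. delta i j * (coef n \<Phi> i j r s / complex_of_real (sqrt (real n))))"
      unfolding F_def by (intro sum.cong refl) (simp add: V2)
    also have "\<dots> = (\<Sum>i<n. coef n \<Phi> i i r s) / complex_of_real (sqrt (real n))"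
      unfolding sum_divide_distrib by (intro sum.cong refl) (simp only: sum_delta_left lessThan_iff)
    also have "\<dots> = complex_of_real ((real n / sqrt (real n)) / real k) * delta r s"
      by (simp add: unital_scaled_identity[OF \<Phi> u n that])
    also have "real n / sqrt (real n) = sqrt (real n)" using n by (simp add: real_div_sqrt)
    finally show ?thesis .
  qed
  have \<Phi>M: "\<Phi> (Ms ! p) \<in> herm k" "(\<Sum>r<k. \<Phi> (Ms ! p) $$ (r,r)) = 0" if "p < L" for p
  proof -
    show h: "\<Phi> (Ms ! p) \<in> herm k" by (rule herm_map_herm[OF \<Phi> M(1)[OF that]])
    have "mtrace (\<Phi> (Ms ! p)) = 0" using tp M[OF that] by (simp add: trace_preserving_def)
    then show "(\<Sum>r<k. \<Phi> (Ms ! p) $$ (r,r)) = 0" using herm_carrier[OF h] by (simp add: mtrace_def)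
  qed
  let ?A = "A_mat n \<Phi>"
  have A: "?A = mat L L (\<lambda>(i,j). mtrace (\<Phi> (Ms!i) * \<Phi> (Ms!j)))"
    unfolding A_mat_def Let_def Ms_def[symmetric] L_def ..
  have AB: "?A $$ (p,p') = B p p'" if "p < L" "p' < L" for p p'
  proof -
    have "?A $$ (p,p') = (\<Sum>r<k. \<Sum>s<k. \<Phi> (Ms!p) $$ (r,s) * \<Phi> (Ms!p') $$ (s,r))"
      unfolding A using that herm_carrier[OF \<Phi>M(1)[OF that(1)]] herm_carrier[OF \<Phi>M(1)[OF that(2)]]
      by (simp add: mtrace_def scalar_prod_def atLeast0LessThan)
    also have "\<dots> = B p p'"
      unfolding B_def using that by (intro sum.cong refl) (simp add: F1 herm_cnj[OF \<Phi>M(1)])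
    finally show ?thesis .
  qed
  have Bcnj: "cnj (B p p') = B p' p" for p p'
    by (simp add: B_def mult.commute)
  have Ah: "?A \<in> herm L"
    by (rule hermI) (simp add: A, simp add: AB Bcnj)
  have BLL: "B L L = complex_of_real (real n / real k)"
  proof -
    have "B L L = (\<Sum>r<k. \<Sum>s<k. delta r s * complex_of_real (sqrt (real n) / real k * (sqrt (real n) / real k)))"
      unfolding B_def by (intro sum.cong refl) (simp add: F2, simp add: delta_def flip: of_real_mult)
    also have "\<dots> = (\<Sum>r<k. complex_of_real (sqrt (real n) / real k * (sqrt (real n) / real k)))"
      by (intro sum.cong refl) (simp only: sum_delta_left lessThan_iff)
    also have "\<dots> = complex_of_real (real k * (sqrt (real n) / real k * (sqrt (real n) / real k)))" by simp
    also have "real k * (sqrt (real n) / real k * (sqrt (real n) / real k)) = real n / real k"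
      using k by (simp add: field_simps)
    finally show ?thesis .
  qed
  have BpL: "B p L = 0" if "p < L" for p
  proof -
    have "B p L = (\<Sum>r<k. \<Sum>s<k. (\<Phi> (Ms!p) $$ (r,s) * complex_of_real (sqrt (real n) / real k)) * delta s r)"
      unfolding B_def using that by (intro sum.cong refl) (simp add: F1 F2, simp add: delta_def)
    also have "\<dots> = (\<Sum>r<k. \<Phi> (Ms!p) $$ (r,r) * complex_of_real (sqrt (real n) / real k))"
      by (intro sum.cong refl) (simp only: sum_delta_right lessThan_iff)
    also have "\<dots> = 0" unfolding sum_distrib_right[symmetric] using \<Phi>M(2)[OF that] by simp
    finally show ?thesis .
  qed
  then have BLp: "B L p = 0" if "p < L" for p using Bcnj[of p L] that by simp
  \<comment> \<open>The coordinates of X are complex, since X is not assumed Hermitian; the matrix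
    \<open>?A\<close> is therefore used as a Hermitian form.\<close>
  define c where "c p = (\<Sum>q<n*n. cnj (V q p) * X (q div n) (q mod n))" for p
  have X: "X i j = (\<Sum>p<n*n. c p * V (i*n+j) p)" if "i < n" "j < n" for i j
  proof -
    let ?q = "i*n+j"
    have q: "?q < n*n" using that by (rule mult_add_less)
    have "(\<Sum>p<n*n. c p * V ?q p) = (\<Sum>p<n*n. \<Sum>q<n*n. (V ?q p * cnj (V q p)) * X (q div n) (q mod n))"
      unfolding c_def sum_distrib_right by (simp only: mult_ac)
    also have "\<dots> = (\<Sum>q<n*n. (\<Sum>p<n*n. V ?q p * cnj (V q p)) * X (q div n) (q mod n))"
      unfolding sum_distrib_right by (rule sum.swap)
    also have "\<dots> = (\<Sum>q<n*n. delta ?q q * X (q div n) (q mod n))"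
      by (intro sum.cong refl) (simp add: orthonormal_rows[OF V q])
    also have "\<dots> = X i j" unfolding sum_delta_left[OF q] using that by simp
    finally show ?thesis by simp
  qed
  have cn: "(\<Sum>p<n*n. (cmod (c p))\<^sup>2) = (\<Sum>i<n. \<Sum>j<n. (cmod (X i j))\<^sup>2)"
    unfolding c_def parseval[OF V] by (rule sum_div_mod)
  have cL: "(cmod (c L))\<^sup>2 = (cmod (\<Sum>i<n. X i i))\<^sup>2 / real n"
  proof -
    have "c L = (\<Sum>i<n. \<Sum>j<n. cnj (V (i*n+j) L) * X i j)"
      unfolding c_def sum_mult_add by (intro sum.cong refl) simp
    also have "\<dots> = (\<Sum>i<n. \<Sum>j<n. delta i j * (X i j / complex_of_real (sqrt (real n))))"
      by (intro sum.cong refl) (simp add: V2, simp add: delta_def)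
    also have "\<dots> = (\<Sum>i<n. X i i) / complex_of_real (sqrt (real n))"
      unfolding sum_divide_distrib by (intro sum.cong refl) (simp only: sum_delta_left lessThan_iff)
    finally show ?thesis by (simp add: norm_divide power_divide)
  qed
  define Q where "Q = (\<Sum>p<L. \<Sum>p'<L. c p * cnj (c p') * B p p')"
  have "complex_of_real (\<Sum>r<k. \<Sum>s<k. (cmod (\<Sum>i<n. \<Sum>j<n. X i j * coef n \<Phi> i j r s))\<^sup>2)
      = (\<Sum>r<k. \<Sum>s<k. (\<Sum>p<n*n. c p * F p r s) * cnj (\<Sum>p<n*n. c p * F p r s))"
  proof -
    have "(\<Sum>i<n. \<Sum>j<n. X i j * coef n \<Phi> i j r s) = (\<Sum>p<n*n. c p * F p r s)" for r s
    proof -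
      have "(\<Sum>i<n. \<Sum>j<n. X i j * coef n \<Phi> i j r s)
          = (\<Sum>i<n. \<Sum>j<n. \<Sum>p<n*n. c p * (V (i*n+j) p * coef n \<Phi> i j r s))"
        by (intro sum.cong refl) (simp add: X sum_distrib_right mult.assoc)
      also have "\<dots> = (\<Sum>p<n*n. \<Sum>i<n. \<Sum>j<n. c p * (V (i*n+j) p * coef n \<Phi> i j r s))"
        by (rule sum_rotate)
      finally show ?thesis unfolding F_def by (simp only: sum_distrib_left)
    qed
    then show ?thesis by (simp only: cmod_sq of_real_sum)
  qed
  also have "\<dots> = (\<Sum>r<k. \<Sum>s<k. \<Sum>p<n*n. \<Sum>p'<n*n. c p * cnj (c p') * (F p r s * cnj (F p' r s)))"
    unfolding cnj_sum sum_product by (simp only: complex_cnj_mult mult_ac)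
  also have "\<dots> = (\<Sum>p<n*n. \<Sum>r<k. \<Sum>s<k. \<Sum>p'<n*n. c p * cnj (c p') * (F p r s * cnj (F p' r s)))"
    by (rule sum_rotate)
  also have "\<dots> = (\<Sum>p<n*n. \<Sum>p'<n*n. \<Sum>r<k. \<Sum>s<k. c p * cnj (c p') * (F p r s * cnj (F p' r s)))"
    by (intro sum.cong refl sum_rotate)
  also have "\<dots> = (\<Sum>p<Suc L. \<Sum>p'<Suc L. c p * cnj (c p') * B p p')"
    unfolding B_def L by (simp only: sum_distrib_left)
  also have "\<dots> = Q + c L * cnj (c L) * complex_of_real (real n / real k)"
    by (simp add: Q_def sum.distrib BLL BpL BLp)
  finally have main: "complex_of_real (\<Sum>r<k. \<Sum>s<k. (cmod (\<Sum>i<n. \<Sum>j<n. X i j * coef n \<Phi> i j r s))\<^sup>2)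
      = Q + complex_of_real ((cmod (c L))\<^sup>2 * (real n / real k))"
    by (simp only: cmod_sq of_real_mult)
  \<comment> \<open>\<open>quad_form\<close> conjugates the left vector, whereas Q has the conjugate
    on the right; hence the conjugated coordinates.\<close>
  have Qq: "Q = quad_form L ?A (\<lambda>p. cnj (c p))"
    unfolding Q_def quad_form_def by (intro sum.cong refl) (simp add: AB mult_ac)
  have "Re Q \<le> a * (\<Sum>p<L. (cmod (c p))\<^sup>2)"
    using quad_form_le_lambda_max[OF Ah, of "\<lambda>p. cnj (c p)"] unfolding Qq a_def by simp
  also have "(\<Sum>p<L. (cmod (c p))\<^sup>2) = (\<Sum>i<n. \<Sum>j<n. (cmod (X i j))\<^sup>2) - (cmod (c L))\<^sup>2"
    unfolding cn[symmetric] L[symmetric] by simp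
  finally have "Re Q \<le> a * ((\<Sum>i<n. \<Sum>j<n. (cmod (X i j))\<^sup>2) - (cmod (c L))\<^sup>2)" .
  moreover have "(\<Sum>r<k. \<Sum>s<k. (cmod (\<Sum>i<n. \<Sum>j<n. X i j * coef n \<Phi> i j r s))\<^sup>2)
      = Re Q + (cmod (c L))\<^sup>2 * (real n / real k)"
    using arg_cong[OF main, of Re] by (simp only: Re_complex_of_real plus_complex.simps)
  ultimately have "(\<Sum>r<k. \<Sum>s<k. (cmod (\<Sum>i<n. \<Sum>j<n. X i j * coef n \<Phi> i j r s))\<^sup>2)
      \<le> a * ((\<Sum>i<n. \<Sum>j<n. (cmod (X i j))\<^sup>2) - (cmod (c L))\<^sup>2) + (cmod (c L))\<^sup>2 * (real n / real k)"
    by linarith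
  \<comment> \<open>The coordinate along the identity satisfies |c L|^2 = |Tr X|^2 / n, which turns
    its weight n/k - a into 1/k - a/n.\<close>
  also have "\<dots> = (1 / real k - a / real n) * (cmod (\<Sum>i<n. X i i))\<^sup>2 + a * (\<Sum>i<n. \<Sum>j<n. (cmod (X i j))\<^sup>2)"
    unfolding cL using n by (simp add: field_simps)
  finally show "(\<Sum>r<k. \<Sum>s<k. (cmod (\<Sum>i<n. \<Sum>j<n. X i j * coef n \<Phi> i j r s))\<^sup>2)
     \<le> (1 / real k - a / real n) * (cmod (\<Sum>i<n. X i i))\<^sup>2 + a * (\<Sum>i<n. \<Sum>j<n. (cmod (X i j))\<^sup>2)" .
  show "0 \<le> a"
  proof (cases "L = 0")
    \<comment> \<open>Here n = 1: there is no traceless direction, and \<open>lambda_max\<close> of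
      the empty matrix is 0 by convention.\<close>
    case True
    have "?A \<in> carrier_mat 0 0" using A True by simp
    from someI_ex[OF char_poly_factorized[OF this]] have "eigvals ?A = []"
      using A True unfolding eigvals_def by simp
    then show ?thesis by (simp add: a_def lambda_max_def)
  next
    case False
    \<comment> \<open>A first coordinate vector as test vector: the form is then the squared norm of
      the image of \<open>Ms ! 0\<close>.\<close>
    have "quad_form L ?A (delta 0) = B 0 0"
    proof -
      have "quad_form L ?A (delta 0) = (\<Sum>i<L. delta 0 i * (\<Sum>j<L. delta 0 j * B i j))"
        unfolding quad_form_def sum_distrib_left by (intro sum.cong refl) (simp add: AB delta_def)
      then show ?thesis using False by (simp add: sum_delta_left)
    qed
    also have "B 0 0 = complex_of_real (\<Sum>r<k. \<Sum>s<k. (cmod (F 0 r s))\<^sup>2)"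
      unfolding B_def by (simp only: cmod_sq of_real_sum)
    finally have "0 \<le> Re (quad_form L ?A (delta 0))" by (simp add: sum_nonneg)
    also have "\<dots> \<le> a * (\<Sum>i<L. (cmod (delta 0 i))\<^sup>2)" unfolding a_def by (rule quad_form_le_lambda_max[OF Ah])
    also have "(\<Sum>i<L. (cmod (delta 0 i))\<^sup>2) = 1"
      using False by (simp add: delta_def if_distrib[of cmod] if_distrib[of "\<lambda>x. x\<^sup>2"] cong: if_cong)
    finally show ?thesis by simp
  qed
qed

section \<open>The tensor product bound\<close>

text \<open>Once the square is expanded, the sums over r and s separate for each pair t, u. The
  mixed products of x and y become an inner product of two Gram matrices, one belonging to x alone
  and one to y alone.\<close>

lemma gram_norm:
  fixes x y :: "nat \<Rightarrow> nat \<Rightarrow> complex"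
  shows "complex_of_real (\<Sum>r<l. \<Sum>s<l. (cmod (\<Sum>t<T. x t r * cnj (y t s)))\<^sup>2)
    = (\<Sum>t<T. \<Sum>u<T. (\<Sum>r<l. x t r * cnj (x u r)) * cnj (\<Sum>s<l. y t s * cnj (y u s)))"
proof -
  have "complex_of_real (\<Sum>r<l. \<Sum>s<l. (cmod (\<Sum>t<T. x t r * cnj (y t s)))\<^sup>2)
      = (\<Sum>r<l. \<Sum>s<l. (\<Sum>t<T. x t r * cnj (y t s)) * cnj (\<Sum>t<T. x t r * cnj (y t s)))"
    by (simp only: cmod_sq of_real_sum)
  also have "\<dots> = (\<Sum>r<l. \<Sum>s<l. \<Sum>t<T. \<Sum>u<T. (x t r * cnj (x u r)) * cnj (y t s * cnj (y u s)))"
    unfolding cnj_sum sum_product by (simp only: complex_cnj_mult complex_cnj_cnj mult_ac)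
  also have "\<dots> = (\<Sum>t<T. \<Sum>r<l. \<Sum>s<l. \<Sum>u<T. (x t r * cnj (x u r)) * cnj (y t s * cnj (y u s)))"
    by (rule sum_rotate)
  also have "\<dots> = (\<Sum>t<T. \<Sum>u<T. \<Sum>r<l. \<Sum>s<l. (x t r * cnj (x u r)) * cnj (y t s * cnj (y u s)))"
    by (intro sum.cong refl sum_rotate)
  finally show ?thesis unfolding cnj_sum sum_product .
qed

text \<open>The inequality \<open>\<parallel>B\<parallel>\<^sub>2\<^sup>2 \<le> \<parallel>A\<parallel>\<^sub>2 \<parallel>C\<parallel>\<^sub>2\<close> for a positive block matrix with diagonal blocks \<open>A\<close>, \<open>C\<close> and
  off-diagonal block \<open>B\<close>: with Gram vectors \<open>x\<^sub>t \<oplus> y\<^sub>t\<close> it is Cauchy-Schwarz for the Gram matrices.\<close>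

lemma gram_block_bound:
  fixes x y :: "nat \<Rightarrow> nat \<Rightarrow> complex"
  shows "(\<Sum>r<l. \<Sum>s<l. (cmod (\<Sum>t<T. x t r * cnj (y t s)))\<^sup>2)
    \<le> sqrt (\<Sum>r<l. \<Sum>s<l. (cmod (\<Sum>t<T. x t r * cnj (x t s)))\<^sup>2)
      * sqrt (\<Sum>r<l. \<Sum>s<l. (cmod (\<Sum>t<T. y t r * cnj (y t s)))\<^sup>2)"
proof -
  define g where "g z = (\<lambda>(t,u). \<Sum>r<l. z t r * cnj (z u r))" for z :: "nat \<Rightarrow> nat \<Rightarrow> complex"
  let ?S = "{..<T}\<times>{..<T}"
  have e: "complex_of_real (\<Sum>r<l. \<Sum>s<l. (cmod (\<Sum>t<T. x t r * cnj (y t s)))\<^sup>2) = (\<Sum>p\<in>?S. g x p * cnj (g y p))"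
    for x y :: "nat \<Rightarrow> nat \<Rightarrow> complex"
    unfolding gram_norm by (simp add: sum.cartesian_product g_def case_prod_unfold)
  have e2: "(\<Sum>r<l. \<Sum>s<l. (cmod (\<Sum>t<T. x t r * cnj (x t s)))\<^sup>2) = (\<Sum>p\<in>?S. (cmod (g x p))\<^sup>2)"
    for x :: "nat \<Rightarrow> nat \<Rightarrow> complex"
    using e[of x x] by (simp only: cmod_sq of_real_sum[symmetric] of_real_eq_iff)
  have "(\<Sum>r<l. \<Sum>s<l. (cmod (\<Sum>t<T. x t r * cnj (y t s)))\<^sup>2)
      = cmod (complex_of_real (\<Sum>r<l. \<Sum>s<l. (cmod (\<Sum>t<T. x t r * cnj (y t s)))\<^sup>2))"
    unfolding norm_of_real by (intro abs_of_nonneg[symmetric] sum_nonneg) auto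
  also have "\<dots> \<le> (\<Sum>p\<in>?S. cmod (g x p * cnj (g y p)))"
    unfolding e by (rule norm_sum)
  also have "\<dots> = (\<Sum>p\<in>?S. \<bar>cmod (g x p)\<bar> * \<bar>cmod (g y p)\<bar>)" by (simp add: norm_mult)
  also have "\<dots> \<le> L2_set (\<lambda>p. cmod (g x p)) ?S * L2_set (\<lambda>p. cmod (g y p)) ?S"
    by (rule L2_set_mult_ineq)
  finally show ?thesis unfolding e2 L2_set_def .
qed

text \<open>The sign of 1/k - a/n decides, where a is the largest eigenvalue. If it is nonnegative,
  P is raised to D and the coefficients add up to 1/k + (1 - 1/n) a; if it is negative, the term in
  P is dropped and a remains. These are the two branches of \<open>gamma\<close>.\<close>

lemma gamma_bound:
  assumes a: "0 \<le> lambda_max (A_mat n \<Phi>)" and n: "0 < n" and k: "0 < k"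
    and P: "0 \<le> P" "P \<le> D" and Q: "Q \<le> D"
  shows "(1 / real k - lambda_max (A_mat n \<Phi>) / real n) * P + lambda_max (A_mat n \<Phi>) * Q \<le> gamma n k \<Phi> * D"
proof -
  let ?a = "lambda_max (A_mat n \<Phi>)"
  have aQ: "?a * Q \<le> ?a * D" using a Q by (rule mult_left_mono[rotated])
  show ?thesis
  proof (cases "real k * ?a \<le> real n")
    case True
    then have "0 \<le> 1 / real k - ?a / real n" using n k by (simp add: field_simps)
    then have "(1 / real k - ?a / real n) * P \<le> (1 / real k - ?a / real n) * D" using P(2) by (intro mult_left_mono)
    then show ?thesis using True aQ by (simp add: gamma_def Let_def algebra_simps)
  next
    case False
    then have "1 / real k - ?a / real n \<le> 0" using n k by (simp add: field_simps)
    then have "(1 / real k - ?a / real n) * P \<le> 0" using P(1) by (rule mult_nonpos_nonneg)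
    then show ?thesis using False aQ by (simp add: gamma_def Let_def)
  qed
qed

text \<open>Positivity is what splitting the logarithms in the entropy bounds requires.\<close>

lemma gamma_pos:
  assumes "herm_map n k \<Phi>" "unital n k \<Phi>" "trace_preserving n \<Phi>" "0 < n" "0 < k"
  shows "0 < gamma n k \<Phi>"
proof -
  have a: "0 \<le> lambda_max (A_mat n \<Phi>)" by (rule unital_tp_bound(2)[OF assms])
  show ?thesis
  proof (cases "real k * lambda_max (A_mat n \<Phi>) \<le> real n")
    case True
    have "0 \<le> (1 - 1 / real n) * lambda_max (A_mat n \<Phi>)" using a assms(4) by (intro mult_nonneg_nonneg) auto
    then show ?thesis using True assms(5) by (simp add: gamma_def Let_def add_pos_nonneg)
  next
    case False
    have "lambda_max (A_mat n \<Phi>) \<noteq> 0" using False by auto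
    then show ?thesis using False a by (simp add: gamma_def Let_def)
  qed
qed

text \<open>Stated as a bare sum over output indices, so that either order of the tensor factors
  reaches it by reordering sums. The indices of \<open>\<Omega>\<close> stand outside: once they are
  fixed, the rest is \<open>unital_tp_bound\<close> for one n x n matrix.\<close>

lemma tensor_core_bound:
  fixes v :: "nat \<Rightarrow> nat \<Rightarrow> complex"
  assumes \<Phi>: "herm_map n k \<Phi>" and u: "unital n k \<Phi>" and tp: "trace_preserving n \<Phi>"
    and n: "0 < n" and k: "0 < k" and m: "0 < m"
    and \<Omega>: "herm_map m l \<Omega>" and kr: "kraus m l (coef m \<Omega>)" and b: "pure_bound m \<Omega> C"
  shows "(\<Sum>r2<l. \<Sum>s2<l. \<Sum>r1<k. \<Sum>s1<k. (cmod (\<Sum>i<n. \<Sum>j<n.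
      (\<Sum>a<m. \<Sum>b<m. v i a * cnj (v j b) * coef m \<Omega> a b r2 s2) * coef n \<Phi> i j r1 s1))\<^sup>2)
    \<le> gamma n k \<Phi> * (C * (\<Sum>i<n. \<Sum>a<m. (cmod (v i a))\<^sup>2))\<^sup>2"
proof -
  define T where "T i j r s = (\<Sum>a<m. \<Sum>b<m. v i a * cnj (v j b) * coef m \<Omega> a b r s)" for i j r s
  define S where "S i = schatten2 (\<Omega> (outer m (v i)))" for i
  define N where "N i = (\<Sum>a<m. (cmod (v i a))\<^sup>2)" for i
  define D where "D = (C * (\<Sum>i<n. N i))\<^sup>2"
  have C0: "0 \<le> C" by (rule pure_bound_nonneg[OF \<Omega> b m])
  have N0: "0 \<le> N i" for i by (simp add: N_def sum_nonneg)
  have car: "\<Omega> A \<in> carrier_mat l l" if "A \<in> herm m" for A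
    by (rule herm_carrier[OF herm_map_herm[OF \<Omega> that]])
  have S0: "0 \<le> S i" for i unfolding S_def by (rule schatten2_nonneg[OF car[OF outer_herm]])
  have SC: "S i \<le> C * N i" for i using b unfolding pure_bound_def S_def N_def by blast
  have S: "S i = sqrt (\<Sum>r<l. \<Sum>s<l. (cmod (T i i r s))\<^sup>2)" for i
    unfolding S_def schatten2_eq[OF car[OF outer_herm]]
    by (intro arg_cong[of _ _ sqrt] sum.cong refl)
      (simp add: herm_map_lin_map[OF \<Omega> outer_herm] lin_map_index outer_index T_def)
  have TS: "(\<Sum>r<l. \<Sum>s<l. (cmod (T i j r s))\<^sup>2) \<le> S i * S j" for i j
  proof -
    obtain K and \<tau> :: nat where K: "\<And>a b r s. a < m \<Longrightarrow> b < m \<Longrightarrow> r < l \<Longrightarrow> s < l \<Longrightarrow>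
        coef m \<Omega> a b r s = (\<Sum>t<\<tau>. K t r a * cnj (K t s b))"
      using kr unfolding kraus_def by blast
    \<comment> \<open>The t-th Kraus operator applied to the i-th block of v; the matrices T i j are
      sums of products of these vectors.\<close>
    define x where "x i t r = (\<Sum>a<m. v i a * K t r a)" for i t r
    have "T i j r s = (\<Sum>t<\<tau>. x i t r * cnj (x j t s))" if "r < l" "s < l" for i j r s
    proof -
      have "T i j r s = (\<Sum>a<m. \<Sum>b<m. \<Sum>t<\<tau>. (v i a * K t r a) * cnj (v j b * K t s b))"
        unfolding T_def using that by (intro sum.cong refl) (simp add: K sum_distrib_left mult_ac)
      also have "\<dots> = (\<Sum>t<\<tau>. \<Sum>a<m. \<Sum>b<m. (v i a * K t r a) * cnj (v j b * K t s b))"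
        by (rule sum_rotate)
      finally show ?thesis unfolding x_def cnj_sum sum_product .
    qed
    then show ?thesis using gram_block_bound[of "x i" "x j" \<tau> l] by (simp add: S)
  qed
  have P: "(\<Sum>r<l. \<Sum>s<l. (cmod (\<Sum>i<n. T i i r s))\<^sup>2) \<le> D"
  proof -
    \<comment> \<open>The partial trace over the first factor. Applying \<open>\<Omega>\<close> to
      it gives the sum of the diagonal blocks.\<close>
    define R where "R = mat m m (\<lambda>(a,b). \<Sum>i<n. v i a * cnj (v i b))"
    have Rab: "R $$ (a,b) = (\<Sum>i<n. v i a * cnj (v i b))" if "a < m" "b < m" for a b
      using that by (simp add: R_def)
    have R: "R \<in> psd m" by (rule psd_gram[where T = "{..<n}" and x = v]) (auto simp: R_def)
    then have Rh: "R \<in> herm m" by (simp add: psd_iff)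
    have "mtrace R = (\<Sum>a<m. \<Sum>i<n. complex_of_real ((cmod (v i a))\<^sup>2))"
      by (simp only: mtrace_def R_def) (simp add: cmod_sq)
    also have "\<dots> = complex_of_real (\<Sum>i<n. N i)"
      unfolding N_def of_real_sum by (rule sum.swap)
    finally have s1: "schatten1 R = (\<Sum>i<n. N i)" by (simp add: schatten1_psd[OF R])
    have "\<Omega> R $$ (r,s) = (\<Sum>i<n. T i i r s)" if "r < l" "s < l" for r s
    proof -
      have "\<Omega> R $$ (r,s) = (\<Sum>a<m. \<Sum>b<m. \<Sum>i<n. v i a * cnj (v i b) * coef m \<Omega> a b r s)"
        using that by (simp add: herm_map_lin_map[OF \<Omega> Rh] lin_map_index Rab sum_distrib_right)
      also have "\<dots> = (\<Sum>i<n. T i i r s)" unfolding T_def by (rule sum_rotate)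
      finally show ?thesis .
    qed
    then have "sqrt (\<Sum>r<l. \<Sum>s<l. (cmod (\<Sum>i<n. T i i r s))\<^sup>2) = schatten2 (\<Omega> R)"
      by (simp add: schatten2_eq[OF car[OF Rh]])
    also have "\<dots> \<le> C * (\<Sum>i<n. N i)"
      using pure_bound_schatten1[OF \<Omega> b Rh] by (simp add: s1)
    finally show ?thesis unfolding D_def by (rule sqrt_le_D)
  qed
  have Q: "(\<Sum>r<l. \<Sum>s<l. \<Sum>i<n. \<Sum>j<n. (cmod (T i j r s))\<^sup>2) \<le> D"
  proof -
    have "(\<Sum>r<l. \<Sum>s<l. \<Sum>i<n. \<Sum>j<n. (cmod (T i j r s))\<^sup>2)
        = (\<Sum>i<n. \<Sum>r<l. \<Sum>s<l. \<Sum>j<n. (cmod (T i j r s))\<^sup>2)" by (rule sum_rotate)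
    also have "\<dots> = (\<Sum>i<n. \<Sum>j<n. \<Sum>r<l. \<Sum>s<l. (cmod (T i j r s))\<^sup>2)"
      by (intro sum.cong refl sum_rotate)
    also have "\<dots> \<le> (\<Sum>i<n. \<Sum>j<n. S i * S j)" by (intro sum_mono TS)
    also have "\<dots> = (\<Sum>i<n. S i)\<^sup>2" by (simp only: power2_eq_square sum_product)
    also have "\<dots> \<le> (\<Sum>i<n. C * N i)\<^sup>2"
      by (intro power_mono sum_mono SC sum_nonneg S0)
    finally show ?thesis by (simp add: D_def sum_distrib_left)
  qed
  let ?a = "lambda_max (A_mat n \<Phi>)"
  have "(\<Sum>r2<l. \<Sum>s2<l. \<Sum>r1<k. \<Sum>s1<k. (cmod (\<Sum>i<n. \<Sum>j<n. T i j r2 s2 * coef n \<Phi> i j r1 s1))\<^sup>2)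
      \<le> (\<Sum>r2<l. \<Sum>s2<l. (1 / real k - ?a / real n) * (cmod (\<Sum>i<n. T i i r2 s2))\<^sup>2
          + ?a * (\<Sum>i<n. \<Sum>j<n. (cmod (T i j r2 s2))\<^sup>2))"
    by (intro sum_mono unital_tp_bound(1)[OF \<Phi> u tp n k])
  also have "\<dots> = (1 / real k - ?a / real n) * (\<Sum>r<l. \<Sum>s<l. (cmod (\<Sum>i<n. T i i r s))\<^sup>2)
      + ?a * (\<Sum>r<l. \<Sum>s<l. \<Sum>i<n. \<Sum>j<n. (cmod (T i j r s))\<^sup>2)"
    by (simp only: sum.distrib sum_distrib_left)
  also have "\<dots> \<le> gamma n k \<Phi> * D"
    by (rule gamma_bound[OF unital_tp_bound(2)[OF \<Phi> u tp n k] n k _ P Q]) (intro sum_nonneg, simp)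
  finally show ?thesis unfolding T_def D_def N_def .
qed

lemma tensor_map_outer_norm:
  "(schatten2 (tensor_map n m k l \<Phi> \<Omega> (outer (n*m) v)))\<^sup>2
    = (\<Sum>r1<k. \<Sum>r2<l. \<Sum>s1<k. \<Sum>s2<l. (cmod (\<Sum>i<n. \<Sum>a<m. \<Sum>j<n. \<Sum>b<m.
        v (i*m+a) * cnj (v (j*m+b)) * (coef n \<Phi> i j r1 s1 * coef m \<Omega> a b r2 s2)))\<^sup>2)"
proof -
  let ?f = "\<lambda>r1 r2 s1 s2 i a j b. v (i*m+a) * cnj (v (j*m+b)) * (coef n \<Phi> i j r1 s1 * coef m \<Omega> a b r2 s2)"
  have e: "tensor_map n m k l \<Phi> \<Omega> (outer (n*m) v) $$ (r,s)
      = (\<Sum>i<n. \<Sum>a<m. \<Sum>j<n. \<Sum>b<m. ?f (r div l) (r mod l) (s div l) (s mod l) i a j b)"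
    if "r < k*l" "s < k*l" for r s
    using that by (simp add: tensor_map_lin_map lin_map_index sum_mult_add outer_index mult_add_less tensor_coef_def)
  have "(schatten2 (tensor_map n m k l \<Phi> \<Omega> (outer (n*m) v)))\<^sup>2
      = (\<Sum>r<k*l. \<Sum>s<k*l. (cmod (tensor_map n m k l \<Phi> \<Omega> (outer (n*m) v) $$ (r,s)))\<^sup>2)"
    unfolding tensor_map_lin_map schatten2_eq[OF lin_map_carrier] by (simp add: sum_nonneg)
  also have "\<dots> = (\<Sum>r<k*l. \<Sum>s<k*l. (cmod (\<Sum>i<n. \<Sum>a<m. \<Sum>j<n. \<Sum>b<m.
      ?f (r div l) (r mod l) (s div l) (s mod l) i a j b))\<^sup>2)"
    by (simp add: e)
  also have "\<dots> = (\<Sum>r<k*l. \<Sum>s1<k. \<Sum>s2<l. (cmod (\<Sum>i<n. \<Sum>a<m. \<Sum>j<n. \<Sum>b<m.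
      ?f (r div l) (r mod l) s1 s2 i a j b))\<^sup>2)"
    by (intro sum.cong refl sum_div_mod)
  also have "\<dots> = (\<Sum>r1<k. \<Sum>r2<l. \<Sum>s1<k. \<Sum>s2<l. (cmod (\<Sum>i<n. \<Sum>a<m. \<Sum>j<n. \<Sum>b<m.
      ?f r1 r2 s1 s2 i a j b))\<^sup>2)"
    by (rule sum_div_mod)
  finally show ?thesis .
qed

text \<open>The two orders differ only in index bookkeeping. The second serves the induction over N,
  where the new unital factor stands on the right and the product so far takes the place of
  \<open>\<Omega>\<close>.\<close>

lemma tensor_pure_bound:
  assumes \<Phi>: "herm_map n k \<Phi>" "unital n k \<Phi>" "trace_preserving n \<Phi>"
    and pos: "0 < n" "0 < k" "0 < m"
    and \<Omega>: "herm_map m l \<Omega>" "kraus m l (coef m \<Omega>)" "pure_bound m \<Omega> C"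
  shows "pure_bound (n*m) (tensor_map n m k l \<Phi> \<Omega>) (sqrt (gamma n k \<Phi>) * C)"
    and "pure_bound (m*n) (tensor_map m n l k \<Omega> \<Phi>) (sqrt (gamma n k \<Phi>) * C)"
proof -
  have C0: "0 \<le> C" by (rule pure_bound_nonneg[OF \<Omega>(1,3) pos(3)])
  have g: "0 < gamma n k \<Phi>" by (rule gamma_pos[OF \<Phi> pos(1,2)])
  have fin: "x \<le> sqrt (gamma n k \<Phi>) * C * N" if "x\<^sup>2 \<le> gamma n k \<Phi> * (C * N)\<^sup>2" "0 \<le> N" for x N :: real
  proof -
    have "x\<^sup>2 \<le> (sqrt (gamma n k \<Phi>) * C * N)\<^sup>2"
      using that g by (simp add: power_mult_distrib)
    then show ?thesis using C0 g that(2) by (intro power2_le_imp_le[of x]) auto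
  qed
  show "pure_bound (n*m) (tensor_map n m k l \<Phi> \<Omega>) (sqrt (gamma n k \<Phi>) * C)"
    unfolding pure_bound_def
  proof
    fix v
    let ?f = "\<lambda>r1 r2 s1 s2 i a j b. v (i*m+a) * cnj (v (j*m+b)) * (coef n \<Phi> i j r1 s1 * coef m \<Omega> a b r2 s2)"
    have inner: "(\<Sum>i<n. \<Sum>a<m. \<Sum>j<n. \<Sum>b<m. ?f r1 r2 s1 s2 i a j b)
        = (\<Sum>i<n. \<Sum>j<n. (\<Sum>a<m. \<Sum>b<m. v (i*m+a) * cnj (v (j*m+b)) * coef m \<Omega> a b r2 s2) * coef n \<Phi> i j r1 s1)"
      for r1 r2 s1 s2
    proof -
      have "(\<Sum>i<n. \<Sum>a<m. \<Sum>j<n. \<Sum>b<m. ?f r1 r2 s1 s2 i a j b) = (\<Sum>i<n. \<Sum>j<n. \<Sum>a<m. \<Sum>b<m. ?f r1 r2 s1 s2 i a j b)"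
        by (intro sum.cong refl sum.swap)
      then show ?thesis unfolding sum_distrib_right by (simp only: mult_ac)
    qed
    let ?G = "\<lambda>r2 s2 r1 s1. (cmod (\<Sum>i<n. \<Sum>j<n. (\<Sum>a<m. \<Sum>b<m.
        v (i*m+a) * cnj (v (j*m+b)) * coef m \<Omega> a b r2 s2) * coef n \<Phi> i j r1 s1))\<^sup>2"
    have "(schatten2 (tensor_map n m k l \<Phi> \<Omega> (outer (n*m) v)))\<^sup>2 = (\<Sum>r1<k. \<Sum>r2<l. \<Sum>s1<k. \<Sum>s2<l. ?G r2 s2 r1 s1)"
      unfolding tensor_map_outer_norm inner ..
    also have "\<dots> = (\<Sum>r2<l. \<Sum>r1<k. \<Sum>s1<k. \<Sum>s2<l. ?G r2 s2 r1 s1)" by (rule sum.swap)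
    also have "\<dots> = (\<Sum>r2<l. \<Sum>s2<l. \<Sum>r1<k. \<Sum>s1<k. ?G r2 s2 r1 s1)" by (intro sum.cong refl sum_rotate)
    also have "\<dots> \<le> gamma n k \<Phi> * (C * (\<Sum>i<n. \<Sum>a<m. (cmod (v (i*m+a)))\<^sup>2))\<^sup>2"
      by (rule tensor_core_bound[OF \<Phi> pos \<Omega>])
    finally show "schatten2 (tensor_map n m k l \<Phi> \<Omega> (outer (n*m) v)) \<le> sqrt (gamma n k \<Phi>) * C * (\<Sum>p<n*m. (cmod (v p))\<^sup>2)"
      unfolding sum_mult_add[symmetric, of "\<lambda>p. (cmod (v p))\<^sup>2"] by (rule fin) (simp add: sum_nonneg)
  qed
  show "pure_bound (m*n) (tensor_map m n l k \<Omega> \<Phi>) (sqrt (gamma n k \<Phi>) * C)"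
    unfolding pure_bound_def
  proof
    fix v
    let ?f = "\<lambda>r2 r1 s2 s1 a i b j. v (a*n+i) * cnj (v (b*n+j)) * (coef m \<Omega> a b r2 s2 * coef n \<Phi> i j r1 s1)"
    have inner: "(\<Sum>a<m. \<Sum>i<n. \<Sum>b<m. \<Sum>j<n. ?f r2 r1 s2 s1 a i b j)
        = (\<Sum>i<n. \<Sum>j<n. (\<Sum>a<m. \<Sum>b<m. v (a*n+i) * cnj (v (b*n+j)) * coef m \<Omega> a b r2 s2) * coef n \<Phi> i j r1 s1)"
      for r1 r2 s1 s2
    proof -
      have "(\<Sum>a<m. \<Sum>i<n. \<Sum>b<m. \<Sum>j<n. ?f r2 r1 s2 s1 a i b j) = (\<Sum>i<n. \<Sum>a<m. \<Sum>b<m. \<Sum>j<n. ?f r2 r1 s2 s1 a i b j)"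
        by (rule sum.swap)
      also have "\<dots> = (\<Sum>i<n. \<Sum>j<n. \<Sum>a<m. \<Sum>b<m. ?f r2 r1 s2 s1 a i b j)"
        by (intro sum.cong refl sum_rotate)
      finally show ?thesis unfolding sum_distrib_right by (simp only: mult_ac)
    qed
    let ?G = "\<lambda>r2 s2 r1 s1. (cmod (\<Sum>i<n. \<Sum>j<n. (\<Sum>a<m. \<Sum>b<m.
        v (a*n+i) * cnj (v (b*n+j)) * coef m \<Omega> a b r2 s2) * coef n \<Phi> i j r1 s1))\<^sup>2"
    have "(schatten2 (tensor_map m n l k \<Omega> \<Phi> (outer (m*n) v)))\<^sup>2 = (\<Sum>r2<l. \<Sum>r1<k. \<Sum>s2<l. \<Sum>s1<k. ?G r2 s2 r1 s1)"
      unfolding tensor_map_outer_norm inner ..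
    also have "\<dots> = (\<Sum>r2<l. \<Sum>s2<l. \<Sum>r1<k. \<Sum>s1<k. ?G r2 s2 r1 s1)" by (intro sum.cong refl sum.swap)
    also have "\<dots> \<le> gamma n k \<Phi> * (C * (\<Sum>i<n. \<Sum>a<m. (cmod (v (a*n+i)))\<^sup>2))\<^sup>2"
      by (rule tensor_core_bound[OF \<Phi> pos \<Omega>])
    also have "(\<Sum>i<n. \<Sum>a<m. (cmod (v (a*n+i)))\<^sup>2) = (\<Sum>p<m*n. (cmod (v p))\<^sup>2)"
      unfolding sum_mult_add by (rule sum.swap)
    finally show "schatten2 (tensor_map m n l k \<Omega> \<Phi> (outer (m*n) v)) \<le> sqrt (gamma n k \<Phi>) * C * (\<Sum>p<m*n. (cmod (v p))\<^sup>2)"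
      by (rule fin) (simp add: sum_nonneg)
  qed
qed

section \<open>Entropies\<close>

text \<open>Tangent at 1 of a convex power, from ln x \<le> x - 1 and exp y \<ge> 1 + y.\<close>

lemma powr_ge_tangent:
  fixes x a :: real
  assumes "0 < x" "a \<le> 0"
  shows "1 + a * (x - 1) \<le> x powr a"
proof -
  have "a * (x - 1) \<le> a * ln x"
    using ln_le_minus_one[OF assms(1)] assms(2) by (intro mult_left_mono_neg)
  also have "1 + a * ln x \<le> exp (a * ln x)" by (rule exp_ge_add_one_self)
  finally show ?thesis using assms(1) by (simp add: powr_def)
qed

text \<open>Bernoulli's inequality, as the weighted arithmetic-geometric mean inequality for x and
  1.\<close>

lemma powr_le_tangent:
  fixes x a :: real
  assumes "0 < x" "0 \<le> a" "a \<le> 1"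
  shows "x powr a \<le> 1 + a * (x - 1)"
proof -
  let ?m = "1 + a * (x - 1)"
  have m: "0 < ?m"
  proof (cases "a = 1")
    case False
    then have "0 < (1 - a) + a * x" using assms by (intro add_pos_nonneg) auto
    then show ?thesis by (simp add: algebra_simps)
  qed (use assms in simp)
  \<comment> \<open>Concavity of ln at \<open>?m\<close>, the mean of x and 1 with weights a and 1 -
    a. In the weighted sum of this line and the next the tangent terms cancel.\<close>
  have "a * ln (x / ?m) \<le> a * (x / ?m - 1)"
    using assms m by (intro mult_left_mono ln_le_minus_one) auto
  moreover have "(1 - a) * ln (1 / ?m) \<le> (1 - a) * (1 / ?m - 1)"
    using assms m by (intro mult_left_mono ln_le_minus_one) auto
  moreover have "a * ln (x / ?m) + (1 - a) * ln (1 / ?m) = a * ln x - ln ?m"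
    using assms m by (simp add: ln_div algebra_simps)
  moreover have "a * (x / ?m - 1) + (1 - a) * (1 / ?m - 1) = 0"
    using m by (simp add: divide_simps) (simp add: algebra_simps)
  ultimately have "a * ln x \<le> ln ?m" by linarith
  then have "exp (a * ln x) \<le> ?m" using m by (metis exp_le_cancel_iff exp_ln)
  then show ?thesis using assms(1) by (simp add: powr_def)
qed

context
  fixes d :: "nat \<Rightarrow> real" and n :: nat
  assumes d0: "\<And>t. t < n \<Longrightarrow> 0 \<le> d t" and d1: "(\<Sum>t<n. d t) = 1"
begin

lemma purity_pos: "0 < (\<Sum>t<n. (d t)\<^sup>2)"
proof (rule ccontr)
  assume "\<not> ?thesis"
  then have "(\<Sum>t<n. (d t)\<^sup>2) = 0" by (simp add: sum_nonneg order_antisym)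
  then have "\<forall>t<n. d t = 0" by (simp add: sum_nonneg_eq_0_iff)
  then show False using d1 by simp
qed

lemma purity_le_1: "(\<Sum>t<n. (d t)\<^sup>2) \<le> 1"
proof -
  have "d t \<le> 1" if "t < n" for t
    using member_le_sum[of t "{..<n}" d] d0 d1 that by auto
  then have "(\<Sum>t<n. (d t)\<^sup>2) \<le> (\<Sum>t<n. d t)"
    using d0 by (intro sum_mono) (simp add: power2_eq_square mult_left_le)
  then show ?thesis using d1 by simp
qed

text \<open>The function \<open>x powr (\<alpha> - 1)\<close> is compared with its tangent at the purity, the \<open>d\<close>-mean of \<open>d\<close>.\<close>

lemma tangent_sum:
  defines "s \<equiv> \<Sum>t<n. (d t)\<^sup>2"
  shows "(\<Sum>t<n. d t * (c * (1 + b * (d t / s - 1)))) = c"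
proof -
  have s: "0 < s" unfolding s_def by (rule purity_pos)
  \<comment> \<open>The linear term has d-mean zero, because the squares sum to s and the weights to
    1.\<close>
  have "(\<Sum>t<n. d t * (c * (1 + b * (d t / s - 1)))) = (\<Sum>t<n. c * (1 - b) * d t + c * b / s * (d t)\<^sup>2)"
    using s by (intro sum.cong refl) (simp add: field_simps power2_eq_square)
  also have "\<dots> = c * (1 - b) * (\<Sum>t<n. d t) + c * b / s * s"
    unfolding s_def by (simp only: sum.distrib sum_distrib_left)
  finally show ?thesis using s d1 by (simp add: algebra_simps)
qed

text \<open>Rescaling by s moves the point of tangency from s to 1.\<close>

lemma powr_split:
  assumes "t < n" "d t \<noteq> 0"
  defines "s \<equiv> \<Sum>t<n. (d t)\<^sup>2"
  shows "d t powr \<alpha> = d t * (s powr (\<alpha> - 1) * (d t / s) powr (\<alpha> - 1))"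
proof -
  have "0 < s" "0 < d t" unfolding s_def using purity_pos d0[OF assms(1)] assms(2) by auto
  then show ?thesis by (simp add: powr_divide powr_diff powr_add)
qed

lemma renyi_sum_ge:
  assumes \<alpha>: "0 \<le> \<alpha>" "\<alpha> \<le> 2"
  defines "s \<equiv> \<Sum>t<n. (d t)\<^sup>2"
  shows "- ln s \<le> (if \<alpha> = 1 then - (\<Sum>t<n. d t * ln (d t)) else ln (\<Sum>t<n. d t powr \<alpha>) / (1 - \<alpha>))"
proof -
  have s: "0 < s" unfolding s_def by (rule purity_pos)
  consider "\<alpha> = 1" | "\<alpha> < 1" | "1 < \<alpha>" by linarith
  then show ?thesis
  proof cases
    case 1
    \<comment> \<open>The limiting case compares ln with its tangent at s; the piece with factor 0
      contributes nothing.\<close>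
    have "(\<Sum>t<n. d t * ln (d t)) \<le> (\<Sum>t<n. d t * (ln s + 0 * (d t / s - 1)) + d t * (1 * (d t / s - 1)))"
    proof (rule sum_mono)
      fix t assume t: "t \<in> {..<n}"
      show "d t * ln (d t) \<le> d t * (ln s + 0 * (d t / s - 1)) + d t * (1 * (d t / s - 1))"
      proof (cases "d t = 0")
        case False
        then have "0 < d t" using d0[of t] t by simp
        then have "ln (d t) \<le> ln s + (d t / s - 1)"
          using ln_le_minus_one[of "d t / s"] s by (simp add: ln_div)
        then show ?thesis using \<open>0 < d t\<close> by (simp flip: distrib_left)
      qed simp
    qed
    also have "\<dots> = (\<Sum>t<n. ln s * d t + ((d t)\<^sup>2 / s - d t))"
      using s by (intro sum.cong refl) (simp add: field_simps power2_eq_square)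
    also have "\<dots> = ln s * (\<Sum>t<n. d t) + (s / s - (\<Sum>t<n. d t))"
      unfolding s_def by (simp only: sum.distrib sum_subtractf sum_distrib_left sum_divide_distrib)
    also have "\<dots> = ln s" using s d1 by simp
    finally show ?thesis using 1 by simp
  next
    case 2
    \<comment> \<open>The exponent \<alpha> - 1 is negative, so the power is convex and lies above
      its tangent; dividing by 1 - \<alpha> > 0 keeps the direction.\<close>
    have "s powr (\<alpha> - 1) = (\<Sum>t<n. d t * (s powr (\<alpha> - 1) * (1 + (\<alpha> - 1) * (d t / s - 1))))"
      unfolding s_def by (rule tangent_sum[symmetric])
    also have "\<dots> \<le> (\<Sum>t<n. d t powr \<alpha>)"
    proof (rule sum_mono)
      fix t assume t: "t \<in> {..<n}"
      show "d t * (s powr (\<alpha> - 1) * (1 + (\<alpha> - 1) * (d t / s - 1))) \<le> d t powr \<alpha>"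
      \<comment> \<open>A zero eigenvalue contributes 0 on both sides, also for \<alpha> = 0, since
        0 powr 0 = 0.\<close>
      proof (cases "d t = 0")
        case False
        then have "0 < d t" using d0[of t] t by simp
        then show ?thesis
          using powr_split[of t \<alpha>] t False powr_ge_tangent[of "d t / s" "\<alpha> - 1"] 2 s
          by (auto simp: s_def[symmetric] intro!: mult_left_mono)
      qed simp
    qed
    finally have "ln (s powr (\<alpha> - 1)) \<le> ln (\<Sum>t<n. d t powr \<alpha>)"
      using s by (intro ln_mono) auto
    then have "(\<alpha> - 1) * ln s \<le> ln (\<Sum>t<n. d t powr \<alpha>)" using s by (simp add: ln_powr)
    then show ?thesis using 2 by (simp add: pos_le_divide_eq algebra_simps)
  next
    case 3
    \<comment> \<open>Now 0 < \<alpha> - 1 \<le> 1, which is where \<alpha> \<le> 2 enters: the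
      power is concave and lies below its tangent, and dividing by the negative 1 - \<alpha>
      reverses the inequality.\<close>
    have "(\<Sum>t<n. d t powr \<alpha>) \<le> (\<Sum>t<n. d t * (s powr (\<alpha> - 1) * (1 + (\<alpha> - 1) * (d t / s - 1))))"
    proof (rule sum_mono)
      fix t assume t: "t \<in> {..<n}"
      show "d t powr \<alpha> \<le> d t * (s powr (\<alpha> - 1) * (1 + (\<alpha> - 1) * (d t / s - 1)))"
      proof (cases "d t = 0")
        case False
        then have "0 < d t" using d0[of t] t by simp
        then show ?thesis
          using powr_split[of t \<alpha>] t False powr_le_tangent[of "d t / s" "\<alpha> - 1"] 3 \<alpha> s
          by (auto simp: s_def[symmetric] intro!: mult_left_mono)
      qed simp
    qed
    also have "\<dots> = s powr (\<alpha> - 1)" unfolding s_def by (rule tangent_sum)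
    finally have le: "(\<Sum>t<n. d t powr \<alpha>) \<le> s powr (\<alpha> - 1)" .
    have "\<exists>t<n. d t \<noteq> 0" using d1 by (metis lessThan_iff sum.neutral zero_neq_one)
    then have "0 < (\<Sum>t<n. d t powr \<alpha>)" by (auto intro!: sum_pos2)
    then have "ln (\<Sum>t<n. d t powr \<alpha>) \<le> ln (s powr (\<alpha> - 1))" using le s by (intro ln_mono) auto
    then have "ln (\<Sum>t<n. d t powr \<alpha>) \<le> (\<alpha> - 1) * ln s" using s by (simp add: ln_powr)
    then show ?thesis using 3 by (simp add: neg_le_divide_eq algebra_simps)
  qed
qed

end

section \<open>Density matrices and minimal output entropies\<close>

lemma density_spectrum:
  assumes "\<sigma> \<in> density k"
  obtains U d where "spectral_rep k \<sigma> U d" "\<And>t. t < k \<Longrightarrow> 0 \<le> d t" "(\<Sum>t<k. d t) = 1"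
proof -
  have p: "\<sigma> \<in> psd k" "\<sigma> \<in> herm k" "mtrace \<sigma> = 1" using assms by (auto simp: density_def psd_def)
  obtain U d where Ud: "spectral_rep k \<sigma> U d" using spectral_theorem[OF p(2)] by blast
  have "(\<Sum>t<k. d t) = 1" using spectral_rep_trace[OF Ud] p(3) by (metis of_real_eq_1_iff)
  then show ?thesis using that[OF Ud] spectral_rep_psd_nonneg[OF Ud p(1)] by blast
qed

lemma renyi_ge:
  assumes "\<sigma> \<in> density k" "0 \<le> \<alpha>" "\<alpha> \<le> 2"
  shows "- ln ((schatten2 \<sigma>)\<^sup>2) \<le> renyi \<alpha> \<sigma>"
proof -
  obtain U d where Ud: "spectral_rep k \<sigma> U d" "\<And>t. t < k \<Longrightarrow> 0 \<le> d t" "(\<Sum>t<k. d t) = 1"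
    using density_spectrum[OF assms(1)] by blast
  show ?thesis
    unfolding renyi_def schatten2_spectral[OF Ud(1)] spectral_rep_eigvals[OF Ud(1), of "\<lambda>x. x * ln x"]
      spectral_rep_eigvals[OF Ud(1), of "\<lambda>x. x powr \<alpha>"]
    by (rule renyi_sum_ge[OF Ud(2,3) assms(2,3)])
qed

text \<open>Positivity of the norm licenses taking logarithms; the bound by 1 keeps the set of
  entropies bounded below.\<close>

lemma renyi_2:
  assumes "\<sigma> \<in> density k"
  shows "renyi 2 \<sigma> = - ln ((schatten2 \<sigma>)\<^sup>2)"
    and "0 < schatten2 \<sigma>" and "schatten2 \<sigma> \<le> 1"
proof -
  obtain U d where Ud: "spectral_rep k \<sigma> U d" "\<And>t. t < k \<Longrightarrow> 0 \<le> d t" "(\<Sum>t<k. d t) = 1"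
    using density_spectrum[OF assms] by blast
  have "(\<Sum>t<k. d t powr 2) = (\<Sum>t<k. (d t)\<^sup>2)"
    using Ud(2) by (intro sum.cong refl) (auto simp: powr_numeral)
  then show "renyi 2 \<sigma> = - ln ((schatten2 \<sigma>)\<^sup>2)"
    unfolding renyi_def schatten2_spectral[OF Ud(1)] spectral_rep_eigvals[OF Ud(1), of "\<lambda>x. x powr 2"] by simp
  have nn: "0 \<le> schatten2 \<sigma>" using Ud(1) schatten2_nonneg unfolding spectral_rep_def by blast
  have "0 < (schatten2 \<sigma>)\<^sup>2" unfolding schatten2_spectral[OF Ud(1)] by (rule purity_pos[OF Ud(2,3)])
  then show "0 < schatten2 \<sigma>" using nn by (simp add: order_le_neq_trans)
  have "(schatten2 \<sigma>)\<^sup>2 \<le> 1" unfolding schatten2_spectral[OF Ud(1)] by (rule purity_le_1[OF Ud(2,3)])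
  then show "schatten2 \<sigma> \<le> 1" using nn by (simp add: power2_le_imp_le[of _ 1])
qed

lemma outer_density:
  assumes "(\<Sum>i<n. (cmod (v i))\<^sup>2) = 1"
  shows "outer n v \<in> density n"
  using assms outer_psd by (simp add: density_def mtrace_outer)

lemma density_nonempty:
  assumes "0 < n"
  shows "density n \<noteq> {}"
proof -
  have "(\<Sum>i<n. (cmod (delta 0 i))\<^sup>2) = 1"
    using assms by (simp add: delta_def if_distrib[of cmod] if_distrib[of "\<lambda>x. x\<^sup>2"] cong: if_cong)
  then show ?thesis using outer_density by blast
qed

lemma S_min_ge:
  assumes q: "quantum_channel n k \<Psi>" and n: "0 < n" and b: "pure_bound n \<Psi> C" and \<alpha>: "0 \<le> \<alpha>" "\<alpha> \<le> 2"
  shows "- ln (C\<^sup>2) \<le> S_min n \<alpha> \<Psi>"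
  unfolding S_min_def
proof (rule cInf_greatest)
  show "{renyi \<alpha> (\<Psi> \<rho>) |\<rho>. \<rho> \<in> density n} \<noteq> {}" using density_nonempty[OF n] by blast
next
  fix x assume "x \<in> {renyi \<alpha> (\<Psi> \<rho>) |\<rho>. \<rho> \<in> density n}"
  then obtain \<rho> where x: "x = renyi \<alpha> (\<Psi> \<rho>)" and \<rho>: "\<rho> \<in> density n" by blast
  have h: "herm_map n k \<Psi>" using q by (simp add: quantum_channel_def)
  have d: "\<Psi> \<rho> \<in> density k" by (rule quantum_channel_density[OF q n \<rho>])
  have p: "\<rho> \<in> psd n" "\<rho> \<in> herm n" "mtrace \<rho> = 1" using \<rho> by (auto simp: density_def psd_def)
  have "schatten2 (\<Psi> \<rho>) \<le> C"
    using pure_bound_schatten1[OF h b p(2)] p by (simp add: schatten1_psd)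
  then have "(schatten2 (\<Psi> \<rho>))\<^sup>2 \<le> C\<^sup>2" using renyi_2(2)[OF d] by (intro power_mono) auto
  then have "ln ((schatten2 (\<Psi> \<rho>))\<^sup>2) \<le> ln (C\<^sup>2)" using renyi_2(2)[OF d] by (intro ln_mono) auto
  then show "- ln (C\<^sup>2) \<le> x" using renyi_ge[OF d \<alpha>] x by linarith
qed

text \<open>The 2-entropy is -2 times the logarithm of the Hilbert-Schmidt norm, so a lower bound S
  on it caps output norms at exp(-S/2).\<close>

lemma pure_bound_S_min:
  assumes q: "quantum_channel n k \<Psi>" and n: "0 < n"
  shows "pure_bound n \<Psi> (exp (- S_min n 2 \<Psi> / 2))"
  unfolding pure_bound_def
proof
  fix v
  let ?N = "\<Sum>i<n. (cmod (v i))\<^sup>2" and ?S = "S_min n 2 \<Psi>"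
  have h: "herm_map n k \<Psi>" using q by (simp add: quantum_channel_def)
  show "schatten2 (\<Psi> (outer n v)) \<le> exp (- ?S / 2) * ?N"
  proof (cases "?N = 0")
    case True
    then show ?thesis
      using outer_eq_zero[OF True] by (simp add: herm_map_zero[OF h] schatten2_eq[of _ k k])
  next
    case False
    then have N: "0 < ?N" by (simp add: sum_nonneg order_le_neq_trans)
    \<comment> \<open>Entropies are defined on states, so v is normalised and the bound carried back
      by homogeneity.\<close>
    define w where "w i = v i / complex_of_real (sqrt ?N)" for i
    have "(\<Sum>i<n. (cmod (w i))\<^sup>2) = ?N / ?N"
      unfolding w_def sum_divide_distrib using N by (simp add: norm_divide power_divide)
    then have w: "outer n w \<in> density n" using N by (intro outer_density) simp
    have sq: "complex_of_real (sqrt ?N) * complex_of_real (sqrt ?N) = complex_of_real ?N"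
      using N by (simp only: of_real_mult[symmetric] real_sqrt_mult_self abs_of_pos)
    have "outer n v = complex_of_real ?N \<cdot>\<^sub>m outer n w"
      unfolding sq[symmetric] using N
      by (intro mat_cong[of _ n]) (auto simp: outer_index w_def outer_def)
    then have e: "schatten2 (\<Psi> (outer n v)) = ?N * schatten2 (\<Psi> (outer n w))"
      using schatten2_smult[OF herm_carrier[OF herm_map_herm[OF h outer_herm]]] N
      by (simp add: herm_map_smult[OF h outer_herm] del: of_real_sum)
    have d: "\<Psi> \<rho> \<in> density k" if "\<rho> \<in> density n" for \<rho> by (rule quantum_channel_density[OF q n that])
    have "?S \<le> renyi 2 (\<Psi> (outer n w))"
      unfolding S_min_def
    proof (rule cInf_lower)
      \<comment> \<open>A purity is at most 1; this makes the infimum a genuine lower bound.\<close>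
      have "0 \<le> renyi 2 (\<Psi> \<rho>)" if "\<rho> \<in> density n" for \<rho>
        using renyi_2[OF d[OF that]] by (simp add: power_le_one)
      then show "bdd_below {renyi 2 (\<Psi> \<rho>) |\<rho>. \<rho> \<in> density n}" by (intro bdd_belowI[of _ 0]) blast
    qed (use w in blast)
    also have "\<dots> = - 2 * ln (schatten2 (\<Psi> (outer n w)))"
      using renyi_2[OF d[OF w]] by (simp add: ln_realpow)
    finally have "ln (schatten2 (\<Psi> (outer n w))) \<le> - ?S / 2" by simp
    then have "schatten2 (\<Psi> (outer n w)) \<le> exp (- ?S / 2)"
      using renyi_2(2)[OF d[OF w]] by (metis exp_le_cancel_iff exp_ln)
    then show ?thesis unfolding e using N by (simp add: mult.commute mult_left_mono del: of_real_sum)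
  qed
qed

lemma identity_channel: "quantum_channel n n (\<lambda>X. X)"
  by (auto simp: quantum_channel_def herm_map_def trace_preserving_def
      intro!: kraus_imp_completely_positive kraus_id)

text \<open>The two claims are proved together: the step for the norm uses a Kraus form of the
  product so far, which comes from its being a channel.\<close>

lemma tensor_family_channel_bound:
  assumes "\<And>i. i < N \<Longrightarrow> 0 < nn i \<and> 0 < kk i \<and> quantum_channel (nn i) (kk i) (Phi i) \<and> unital (nn i) (kk i) (Phi i)"
  shows "quantum_channel (\<Prod>i<N. nn i) (\<Prod>i<N. kk i) (tensor_family N nn kk Phi) \<and>
    pure_bound (\<Prod>i<N. nn i) (tensor_family N nn kk Phi) (\<Prod>i<N. sqrt (gamma (nn i) (kk i) (Phi i)))"
  using assms
proof (induction N)
  case 0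
  \<comment> \<open>The empty product is the identity on 1 x 1 matrices, with constant 1.\<close>
  have "schatten2 (outer 1 v) = (cmod (v 0))\<^sup>2" for v
    by (simp add: schatten2_eq[OF outer_carrier] outer_index norm_mult power2_eq_square)
  then show ?case using identity_channel[of 1] by (simp add: pure_bound_def)
next
  case (Suc N)
  let ?n = "\<Prod>i<N. nn i" and ?k = "\<Prod>i<N. kk i" and ?F = "tensor_family N nn kk Phi"
  let ?C = "\<Prod>i<N. sqrt (gamma (nn i) (kk i) (Phi i))"
  have n: "0 < ?n" using Suc.prems by (auto intro!: prod_pos)
  have F: "quantum_channel ?n ?k ?F" "pure_bound ?n ?F ?C" using Suc by auto
  have P: "0 < nn N" "0 < kk N" "quantum_channel (nn N) (kk N) (Phi N)" "unital (nn N) (kk N) (Phi N)"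
    using Suc.prems[of N] by auto
  have "quantum_channel (?n * nn N) (?k * kk N) (tensor_map ?n (nn N) ?k (kk N) ?F (Phi N))"
    by (rule quantum_channel_tensor[OF F(1) P(3) n P(1)])
  moreover have "pure_bound (?n * nn N) (tensor_map ?n (nn N) ?k (kk N) ?F (Phi N)) (sqrt (gamma (nn N) (kk N) (Phi N)) * ?C)"
    using F P n completely_positive_imp_kraus[OF _ n]
    by (intro tensor_pure_bound(2)) (auto simp: quantum_channel_def)
  ultimately show ?case by (simp add: mult.commute)
qed

theorem theorem10:
  shows
  "(\<forall>(n::nat) (k::nat) (m::nat) (l::nat) \<Phi> \<Omega>.
       0 < n \<and> 0 < k \<and> 0 < m \<and> 0 < l \<and>
       herm_map n k \<Phi> \<and> unital n k \<Phi> \<and> trace_preserving n \<Phi> \<and>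
       herm_map m l \<Omega> \<and> completely_positive m l \<Omega> \<longrightarrow>
         norm_1to2 (n*m) (tensor_map n m k l \<Phi> \<Omega>) \<le> sqrt (gamma n k \<Phi>) * norm_1to2 m \<Omega> \<and>
         (quantum_channel n k \<Phi> \<and> quantum_channel m l \<Omega> \<longrightarrow>
           (\<forall>\<alpha>::real. 0 \<le> \<alpha> \<and> \<alpha> \<le> 2 \<longrightarrow>
              S_min (n*m) \<alpha> (tensor_map n m k l \<Phi> \<Omega>) \<ge> - ln (gamma n k \<Phi>) + S_min m 2 \<Omega>)))
   \<and>
   (\<forall>(N::nat) (nn::nat \<Rightarrow> nat) (kk::nat \<Rightarrow> nat) Phi.
       1 \<le> N \<and> (\<forall>i<N. 0 < nn i \<and> 0 < kk i \<and> quantum_channel (nn i) (kk i) (Phi i) \<and> unital (nn i) (kk i) (Phi i)) \<longrightarrow>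
         norm_1to2 (\<Prod>i<N. nn i) (tensor_family N nn kk Phi) \<le> (\<Prod>i<N. sqrt (gamma (nn i) (kk i) (Phi i))) \<and>
         (\<forall>\<alpha>::real. 0 \<le> \<alpha> \<and> \<alpha> \<le> 2 \<longrightarrow>
            S_min (\<Prod>i<N. nn i) \<alpha> (tensor_family N nn kk Phi) \<ge> - (\<Sum>i<N. ln (gamma (nn i) (kk i) (Phi i)))))"
proof (intro conjI allI impI, goal_cases)
  case (1 n k m l \<Phi> \<Omega>)
  then have a: "herm_map n k \<Phi>" "unital n k \<Phi>" "trace_preserving n \<Phi>" "0 < n" "0 < k" "0 < m"
    "herm_map m l \<Omega>" and kr: "kraus m l (coef m \<Omega>)"
    using completely_positive_imp_kraus by auto
  have "0 < n * m" using a by simp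
  then show ?case
    by (rule norm_1to2_le[OF herm_map_tensor[OF a(1,7)] tensor_pure_bound(1)[OF a kr pure_bound_norm[OF a(7,6)]]])
next
  case (2 n k m l \<Phi> \<Omega> \<alpha>)
  then have a: "herm_map n k \<Phi>" "unital n k \<Phi>" "trace_preserving n \<Phi>" "0 < n" "0 < k" "0 < m"
    "herm_map m l \<Omega>" and kr: "kraus m l (coef m \<Omega>)" and q: "quantum_channel n k \<Phi>" "quantum_channel m l \<Omega>"
    and \<alpha>: "0 \<le> \<alpha>" "\<alpha> \<le> 2"
    using completely_positive_imp_kraus by auto
  have g: "0 < gamma n k \<Phi>" by (rule gamma_pos[OF a(1-5)])
  have nm: "0 < n * m" using a by simp
  let ?S = "S_min m 2 \<Omega>"
  \<comment> \<open>The constant for \<open>\<Omega>\<close> is exp(-S/2); its square contributes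
    exp(-S), hence the summand S.\<close>
  have "- ln ((sqrt (gamma n k \<Phi>) * exp (- ?S / 2))\<^sup>2) \<le> S_min (n*m) \<alpha> (tensor_map n m k l \<Phi> \<Omega>)"
    by (rule S_min_ge[OF quantum_channel_tensor[OF q a(4,6)] nm
          tensor_pure_bound(1)[OF a kr pure_bound_S_min[OF q(2) a(6)]] \<alpha>])
  also have "(sqrt (gamma n k \<Phi>) * exp (- ?S / 2))\<^sup>2 = gamma n k \<Phi> * exp (- ?S)"
    using g by (simp add: power_mult_distrib exp_double[symmetric])
  finally show ?case using g by (simp add: ln_mult)
next
  case (3 N nn kk Phi)
  then have "quantum_channel (\<Prod>i<N. nn i) (\<Prod>i<N. kk i) (tensor_family N nn kk Phi)"
    "pure_bound (\<Prod>i<N. nn i) (tensor_family N nn kk Phi) (\<Prod>i<N. sqrt (gamma (nn i) (kk i) (Phi i)))"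
    "0 < (\<Prod>i<N. nn i)"
    using tensor_family_channel_bound[of N nn kk Phi] by (auto intro!: prod_pos)
  then show ?case using norm_1to2_le unfolding quantum_channel_def by blast
next
  case (4 N nn kk Phi \<alpha>)
  let ?g = "\<lambda>i. gamma (nn i) (kk i) (Phi i)"
  have q: "quantum_channel (\<Prod>i<N. nn i) (\<Prod>i<N. kk i) (tensor_family N nn kk Phi)"
    "pure_bound (\<Prod>i<N. nn i) (tensor_family N nn kk Phi) (\<Prod>i<N. sqrt (?g i))"
    "0 < (\<Prod>i<N. nn i)"
    using 4 tensor_family_channel_bound[of N nn kk Phi] by (auto intro!: prod_pos)
  have g: "0 < ?g i" if "i < N" for i
    using 4 that by (intro gamma_pos) (auto simp: quantum_channel_def)
  have "- ln ((\<Prod>i<N. sqrt (?g i))\<^sup>2) \<le> S_min (\<Prod>i<N. nn i) \<alpha> (tensor_family N nn kk Phi)"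
    using 4 by (intro S_min_ge[OF q(1,3,2)]) auto
  also have "(\<Prod>i<N. sqrt (?g i))\<^sup>2 = (\<Prod>i<N. ?g i)"
    unfolding prod_power_distrib using g by (intro prod.cong refl) (simp add: less_imp_le)
  also have "ln (\<Prod>i<N. ?g i) = (\<Sum>i<N. ln (?g i))"
    by (intro ln_prod) (auto simp: g[THEN less_imp_neq, THEN not_sym])
  finally show ?case .
qed

end
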